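(* Let $\mathcal{X},\mathcal{Y},\mathcal{V}$ be finite alphabets, let $P$ be a probability distribution on $\mathcal{X}$ with full support, and let $X^n$ be i.i.d. with distribution $P$. Let $d:\mathcal{X}\times\mathcal{Y}\to\mathbb{R}_+$ and $d_e:\mathcal{X}\times\mathcal{V}\to\mathbb{R}_+$ be (bounded) distortion functions, $D\ge D_{\min}:=\max_{x}\min_{y}d(x,y)$, $D_e\ge D_{e,\min}:=\max_x\min_v d_e(x,v)$. Let $\alpha>0$ (reliability exponent), $r>0$ (key rate), and let the channel rate $R$ satisfy $R>R_\alpha:=\max_{Q:\,D(Q\|P)\le\alpha}R(Q,D)$. Write $\overrightarrow{D}=(D,D_e)$ and $\overrightarrow{R}=(R,r)$. Let $E(P,\overrightarrow{D},\overrightarrow{R},\alpha)$ be the optimal exponent $$E(P,\overrightarrow{D},\overrightarrow{R},\alpha)=\lim_{n\to\infty}\max_{f_n}\min_{g_n}-\frac1n\log\Pr\Big(d_e\big(X^n,g_n(f_n(X^n,K))\big)\le D_e\Big)$$ of the Shannon cipher system with lossy communication (described in the context). Then the limit exists and $$E(P,\overrightarrow{D},\overrightarrow{R},\alpha)=\min\Big\{E_0(P,D_e),\ \ r+\min_{Q:\,D(Q\|P)\le\alpha}\big[D(Q\|P)+R(Q,R,D,D_e)\big]\Big\},$$ where $Q$ ranges over probability distributions on $\mathcal{X}$.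
   Context: All logarithms are base 2. $D(Q\|P)$ is the Kullback-Leibler divergence. For sequences, $d(x^n,y^n)=\frac1n\sum_i d(x_i,y_i)$ and $d_e(x^n,v^n)=\frac1n\sum_i d_e(x_i,v_i)$. System: the key $K$ is uniformly distributed on $\mathcal{K}=\{0,1\}^{nr}$ and independent of $X^n$. The transmitter sends $M=f_n(X^n,K)\in\mathcal{M}=\{0,1\}^{nR}$, and the legitimate receiver forms $Y^n=h_n(M,K)\in\mathcal{Y}^n$; $f_n$ and $h_n$ may be stochastic. (As usual, $nr$ and $nR$ are treated as integers, i.e. up to rounding.) The maximum over $f_n$ is over those encoders for which there is a decoder $h_n$ with $\Pr(d(X^n,Y^n)>D)\le 2^{-n\alpha}$. The eavesdropper sees $M$ but not $K$, knows $P,f_n,h_n$, and outputs $V^n=g_n(M)\in\mathcal{V}^n$; $g_n$ ranges over all functions $\mathcal{M}\to\mathcal{V}^n$ and may depend on $P,f_n,h_n$. Rate-distortion functions: $R(Q,D)=\min_{P_{Y|X}:\mathbf{E}[d(X,Y)]\le D}I(X;Y)$ and $R_e(Q,D_e)=\min_{P_{V|X}:\mathbf{E}[d_e(X,V)]\le D_e}I(X;V)$, with $X\sim Q$. For a joint distribution $P_{XY}$, $R(P_{XY},D_e)=\min_{P_{V|X,Y}:\,\mathbf{E}[d_e(X,V)]\le D_e}I(X;V|Y)$. For $P_X$ with $R(P_X,D)\le R$, $$R(P_X,R,D,D_e)=\max_{P_{Y|X}:\ \mathbf{E}[d(X,Y)]\le D,\ I(X;Y)\le R}R(P_XP_{Y|X},D_e).$$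 The perfect secrecy exponent is $E_0(P,D_e)=\min_Q\,[D(Q\|P)+R_e(Q,D_e)]$, with $Q$ ranging over all probability distributions on $\mathcal{X}$. *)

theory Defs
  imports "HOL-Probability.Probability" "HOL-Probability.Information"
begin

text \<open>
  Alphabets are finite types, distributions are of type \<open>'a pmf\<close>, and stochastic maps
  (channels, encoders, decoders) are functions into \<open>pmf\<close>. Sequences are lists of a given length.
  A minimum or maximum over an infinite set of distributions, channels or codes is written as
  \<open>INF\<close> or \<open>SUP\<close>.
\<close>

section \<open>Information measures and rate-distortion functions\<close>

text \<open>
  The library writes the reference measure first: \<open>KL_divergence b M N\<close> is the divergence of \<open>N\<close>
  from \<open>M\<close>. Hence the order of the arguments is swapped here. The value is meaningful when
  \<open>Q\<close> is absolutely continuous with respect to \<open>P\<close>, in particular when \<open>P\<close> has full support.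
\<close>

definition KL :: "'a pmf \<Rightarrow> 'a pmf \<Rightarrow> real" where
  "KL Q P = KL_divergence 2 (measure_pmf P) (measure_pmf Q)"

definition mutual_info :: "('a \<times> 'b) pmf \<Rightarrow> real" where
  "mutual_info J =
     prob_space.mutual_information (measure_pmf J) 2 (count_space UNIV) (count_space UNIV) fst snd"

text \<open>For \<open>((X, Y), V)\<close> distributed according to \<open>J\<close>, this is \<open>I(X; V | Y)\<close>.\<close>

definition cond_mutual_info :: "(('a \<times> 'b) \<times> 'c) pmf \<Rightarrow> real" where
  "cond_mutual_info J =
     prob_space.conditional_mutual_information (measure_pmf J) 2
       (count_space UNIV) (count_space UNIV) (count_space UNIV)
       (\<lambda>((x, y), v). x) (\<lambda>((x, y), v). v) (\<lambda>((x, y), v). y)"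

definition joint_pmf :: "'a pmf \<Rightarrow> ('a \<Rightarrow> 'b pmf) \<Rightarrow> ('a \<times> 'b) pmf" where
  "joint_pmf Q W = do {x \<leftarrow> Q; y \<leftarrow> W x; return_pmf (x, y)}"

definition rate_dist :: "('a \<Rightarrow> 'b \<Rightarrow> real) \<Rightarrow> 'a pmf \<Rightarrow> real \<Rightarrow> real" where
  "rate_dist d Q D =
     (INF W \<in> {W. measure_pmf.expectation (joint_pmf Q W) (\<lambda>(x, y). d x y) \<le> D}.
        mutual_info (joint_pmf Q W))"

text \<open>Rate-distortion function with the second component of the source known on both sides.\<close>

definition cond_rate_dist :: "('x \<Rightarrow> 'v \<Rightarrow> real) \<Rightarrow> ('x \<times> 'y) pmf \<Rightarrow> real \<Rightarrow> real" where
  "cond_rate_dist d_e J D_e =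
     (INF W \<in> {W. measure_pmf.expectation (joint_pmf J W) (\<lambda>((x, y), v). d_e x v) \<le> D_e}.
        cond_mutual_info (joint_pmf J W))"

definition max_cond_rate_dist ::
  "('x \<Rightarrow> 'y \<Rightarrow> real) \<Rightarrow> ('x \<Rightarrow> 'v \<Rightarrow> real) \<Rightarrow> 'x pmf \<Rightarrow> real \<Rightarrow> real \<Rightarrow> real \<Rightarrow> real" where
  "max_cond_rate_dist d d_e Q R D D_e =
     (SUP W \<in> {W. measure_pmf.expectation (joint_pmf Q W) (\<lambda>(x, y). d x y) \<le> D
                  \<and> mutual_info (joint_pmf Q W) \<le> R}.
        cond_rate_dist d_e (joint_pmf Q W) D_e)"

definition perfect_secrecy_exponent :: "('x \<Rightarrow> 'v \<Rightarrow> real) \<Rightarrow> 'x pmf \<Rightarrow> real \<Rightarrow> real" where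
  "perfect_secrecy_exponent d_e P D_e = (INF Q. KL Q P + rate_dist d_e Q D_e)"


section \<open>The cipher system\<close>

definition seqs :: "nat \<Rightarrow> 'a list set" where
  "seqs n = {xs. length xs = n}"

definition bits :: "nat \<Rightarrow> real \<Rightarrow> bool list set" where
  "bits n \<rho> = seqs (nat \<lfloor>real n * \<rho>\<rfloor>)"

definition seq_dist :: "nat \<Rightarrow> ('a \<Rightarrow> 'b \<Rightarrow> real) \<Rightarrow> 'a list \<Rightarrow> 'b list \<Rightarrow> real" where
  "seq_dist n d xs ys = (\<Sum>i<n. d (xs ! i) (ys ! i)) / real n"

definition encoders :: "nat \<Rightarrow> real \<Rightarrow> real \<Rightarrow> ('x list \<Rightarrow> bool list \<Rightarrow> bool list pmf) set" where
  "encoders n R r = {f. \<forall>xs \<in> seqs n. \<forall>k \<in> bits n r. set_pmf (f xs k) \<subseteq> bits n R}"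

definition decoders :: "nat \<Rightarrow> real \<Rightarrow> real \<Rightarrow> (bool list \<Rightarrow> bool list \<Rightarrow> 'y list pmf) set" where
  "decoders n R r = {h. \<forall>m \<in> bits n R. \<forall>k \<in> bits n r. set_pmf (h m k) \<subseteq> seqs n}"

text \<open>Joint distribution of the source sequence, the key and the message.\<close>

definition cipher_pmf ::
  "nat \<Rightarrow> 'x pmf \<Rightarrow> real \<Rightarrow> ('x list \<Rightarrow> bool list \<Rightarrow> bool list pmf)
     \<Rightarrow> ('x list \<times> bool list \<times> bool list) pmf" where
  "cipher_pmf n P r f =
     do {xs \<leftarrow> replicate_pmf n P; k \<leftarrow> pmf_of_set (bits n r); m \<leftarrow> f xs k;
         return_pmf (xs, k, m)}"

definition excess_dist_prob ::
  "nat \<Rightarrow> ('x \<Rightarrow> 'y \<Rightarrow> real) \<Rightarrow> 'x pmf \<Rightarrow> real \<Rightarrow> real \<Rightarrow> ('x list \<Rightarrow> bool list \<Rightarrow> bool list pmf)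
     \<Rightarrow> (bool list \<Rightarrow> bool list \<Rightarrow> 'y list pmf) \<Rightarrow> real" where
  "excess_dist_prob n d P D r f h =
     measure_pmf.prob
       (do {(xs, k, m) \<leftarrow> cipher_pmf n P r f; ys \<leftarrow> h m k; return_pmf (xs, ys)})
       {(xs, ys). seq_dist n d xs ys > D}"

definition reliable_encoders ::
  "nat \<Rightarrow> ('x \<Rightarrow> 'y \<Rightarrow> real) \<Rightarrow> 'x pmf \<Rightarrow> real \<Rightarrow> real \<Rightarrow> real \<Rightarrow> real
     \<Rightarrow> ('x list \<Rightarrow> bool list \<Rightarrow> bool list pmf) set" where
  "reliable_encoders n d P D R r \<alpha> =
     {f \<in> encoders n R r. \<exists>h \<in> decoders n R r.
        excess_dist_prob n d P D r f h \<le> 2 powr (- (real n * \<alpha>))}"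

definition eavesdropper_prob ::
  "nat \<Rightarrow> ('x \<Rightarrow> 'v \<Rightarrow> real) \<Rightarrow> 'x pmf \<Rightarrow> real \<Rightarrow> real \<Rightarrow> ('x list \<Rightarrow> bool list \<Rightarrow> bool list pmf)
     \<Rightarrow> (bool list \<Rightarrow> 'v list) \<Rightarrow> real" where
  "eavesdropper_prob n d_e P D_e r f g =
     measure_pmf.prob (cipher_pmf n P r f) {(xs, k, m). seq_dist n d_e xs (g m) \<le> D_e}"

text \<open>
  Since \<open>log 2 0 = 0\<close> in the library, a success probability of zero must be given the exponent
  \<open>\<infinity>\<close> explicitly; otherwise such estimators would be optimal for the eavesdropper.
\<close>

definition prob_exponent :: "nat \<Rightarrow> real \<Rightarrow> ereal" where
  "prob_exponent n p = (if p = 0 then \<infinity> else ereal (- (1 / real n) * log 2 p))"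

definition secrecy_exponent ::
  "('x \<Rightarrow> 'y \<Rightarrow> real) \<Rightarrow> ('x \<Rightarrow> 'v \<Rightarrow> real) \<Rightarrow> 'x pmf
     \<Rightarrow> real \<Rightarrow> real \<Rightarrow> real \<Rightarrow> real \<Rightarrow> real \<Rightarrow> nat \<Rightarrow> ereal" where
  "secrecy_exponent d d_e P D D_e R r \<alpha> n =
     (SUP f \<in> reliable_encoders n d P D R r \<alpha>.
        INF g \<in> (bits n R \<rightarrow> seqs n).
          prob_exponent n (eavesdropper_prob n d_e P D_e r f g))"

end

theory Submission
  imports Defs "HOL-Real_Asymp.Real_Asymp"
begin

text \<open>
  The proof uses the method of types. Permutation symmetry gives the exact number of sequences that
  have a prescribed joint type with given ones, and Stirling's bounds turn these numbers into
  entropies.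

  For the achievability part, every source type \<open>Q\<close> with \<open>KL Q P \<le> \<alpha> + o(1)\<close> gets, for each key
  separately, its own random codebook of reproductions of a joint type \<open>J\<close>; the encoder picks uniformly
  among the messages whose codeword has joint type \<open>J\<close> with the source sequence. Such an encoder makes
  no error on these types, and the others have total probability at most \<open>2 powr (- n * \<alpha>)\<close>. Given the
  message, an eavesdropper either gains nothing over a blind guess of the source type, or has to find
  the right key and then guess the source given the reproduction.

  For the converse, the eavesdropper guesses either blindly, or the key first and then an estimate
  that is uniform in a conditional type class given the decoded reproduction.

  All optimisations are transferred from types to arbitrary distributions by compactness. The
  constraint sets behave well at the minimal distortion level because the distortion thresholds are
  worst-case ones: each letter has an admissible reproduction.
\<close>

text \<open>Every margin is bought by a strict inequality. The types served by the code must reach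
  1/m beyond divergence \<alpha>: the polynomially many others must together weigh at most
  \<open>2 powr (- (real n * \<alpha>))\<close>, with no loss allowed. The joint types must stay 1/m
  below rate R, which pays for dividing the messages among the types and for random coding. Both
  margins come from one compactness argument, and R > R_alpha is what makes it work. In the converse
  the attacked type needs divergence strictly below \<alpha>, so that its probability exceeds the
  permitted error; a small mixture with P provides this.

  The two terms of the minimum come from one exponential-moment bound. Fix a message and an
  estimate, and add up over the independent keys the numbers of source sequences that are hit. With
  a probability that survives the union bound over messages and estimates, the sum is at most twice
  its mean plus the largest possible summand times a factor linear in n. After division by the
  number of keys the mean gives \<open>rate_dist\<close>, and the largest summand gives r plus
  \<open>cond_rate_dist\<close>.\<close>

lemma sum_pmf_UNIV [simp]: "(\<Sum>a\<in>UNIV. pmf p (a :: 'a :: finite)) = 1"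
  by (rule sum_pmf_eq_1) auto

lemma expectation_finite:
  fixes p :: "'a::finite pmf" and f :: "'a \<Rightarrow> real"
  shows "measure_pmf.expectation p f = (\<Sum>a\<in>UNIV. pmf p a * f a)"
  by (subst integral_measure_pmf_real[where A = UNIV]) (auto simp: mult.commute)

lemma integrable_finite_pmf [simp]:
  fixes p :: "'a::finite pmf" and f :: "'a \<Rightarrow> real"
  shows "integrable (measure_pmf p) f"
  by (rule integrable_measure_pmf_finite) auto

lemma pmf_map_finite:
  fixes p :: "'a::finite pmf"
  shows "pmf (map_pmf f p) b = (\<Sum>a | f a = b. pmf p a)"
  by (subst pmf_map, subst measure_measure_pmf_finite) (auto simp: vimage_def)

lemma pmf_map_ge: "pmf p a \<le> pmf (map_pmf f p) (f a)"
proof -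
  have "pmf p a = measure_pmf.prob p {a}" by (simp add: measure_pmf_single)
  also have "\<dots> \<le> measure_pmf.prob p (f -` {f a})"
    by (rule measure_pmf.finite_measure_mono) auto
  finally show ?thesis by (simp add: pmf_map)
qed

lemma pmf_map_eq_0: "pmf (map_pmf f p) (f a) = 0 \<Longrightarrow> pmf p a = 0"
  using pmf_map_ge[of p a f] pmf_nonneg[of p a] by linarith

lemma exists_pmf:
  fixes f :: "'a::finite \<Rightarrow> real"
  assumes "\<And>a. f a \<ge> 0" "(\<Sum>a\<in>UNIV. f a) = 1"
  obtains p where "pmf p = f"
proof
  have "(\<integral>\<^sup>+ x. ennreal (f x) \<partial>count_space UNIV) = 1"
    using assms by (simp add: nn_integral_count_space_finite)
  then show "pmf (embed_pmf f) = f"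
    using assms by (auto simp: pmf_embed_pmf)
qed

lemma pmf_joint_pmf: "pmf (joint_pmf Q W) (a, b) = pmf Q a * pmf (W a) b"
proof -
  have *: "pmf (map_pmf (Pair x) (W x)) (a, b) = indicator {a} x * pmf (W a) b" for x
    by (cases "x = a") (auto simp: pmf_map_inj' inj_on_def intro: pmf_map_outside)
  have "pmf (joint_pmf Q W) (a, b) = measure_pmf.expectation Q (\<lambda>x. indicator {a} x * pmf (W a) b)"
    unfolding joint_pmf_def map_pmf_def[symmetric] by (simp add: pmf_bind *)
  also have "\<dots> = pmf Q a * pmf (W a) b"
    by (simp add: measure_pmf_single)
  finally show ?thesis .
qed

lemma map_fst_joint_pmf [simp]: "map_pmf fst (joint_pmf Q W) = Q"
  by (simp add: joint_pmf_def map_bind_pmf bind_return_pmf')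

text \<open>Disintegration. On letters of mass zero \<open>cond_pmf\<close> conditions on a null set
  and its value is arbitrary, but there it is multiplied by zero.\<close>

lemma joint_pmf_surj:
  fixes J :: "('a::finite \<times> 'b::finite) pmf"
  assumes "map_pmf fst J = Q"
  obtains W where "joint_pmf Q W = J"
proof
  let ?W = "\<lambda>a. map_pmf snd (cond_pmf J (fst -` {a}))"
  show "joint_pmf Q ?W = J"
  proof (rule pmf_eqI)
    fix z show "pmf (joint_pmf Q ?W) z = pmf J z"
    proof (cases z)
      case (Pair a b)
      have Q: "pmf Q a = measure_pmf.prob J (fst -` {a})"
        using assms by (auto simp: pmf_map)
      show ?thesis
      proof (cases "pmf Q a = 0")
        case True
        then have "pmf J z = 0"
          using pmf_map_eq_0[of fst J z] assms Pair by auto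
        then show ?thesis using True Pair by (simp add: pmf_joint_pmf)
      next
        case False
        then have ne: "set_pmf J \<inter> fst -` {a} \<noteq> {}"
          unfolding Q by (metis measure_Int_set_pmf measure_empty Int_commute)
        have "pmf (?W a) b = measure_pmf.prob (cond_pmf J (fst -` {a})) {(a, b)}"
          unfolding pmf_map
          by (intro measure_eq_AE) (auto simp: AE_measure_pmf_iff set_cond_pmf[OF ne])
        also have "\<dots> = pmf J (a, b) / pmf Q a"
          by (simp add: measure_pmf_single pmf_cond[OF ne] Q)
        finally show ?thesis using False Pair by (simp add: pmf_joint_pmf)
      qed
    qed
  qed
qed

section \<open>Information measures as entropy sums\<close>

definition ent :: "'a::finite pmf \<Rightarrow> real" where
  "ent p = - (\<Sum>a\<in>UNIV. pmf p a * log 2 (pmf p a))"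

lemma ent_expectation: "ent p = - measure_pmf.expectation p (\<lambda>a. log 2 (pmf p a))"
  by (simp add: ent_def expectation_finite)

lemma ent_map:
  fixes p :: "'a::finite pmf" and f :: "'a \<Rightarrow> 'b::finite"
  shows "ent (map_pmf f p) = - (\<Sum>a\<in>UNIV. pmf p a * log 2 (pmf (map_pmf f p) (f a)))"
  by (simp add: ent_expectation expectation_finite[of p])

lemma ent_map_inj:
  fixes f :: "'a::finite \<Rightarrow> 'b::finite"
  assumes "inj f"
  shows "ent (map_pmf f p) = ent p"
  by (subst ent_map) (simp add: pmf_map_inj'[OF assms] ent_def)

text \<open>The tangent bound for ln at 1/x, with ln 2 \<ge> 1/2, gives the crude constant 2. It
  bounds entropies, and applied to a square root it gives continuity at zero.\<close>

lemma log2_term_bounds: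
  fixes x :: real
  assumes "0 \<le> x" "x \<le> 1"
  shows "x * log 2 x \<le> 0" "- (x * log 2 x) \<le> 2"
proof -
  show "x * log 2 x \<le> 0"
    using assms by (cases "x = 0") (auto simp: mult_le_0_iff)
  show "- (x * log 2 x) \<le> 2"
  proof (cases "x = 0")
    case False
    then have x: "x > 0" using assms by auto
    have "ln (1 / x) \<le> 1 / x - 1" using x by (intro ln_le_minus_one) auto
    then have "x * ln (1 / x) \<le> x * (1 / x - 1)" using x by (intro mult_left_mono) auto
    then have "- (x * ln x) \<le> 1" using x assms by (simp add: ln_div algebra_simps)
    moreover have "ln (2::real) \<ge> 1 / 2" using ln2_ge_two_thirds by linarith
    ultimately have "- (x * ln x) \<le> 2 * ln 2" by linarith
    then have "- (x * ln x) / ln 2 \<le> 2" by (subst pos_divide_le_eq) auto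
    then show ?thesis by (simp add: log_def)
  qed simp
qed

lemma ent_nonneg: "ent p \<ge> 0"
  unfolding ent_def by (simp add: sum_nonpos log2_term_bounds(1) pmf_le_1)

lemma ent_le: "ent (p :: 'a::finite pmf) \<le> 2 * real CARD('a)"
proof -
  have "ent p = (\<Sum>a\<in>UNIV. - (pmf p a * log 2 (pmf p a)))" by (simp add: ent_def sum_negf)
  also have "\<dots> \<le> (\<Sum>a\<in>(UNIV :: 'a set). 2)"
    by (intro sum_mono log2_term_bounds(2)) (auto simp: pmf_le_1)
  finally show ?thesis by simp
qed

lemma KL_divergence_pmf:
  fixes p q :: "'a::finite pmf"
  assumes "\<And>a. pmf p a = 0 \<Longrightarrow> pmf q a = 0"
  shows "KL_divergence 2 (measure_pmf p) (measure_pmf q) = (\<Sum>a\<in>UNIV. pmf q a * log 2 (pmf q a / pmf p a))"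
proof -
  interpret sigma_finite_measure "count_space (UNIV :: 'a set)"
    by (rule sigma_finite_measure_count_space_finite) auto
  show ?thesis
    unfolding measure_pmf_eq_density
    by (subst KL_density_density) (use assms in \<open>auto simp: lebesgue_integral_count_space_finite\<close>)
qed

lemma KL_sum:
  fixes P :: "'a::finite pmf"
  assumes "set_pmf P = UNIV"
  shows "KL Q P = (\<Sum>a\<in>UNIV. pmf Q a * log 2 (pmf Q a / pmf P a))"
  unfolding KL_def using assms by (intro KL_divergence_pmf) (metis UNIV_I set_pmf_iff)

lemma KL_altdef:
  fixes P Q :: "'a::finite pmf"
  assumes "set_pmf P = UNIV"
  shows "KL Q P = - ent Q - (\<Sum>a\<in>UNIV. pmf Q a * log 2 (pmf P a))"
proof -
  have pos: "pmf P a > 0" for a using assms by (simp add: pmf_positive)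
  have "KL Q P = (\<Sum>a\<in>UNIV. pmf Q a * log 2 (pmf Q a) - pmf Q a * log 2 (pmf P a))"
    unfolding KL_sum[OF assms]
  proof (rule sum.cong)
    fix a show "pmf Q a * log 2 (pmf Q a / pmf P a) = pmf Q a * log 2 (pmf Q a) - pmf Q a * log 2 (pmf P a)"
      using pos[of a] by (cases "pmf Q a = 0") (auto simp: log_divide pmf_nonneg less_le right_diff_distrib)
  qed auto
  then show ?thesis by (simp add: ent_def sum_subtractf)
qed

text \<open>Mutual information is a divergence from a product measure; identifying that measure with
  a \<open>pmf\<close> turns it into a finite sum.\<close>

lemma pair_measure_pmf:
  fixes p :: "'a::finite pmf" and q :: "'b::finite pmf"
  shows "measure_pmf p \<Otimes>\<^sub>M measure_pmf q = measure_pmf (pair_pmf p q)"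
proof (rule measure_eqI_countable[where A = UNIV])
  have "sets (measure_pmf p \<Otimes>\<^sub>M measure_pmf q) = sets (count_space UNIV \<Otimes>\<^sub>M count_space (UNIV :: 'b set))"
    by (intro sets_pair_measure_cong) auto
  also have "\<dots> = Pow UNIV"
    by (subst pair_measure_count_space) auto
  finally show "sets (measure_pmf p \<Otimes>\<^sub>M measure_pmf q) = Pow UNIV" .
  fix z :: "'a \<times> 'b"
  obtain a b where z: "z = (a, b)" by force
  have "emeasure (measure_pmf p \<Otimes>\<^sub>M measure_pmf q) ({a} \<times> {b}) = emeasure (measure_pmf p) {a} * emeasure (measure_pmf q) {b}"
    by (rule measure_pmf.emeasure_pair_measure_Times) auto
  then show "emeasure (measure_pmf p \<Otimes>\<^sub>M measure_pmf q) {z} = emeasure (measure_pmf (pair_pmf p q)) {z}"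
    by (simp add: z emeasure_pmf_single pmf_pair ennreal_mult)
qed auto

text \<open>Stated for arbitrary random variables because conditional mutual information is by
  definition a difference of two mutual informations, of X with (V, Y) and of X with Y.\<close>

lemma mutual_information_pmf:
  fixes J :: "'c::finite pmf" and X :: "'c \<Rightarrow> 'a::finite" and Y :: "'c \<Rightarrow> 'b::finite"
  shows "prob_space.mutual_information (measure_pmf J) 2 (count_space UNIV) (count_space UNIV) X Y =
    ent (map_pmf X J) + ent (map_pmf Y J) - ent (map_pmf (\<lambda>z. (X z, Y z)) J)"
proof -
  let ?X = "map_pmf X J" and ?Y = "map_pmf Y J" and ?J = "map_pmf (\<lambda>z. (X z, Y z)) J"
  have "prob_space.mutual_information (measure_pmf J) 2 (count_space UNIV) (count_space UNIV) X Y =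
     KL_divergence 2 (measure_pmf (pair_pmf ?X ?Y)) (measure_pmf ?J)"
    unfolding prob_space.mutual_information_def[OF measure_pmf.prob_space_axioms]
    by (simp add: pair_measure_pmf[symmetric] map_pmf_rep_eq pair_measure_count_space)
  also have "\<dots> = (\<Sum>z\<in>UNIV. pmf ?J z * log 2 (pmf ?J z / pmf (pair_pmf ?X ?Y) z))"
  proof (rule KL_divergence_pmf)
    fix z assume *: "pmf (pair_pmf ?X ?Y) z = 0"
    obtain a b where z: "z = (a, b)" by force
    have 1: "map_pmf fst ?J = ?X" "map_pmf snd ?J = ?Y" by (simp_all add: map_pmf_comp)
    show "pmf ?J z = 0"
      using * pmf_map_eq_0[of fst ?J z] pmf_map_eq_0[of snd ?J z] unfolding 1 z
      by (auto simp: pmf_pair)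
  qed
  also have "\<dots> = measure_pmf.expectation ?J (\<lambda>z. log 2 (pmf ?J z / pmf (pair_pmf ?X ?Y) z))"
    by (simp add: expectation_finite)
  also have "\<dots> = measure_pmf.expectation J (\<lambda>z. log 2 (pmf ?J (X z, Y z) / pmf (pair_pmf ?X ?Y) (X z, Y z)))"
    by simp
  also have "\<dots> = measure_pmf.expectation J (\<lambda>z. log 2 (pmf ?J (X z, Y z)) - log 2 (pmf ?X (X z)) - log 2 (pmf ?Y (Y z)))"
  \<comment> \<open>The logarithm of the quotient splits only where all masses are positive, so the
    integrands are compared on the support alone.\<close>
  proof (intro integral_cong_AE, simp, simp, unfold AE_measure_pmf_iff, rule ballI)
    fix z assume "z \<in> set_pmf J"
    then have "pmf J z > 0" by (rule pmf_positive)
    then have "pmf ?J (X z, Y z) > 0" "pmf ?X (X z) > 0" "pmf ?Y (Y z) > 0"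
      using pmf_map_ge[of J z] by (meson less_le_trans)+
    then show "log 2 (pmf ?J (X z, Y z) / pmf (pair_pmf ?X ?Y) (X z, Y z)) =
       log 2 (pmf ?J (X z, Y z)) - log 2 (pmf ?X (X z)) - log 2 (pmf ?Y (Y z))"
      by (simp add: pmf_pair log_divide log_mult)
  qed
  also have "\<dots> = ent ?X + ent ?Y - ent ?J"
    unfolding ent_expectation by simp
  finally show ?thesis .
qed

lemma mutual_info_eq:
  fixes J :: "('a::finite \<times> 'b::finite) pmf"
  shows "mutual_info J = ent (map_pmf fst J) + ent (map_pmf snd J) - ent J"
  unfolding mutual_info_def by (simp add: mutual_information_pmf)

definition yv_marg :: "(('a \<times> 'b) \<times> 'c) pmf \<Rightarrow> ('b \<times> 'c) pmf" where
  "yv_marg = map_pmf (\<lambda>((x, y), v). (y, v))"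

lemma cond_mutual_info_eq:
  fixes J :: "(('a::finite \<times> 'b::finite) \<times> 'c::finite) pmf"
  shows "cond_mutual_info J = ent (map_pmf fst J) + ent (yv_marg J) - ent J - ent (map_pmf snd (map_pmf fst J))"
proof -
  let ?X = "\<lambda>((x::'a, y::'b), v::'c). x" and ?Y = "\<lambda>((x::'a, y::'b), v::'c). y" and ?V = "\<lambda>((x::'a, y::'b), v::'c). v"
  have 1: "ent (map_pmf (\<lambda>z. (?X z, ?V z, ?Y z)) J) = ent J"
    by (rule ent_map_inj) (auto simp: inj_on_def)
  have "ent (map_pmf (\<lambda>z. (?V z, ?Y z)) J) = ent (map_pmf (\<lambda>(y, v). (v, y)) (yv_marg J))"
    unfolding yv_marg_def map_pmf_comp by (rule arg_cong[where f = ent], rule map_pmf_cong) auto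
  also have "\<dots> = ent (yv_marg J)" by (rule ent_map_inj) (auto simp: inj_on_def)
  finally have 2: "ent (map_pmf (\<lambda>z. (?V z, ?Y z)) J) = ent (yv_marg J)" .
  have 3: "map_pmf (\<lambda>z. (?X z, ?Y z)) J = map_pmf fst J"
    by (rule map_pmf_cong) auto
  have 4: "map_pmf ?Y J = map_pmf snd (map_pmf fst J)"
    unfolding map_pmf_comp by (rule map_pmf_cong) auto
  have prod: "count_space (UNIV :: 'c set) \<Otimes>\<^sub>M count_space (UNIV :: 'b set) = count_space UNIV"
    by (simp add: pair_measure_count_space)
  show ?thesis
    unfolding cond_mutual_info_def prob_space.conditional_mutual_information_def[OF measure_pmf.prob_space_axioms] prod mutual_information_pmf
    using 1 2 3 4 by simp
qed

section \<open>Convergence and compactness of distributions\<close>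

text \<open>Pointwise convergence of the masses. On a finite alphabet this is convergence in total
  variation, so entropies and expectations are continuous for it.\<close>

definition pmf_tendsto :: "(nat \<Rightarrow> 'a pmf) \<Rightarrow> 'a pmf \<Rightarrow> bool" where
  "pmf_tendsto X p \<longleftrightarrow> (\<forall>a. (\<lambda>k. pmf (X k) a) \<longlonglongrightarrow> pmf p a)"

lemma pmf_tendsto_subseq: "pmf_tendsto X p \<Longrightarrow> strict_mono s \<Longrightarrow> pmf_tendsto (X \<circ> s) p"
  unfolding pmf_tendsto_def using LIMSEQ_subseq_LIMSEQ by (fastforce simp: comp_def)

lemma pmf_tendsto_unique: "pmf_tendsto X p \<Longrightarrow> pmf_tendsto X q \<Longrightarrow> p = q"
  unfolding pmf_tendsto_def by (intro pmf_eqI) (metis LIMSEQ_unique)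

lemma pmf_tendsto_map:
  fixes p :: "'a::finite pmf"
  shows "pmf_tendsto X p \<Longrightarrow> pmf_tendsto (\<lambda>k. map_pmf f (X k)) (map_pmf f p)"
  unfolding pmf_tendsto_def by (auto simp: pmf_map_finite intro!: tendsto_sum)

lemma pmf_tendsto_expectation:
  fixes p :: "'a::finite pmf" and c :: "'a \<Rightarrow> real"
  shows "pmf_tendsto X p \<Longrightarrow> (\<lambda>k. measure_pmf.expectation (X k) c) \<longlonglongrightarrow> measure_pmf.expectation p c"
  unfolding pmf_tendsto_def by (auto simp: expectation_finite intro!: tendsto_intros)

lemma tendsto_x_log_x:
  fixes f :: "nat \<Rightarrow> real"
  assumes "f \<longlonglongrightarrow> x" "\<And>k. 0 \<le> f k" "\<And>k. f k \<le> 1"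
  shows "(\<lambda>k. f k * log 2 (f k)) \<longlonglongrightarrow> x * log 2 x"
proof (cases "x = 0")
  case False
  then have "x > 0" using assms LIMSEQ_le_const[OF assms(1), of 0] by force
  then show ?thesis using assms by (intro tendsto_intros) auto
next
  case True
  \<comment> \<open>With s = sqrt x one has x log x = 2 s (s log s), and the bracket is at most 2 in
    absolute value by \<open>log2_term_bounds\<close>.\<close>
  have "\<bar>f k * log 2 (f k)\<bar> \<le> 4 * sqrt (f k)" for k
  proof (cases "f k = 0")
    case False
    then have pos: "f k > 0" using assms(2)[of k] by linarith
    let ?s = "sqrt (f k)"
    have "- (?s * log 2 ?s) \<le> 2" using assms pos by (intro log2_term_bounds) auto
    then have "2 * ?s * (- (?s * log 2 ?s)) \<le> 2 * ?s * 2" using pos by (intro mult_left_mono) auto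
    moreover have "log 2 (f k) = 2 * log 2 ?s" using pos by (simp add: log_def ln_sqrt)
    then have "2 * ?s * (- (?s * log 2 ?s)) = - (f k * log 2 (f k))"
      using pos by (simp add: algebra_simps flip: real_sqrt_mult)
    moreover have "f k * log 2 (f k) \<le> 0" using assms by (intro log2_term_bounds)
    ultimately show ?thesis by linarith
  qed auto
  moreover have "(\<lambda>k. 4 * sqrt (f k)) \<longlonglongrightarrow> 4 * sqrt 0"
    using assms(1) True by (intro tendsto_intros) auto
  ultimately show ?thesis
    using True Lim_null_comparison[of "\<lambda>k. f k * log 2 (f k)" "\<lambda>k. 4 * sqrt (f k)" sequentially] by simp
qed

lemma ent_tendsto: "pmf_tendsto X p \<Longrightarrow> (\<lambda>k. ent (X k)) \<longlonglongrightarrow> ent p"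
  unfolding ent_def pmf_tendsto_def by (intro tendsto_intros tendsto_x_log_x) (auto simp: pmf_le_1)

lemma mutual_info_tendsto:
  fixes J :: "('a::finite \<times> 'b::finite) pmf"
  shows "pmf_tendsto X J \<Longrightarrow> (\<lambda>k. mutual_info (X k)) \<longlonglongrightarrow> mutual_info J"
  unfolding mutual_info_eq by (intro tendsto_intros ent_tendsto pmf_tendsto_map)

lemma cond_mutual_info_tendsto:
  fixes J :: "(('a::finite \<times> 'b::finite) \<times> 'c::finite) pmf"
  shows "pmf_tendsto X J \<Longrightarrow> (\<lambda>k. cond_mutual_info (X k)) \<longlonglongrightarrow> cond_mutual_info J"
  unfolding cond_mutual_info_eq yv_marg_def by (intro tendsto_intros ent_tendsto pmf_tendsto_map)

text \<open>With full support of P the divergence is minus an entropy plus a linear functional of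
  its first argument, hence continuous up to the boundary of the simplex.\<close>

lemma KL_tendsto:
  fixes P :: "'a::finite pmf"
  assumes "set_pmf P = UNIV" "pmf_tendsto X Q"
  shows "(\<lambda>k. KL (X k) P) \<longlonglongrightarrow> KL Q P"
  unfolding KL_altdef[OF assms(1)] using assms(2) ent_tendsto[OF assms(2)]
  by (intro tendsto_intros) (auto simp: pmf_tendsto_def)

text \<open>Compactness of the simplex, by Bolzano-Weierstrass in a finite-dimensional space;
  nonnegativity and total mass one pass to the limit because the sum is finite.\<close>

lemma pmf_compact:
  fixes X :: "nat \<Rightarrow> 'a::finite pmf"
  obtains s p where "strict_mono s" "pmf_tendsto (X \<circ> s) p"
proof -
  let ?f = "\<lambda>k. (\<chi> a. pmf (X k) a) :: real ^ 'a"
  have "norm (?f k) \<le> 1" for k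
    using norm_le_l1_cart[of "?f k"] by simp
  then have "bounded (range ?f)" by (auto simp: bounded_iff)
  then obtain l s where s: "strict_mono s" "(?f \<circ> s) \<longlonglongrightarrow> l"
    using bounded_imp_convergent_subsequence by blast
  have lim: "(\<lambda>k. pmf (X (s k)) a) \<longlonglongrightarrow> l $ a" for a
    using tendsto_vec_nth[OF s(2), of a] by (simp add: comp_def)
  have "l $ a \<ge> 0" for a by (rule LIMSEQ_le_const[OF lim]) auto
  moreover have "(\<lambda>k. \<Sum>a\<in>UNIV. pmf (X (s k)) a) \<longlonglongrightarrow> (\<Sum>a\<in>UNIV. l $ a)"
    by (intro tendsto_sum lim)
  then have "(\<Sum>a\<in>UNIV. l $ a) = 1" by (simp add: LIMSEQ_const_iff)
  ultimately obtain p where "pmf p = (\<lambda>a. l $ a)" by (rule exists_pmf)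
  then have "pmf_tendsto (X \<circ> s) p" using lim by (simp add: pmf_tendsto_def)
  with s(1) show ?thesis by (rule that)
qed

section \<open>Mixtures and convexity\<close>

definition mix_pmf :: "real \<Rightarrow> 'a pmf \<Rightarrow> 'a pmf \<Rightarrow> 'a pmf" where
  "mix_pmf t p q = bind_pmf (bernoulli_pmf t) (\<lambda>b. if b then q else p)"

lemma pmf_mix: "0 \<le> t \<Longrightarrow> t \<le> 1 \<Longrightarrow> pmf (mix_pmf t p q) a = (1 - t) * pmf p a + t * pmf q a"
  unfolding mix_pmf_def by (subst pmf_bind) simp

lemma map_mix: "map_pmf f (mix_pmf t p q) = mix_pmf t (map_pmf f p) (map_pmf f q)"
  unfolding mix_pmf_def by (simp add: map_bind_pmf if_distrib)

lemma mix_same [simp]: "mix_pmf t p p = p"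
  unfolding mix_pmf_def by simp

lemma expectation_mix:
  fixes p :: "'a::finite pmf" and c :: "'a \<Rightarrow> real"
  assumes "0 \<le> t" "t \<le> 1"
  shows "measure_pmf.expectation (mix_pmf t p q) c =
    (1 - t) * measure_pmf.expectation p c + t * measure_pmf.expectation q c"
  using assms by (simp add: expectation_finite pmf_mix sum_distrib_left sum.distrib[symmetric] algebra_simps)

lemma mix_tendsto:
  assumes "t \<longlonglongrightarrow> 0" "\<And>k. 0 \<le> t k" "\<And>k. t k \<le> 1"
  shows "pmf_tendsto (\<lambda>k. mix_pmf (t k) p q) p"
  unfolding pmf_tendsto_def
proof
  fix a
  have "(\<lambda>k. (1 - t k) * pmf p a + t k * pmf q a) \<longlonglongrightarrow> (1 - 0) * pmf p a + 0 * pmf q a"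
    using assms by (intro tendsto_intros)
  then show "(\<lambda>k. pmf (mix_pmf (t k) p q) a) \<longlonglongrightarrow> pmf p a"
    using assms by (simp add: pmf_mix)
qed

text \<open>The log-sum inequality: each term is compared with the common ratio A / B by the tangent
  bound ln y \<le> y - 1, and the errors a - b A / B cancel in the sum.\<close>

lemma log_sum_two:
  fixes a1 a2 b1 b2 :: real
  assumes "a1 \<ge> 0" "a2 \<ge> 0" "b1 \<ge> 0" "b2 \<ge> 0" "b1 = 0 \<Longrightarrow> a1 = 0" "b2 = 0 \<Longrightarrow> a2 = 0"
  shows "(a1 + a2) * log 2 ((a1 + a2) / (b1 + b2)) \<le> a1 * log 2 (a1 / b1) + a2 * log 2 (a2 / b2)"
proof (cases "a1 + a2 = 0")
  case True
  then show ?thesis using assms by (simp add: add_nonneg_eq_0_iff)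
next
  case False
  define A B where "A = a1 + a2" and "B = b1 + b2"
  have A: "A > 0" using False assms by (simp add: A_def)
  have B: "B > 0" using False assms unfolding B_def by (metis add.right_neutral add_nonneg_eq_0_iff add_nonneg_nonneg less_eq_real_def)
  have key: "a * ln (A / B) + (a - b * A / B) \<le> a * ln (a / b)" if "a \<ge> 0" "b \<ge> 0" "b = 0 \<Longrightarrow> a = 0" for a b
  proof (cases "a = 0")
    case True
    then show ?thesis using that A B by simp
  next
    case False
    then have ab: "a > 0" "b > 0" using that by (auto simp: less_le)
    have "ln ((b * A) / (a * B)) \<le> (b * A) / (a * B) - 1"
      using ab A B by (intro ln_le_minus_one) auto
    then have "a * ln ((b * A) / (a * B)) \<le> a * ((b * A) / (a * B) - 1)"
      using ab by (intro mult_left_mono) auto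
    moreover have "ln ((b * A) / (a * B)) = ln (A / B) - ln (a / b)"
      using ab A B by (simp add: ln_div ln_mult)
    moreover have "a * ((b * A) / (a * B) - 1) = b * A / B - a"
      using ab B by (simp add: right_diff_distrib)
    ultimately show ?thesis by (simp add: right_diff_distrib)
  qed
  have "b1 * A / B + b2 * A / B = A"
    using B by (simp add: add_divide_distrib[symmetric] distrib_right[symmetric] B_def[symmetric])
  with key[of a1 b1] key[of a2 b2] assms
  have "A * ln (A / B) \<le> a1 * ln (a1 / b1) + a2 * ln (a2 / b2)"
    by (simp add: A_def algebra_simps)
  then have "(A * ln (A / B)) / ln 2 \<le> (a1 * ln (a1 / b1) + a2 * ln (a2 / b2)) / ln 2"
    by (intro divide_right_mono) auto
  then show ?thesis by (simp add: log_def A_def B_def add_divide_distrib)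
qed

lemma log_sum_mix:
  fixes a1 a2 b1 b2 t :: real
  assumes "a1 \<ge> 0" "a2 \<ge> 0" "b1 \<ge> 0" "b2 \<ge> 0" "b1 = 0 \<Longrightarrow> a1 = 0" "b2 = 0 \<Longrightarrow> a2 = 0" "0 \<le> t" "t \<le> 1"
  shows "((1 - t) * a1 + t * a2) * log 2 (((1 - t) * a1 + t * a2) / ((1 - t) * b1 + t * b2))
    \<le> (1 - t) * (a1 * log 2 (a1 / b1)) + t * (a2 * log 2 (a2 / b2))"
proof -
  have "((1 - t) * a1) * log 2 (((1 - t) * a1) / ((1 - t) * b1)) = (1 - t) * (a1 * log 2 (a1 / b1))"
    by (cases "t = 1") auto
  moreover have "(t * a2) * log 2 ((t * a2) / (t * b2)) = t * (a2 * log 2 (a2 / b2))"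
    by (cases "t = 0") auto
  ultimately show ?thesis
    using log_sum_two[of "(1 - t) * a1" "t * a2" "(1 - t) * b1" "t * b2"] assms by fastforce
qed

text \<open>The entropy form of mutual information suits limits; this divergence form suits
  convexity and nonnegativity.\<close>

lemma mutual_info_divergence:
  fixes J :: "('a::finite \<times> 'b::finite) pmf"
  shows "mutual_info J = (\<Sum>z\<in>UNIV. pmf J z * log 2 (pmf J z / (pmf (map_pmf fst J) (fst z) * pmf (map_pmf snd J) (snd z))))"
proof -
  have pair: "pmf (pair_pmf p q) z = pmf p (fst z) * pmf q (snd z)" for p :: "'a pmf" and q :: "'b pmf" and z
    by (cases z) (simp add: pmf_pair)
  have "mutual_info J = KL_divergence 2 (measure_pmf (pair_pmf (map_pmf fst J) (map_pmf snd J))) (measure_pmf J)"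
    unfolding mutual_info_def prob_space.mutual_information_def[OF measure_pmf.prob_space_axioms]
    by (simp add: pair_measure_pmf[symmetric] map_pmf_rep_eq pair_measure_count_space)
       (simp add: map_pmf_rep_eq[symmetric])
  also have "\<dots> = (\<Sum>z\<in>UNIV. pmf J z * log 2 (pmf J z / pmf (pair_pmf (map_pmf fst J) (map_pmf snd J)) z))"
    using pmf_map_eq_0[of fst J] pmf_map_eq_0[of snd J] by (intro KL_divergence_pmf) (auto simp: pmf_pair split: prod.splits)
  finally show ?thesis by (simp add: pair)
qed

text \<open>With a common source marginal, the product of the two marginals is affine in the mixture
  weight, so \<open>log_sum_mix\<close> applies term by term.\<close>

lemma mutual_info_convex:
  fixes J K :: "('a::finite \<times> 'b::finite) pmf"
  assumes "map_pmf fst J = map_pmf fst K" "0 \<le> t" "t \<le> 1"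
  shows "mutual_info (mix_pmf t J K) \<le> (1 - t) * mutual_info J + t * mutual_info K"
proof -
  let ?Q = "pmf (map_pmf fst K)"
  have "pmf (mix_pmf t J K) z * log 2 (pmf (mix_pmf t J K) z / (?Q (fst z) * pmf (map_pmf snd (mix_pmf t J K)) (snd z)))
     \<le> (1 - t) * (pmf J z * log 2 (pmf J z / (?Q (fst z) * pmf (map_pmf snd J) (snd z)))) +
       t * (pmf K z * log 2 (pmf K z / (?Q (fst z) * pmf (map_pmf snd K) (snd z))))" for z
  proof -
    have "pmf J z = 0" if "?Q (fst z) * pmf (map_pmf snd J) (snd z) = 0"
      using that pmf_map_eq_0[of fst J z] pmf_map_eq_0[of snd J z] assms by auto
    moreover have "pmf K z = 0" if "?Q (fst z) * pmf (map_pmf snd K) (snd z) = 0"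
      using that pmf_map_eq_0[of fst K z] pmf_map_eq_0[of snd K z] assms by auto
    ultimately have "((1 - t) * pmf J z + t * pmf K z) * log 2 (((1 - t) * pmf J z + t * pmf K z) /
        ((1 - t) * (?Q (fst z) * pmf (map_pmf snd J) (snd z)) + t * (?Q (fst z) * pmf (map_pmf snd K) (snd z))))
       \<le> (1 - t) * (pmf J z * log 2 (pmf J z / (?Q (fst z) * pmf (map_pmf snd J) (snd z)))) +
       t * (pmf K z * log 2 (pmf K z / (?Q (fst z) * pmf (map_pmf snd K) (snd z))))"
      using assms by (intro log_sum_mix) auto
    moreover have "(1 - t) * (?Q (fst z) * pmf (map_pmf snd J) (snd z)) + t * (?Q (fst z) * pmf (map_pmf snd K) (snd z))
       = ?Q (fst z) * pmf (map_pmf snd (mix_pmf t J K)) (snd z)"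
      using assms by (simp add: map_mix pmf_mix algebra_simps)
    ultimately show ?thesis using assms by (simp add: pmf_mix)
  qed
  then have "(\<Sum>z\<in>UNIV. pmf (mix_pmf t J K) z * log 2 (pmf (mix_pmf t J K) z / (?Q (fst z) * pmf (map_pmf snd (mix_pmf t J K)) (snd z))))
    \<le> (\<Sum>z\<in>UNIV. (1 - t) * (pmf J z * log 2 (pmf J z / (?Q (fst z) * pmf (map_pmf snd J) (snd z)))) +
       t * (pmf K z * log 2 (pmf K z / (?Q (fst z) * pmf (map_pmf snd K) (snd z)))))"
    by (intro sum_mono)
  moreover have "map_pmf fst (mix_pmf t J K) = map_pmf fst K"
    using assms(1) by (simp add: map_mix)
  ultimately show ?thesis
    using assms(1) unfolding mutual_info_divergence by (simp add: sum.distrib sum_distrib_left)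
qed

text \<open>Convexity of divergence, where P itself contributes zero. Thus a mixture with t > 0
  moves any point of a divergence ball of positive radius strictly inside.\<close>

lemma KL_mix:
  fixes P :: "'a::finite pmf"
  assumes P: "set_pmf P = UNIV" and t: "0 \<le> t" "t \<le> 1"
  shows "KL (mix_pmf t Q P) P \<le> (1 - t) * KL Q P"
proof -
  have pos: "pmf P a > 0" for a using P by (simp add: pmf_positive)
  have "pmf (mix_pmf t Q P) a * log 2 (pmf (mix_pmf t Q P) a / pmf P a) \<le> (1 - t) * (pmf Q a * log 2 (pmf Q a / pmf P a))" for a
    using log_sum_mix[of "pmf Q a" "pmf P a" "pmf P a" "pmf P a" t] t pos[of a]
    by (simp add: pmf_mix algebra_simps)
  then show ?thesis
    unfolding KL_sum[OF P] sum_distrib_left by (intro sum_mono)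
qed

lemma KL_self:
  fixes P :: "'a::finite pmf"
  assumes "set_pmf P = UNIV"
  shows "KL P P = 0"
  unfolding KL_sum[OF assms] by (intro sum.neutral) (auto simp: divide_self_if)

lemma log_quotient_ge:
  fixes a b :: real
  assumes "a \<ge> 0" "b \<ge> 0" "b = 0 \<Longrightarrow> a = 0"
  shows "a * log 2 (a / b) \<ge> (a - b) / ln 2"
proof (cases "a = 0")
  case False
  then have ab: "a > 0" "b > 0" using assms by (auto simp: less_le)
  have "ln (b / a) \<le> b / a - 1" using ab by (intro ln_le_minus_one) auto
  then have "a * ln (b / a) \<le> a * (b / a - 1)" using ab by (intro mult_left_mono) auto
  then have "a - b \<le> a * ln (a / b)" using ab by (simp add: ln_div right_diff_distrib)
  then have "(a - b) / ln 2 \<le> a * ln (a / b) / ln 2" by (intro divide_right_mono) auto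
  then show ?thesis by (simp add: log_def)
qed (use assms in auto)

lemma KL_nonneg:
  fixes P :: "'a::finite pmf"
  assumes "set_pmf P = UNIV"
  shows "KL Q P \<ge> 0"
proof -
  have pos: "pmf P a > 0" for a using assms by (simp add: pmf_positive)
  have "0 = (\<Sum>a\<in>UNIV. (pmf Q a - pmf P a) / ln 2)"
    by (simp add: sum_divide_distrib[symmetric] sum_subtractf)
  also have "\<dots> \<le> KL Q P"
    unfolding KL_sum[OF assms] using pos by (intro sum_mono log_quotient_ge) (auto simp: less_imp_neq[symmetric])
  finally show ?thesis .
qed

lemma mutual_info_nonneg:
  fixes J :: "('a::finite \<times> 'b::finite) pmf"
  shows "mutual_info J \<ge> 0"
proof -
  let ?q = "\<lambda>z. pmf (map_pmf fst J) (fst z) * pmf (map_pmf snd J) (snd z)"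
  have "(\<Sum>z\<in>UNIV. ?q z) = (\<Sum>a\<in>UNIV. \<Sum>b\<in>UNIV. pmf (map_pmf fst J) a * pmf (map_pmf snd J) b)"
    unfolding UNIV_Times_UNIV[symmetric] sum.cartesian_product by (simp add: case_prod_beta')
  also have "\<dots> = 1" by (simp add: sum_distrib_left[symmetric])
  finally have "0 = (\<Sum>z\<in>UNIV. (pmf J z - ?q z) / ln 2)"
    by (simp add: sum_divide_distrib[symmetric] sum_subtractf)
  also have "\<dots> \<le> mutual_info J"
    unfolding mutual_info_divergence using pmf_map_eq_0[of fst J] pmf_map_eq_0[of snd J]
    by (intro sum_mono log_quotient_ge) auto
  finally show ?thesis .
qed

lemma mutual_info_le:
  fixes J :: "('a::finite \<times> 'b::finite) pmf"
  shows "mutual_info J \<le> 2 * real CARD('a) + 2 * real CARD('b)"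
  using ent_le[of "map_pmf fst J"] ent_le[of "map_pmf snd J"] ent_nonneg[of J] unfolding mutual_info_eq by linarith

section \<open>Types\<close>

text \<open>The distributions with denominator n. For n = 0 every distribution would qualify, so the
  counting results assume n > 0.\<close>

definition is_type :: "nat \<Rightarrow> 'a pmf \<Rightarrow> bool" where
  "is_type n p \<longleftrightarrow> (\<forall>a. real n * pmf p a \<in> \<nat>)"

lemma pmf_map_fst:
  fixes J :: "('a::finite \<times> 'b::finite) pmf"
  shows "pmf (map_pmf fst J) a = (\<Sum>b\<in>UNIV. pmf J (a, b))"
proof -
  have "pmf (map_pmf fst J) a = (\<Sum>z\<in>Pair a ` UNIV. pmf J z)"
    unfolding pmf_map_finite by (rule sum.cong) auto
  also have "\<dots> = (\<Sum>b\<in>UNIV. pmf J (a, b))"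
    by (subst sum.reindex) (auto simp: inj_on_def)
  finally show ?thesis .
qed

lemma expectation_prod:
  fixes J :: "('a::finite \<times> 'b::finite) pmf" and c :: "'a \<Rightarrow> 'b \<Rightarrow> real"
  shows "measure_pmf.expectation J (\<lambda>(a, b). c a b) = (\<Sum>a\<in>UNIV. \<Sum>b\<in>UNIV. pmf J (a, b) * c a b)"
  unfolding expectation_finite UNIV_Times_UNIV[symmetric] sum.cartesian_product by (simp add: case_prod_beta')

lemma expectation_joint:
  fixes Q :: "'a::finite pmf" and W :: "'a \<Rightarrow> 'b::finite pmf" and c :: "'a \<Rightarrow> 'b \<Rightarrow> real"
  shows "measure_pmf.expectation (joint_pmf Q W) (\<lambda>(a, b). c a b) =
    (\<Sum>a\<in>UNIV. pmf Q a * (\<Sum>b\<in>UNIV. pmf (W a) b * c a b))"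
  unfolding expectation_prod pmf_joint_pmf by (simp add: sum_distrib_left mult.assoc)

text \<open>Rounding down all conditional counts except that of the cheapest letter, which absorbs the
  remainder, never increases the cost.\<close>

lemma round_to_type:
  fixes Q :: "'a::finite pmf" and W :: "'a \<Rightarrow> 'b::finite pmf" and c :: "'a \<Rightarrow> 'b \<Rightarrow> real"
  assumes n: "n > 0" and Q: "is_type n Q" and bs: "\<And>a b. c a (bs a) \<le> c a b"
  obtains J where "is_type n J" "map_pmf fst J = Q"
    "\<And>z. \<bar>pmf J z - pmf (joint_pmf Q W) z\<bar> \<le> real CARD('b) / real n"
    "measure_pmf.expectation J (\<lambda>(a, b). c a b) \<le> measure_pmf.expectation (joint_pmf Q W) (\<lambda>(a, b). c a b)"
proof -
  define q where "q a = real n * pmf Q a" for a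
  have q: "q a \<in> \<nat>" "q a \<ge> 0" for a using Q by (auto simp: is_type_def q_def)
  define u where "u a b = real (nat \<lfloor>q a * pmf (W a) b\<rfloor>)" for a b
  have u: "u a b \<le> q a * pmf (W a) b" "u a b \<ge> q a * pmf (W a) b - 1" "u a b \<ge> 0" for a b
  proof -
    have "q a * pmf (W a) b \<ge> 0" using q by simp
    then show "u a b \<le> q a * pmf (W a) b" "u a b \<ge> q a * pmf (W a) b - 1"
      unfolding u_def by (auto simp: le_floor_iff)
  qed (simp add: u_def)
  define F where "F a b = (if b = bs a then q a - (\<Sum>b'\<in>UNIV - {bs a}. u a b') else u a b)" for a b
  define g where "g a b = F a b - q a * pmf (W a) b" for a b
  have split: "(\<Sum>b\<in>UNIV. h b) = h (bs a) + (\<Sum>b\<in>UNIV - {bs a}. h b)" for h :: "'b \<Rightarrow> real" and a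
    by (subst sum.remove[of _ "bs a"]) auto
  have sumF: "(\<Sum>b\<in>UNIV. F a b) = q a" for a
    by (subst split[of _ a]) (simp add: F_def)
  have sumqW: "(\<Sum>b\<in>UNIV. q a * pmf (W a) b) = q a" for a
    by (simp add: sum_distrib_left[symmetric])
  have sumg: "(\<Sum>b\<in>UNIV. g a b) = 0" for a
    unfolding g_def sum_subtractf sumF sumqW by simp
  have g_neg: "g a b \<le> 0" "g a b \<ge> - 1" if "b \<noteq> bs a" for a b
    using that u[of a b] by (auto simp: g_def F_def)
  have g_bs: "g a (bs a) = - (\<Sum>b\<in>UNIV - {bs a}. g a b)" for a
    using sumg[of a] split[of "g a" a] by linarith
  have g_bs_nn: "g a (bs a) \<ge> 0" for a
  proof -
    have "(\<Sum>b\<in>UNIV - {bs a}. g a b) \<le> 0" by (rule sum_nonpos) (use g_neg(1) in auto)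
    then show ?thesis unfolding g_bs by simp
  qed
  have "(\<Sum>b\<in>UNIV - {bs a}. - g a b) \<le> (\<Sum>b\<in>UNIV - {bs a}. 1)" for a
    using g_neg(2) by (intro sum_mono) (auto simp: minus_le_iff)
  \<comment> \<open>Each of the other letters loses at most one count to rounding, and all these
    losses are credited to the cheapest letter.\<close>
  then have g_bs_le: "g a (bs a) \<le> real CARD('b)" for a
    unfolding g_bs by (simp add: sum_negf card_Diff_singleton order.trans[OF _ of_nat_mono[of "CARD('b) - 1" "CARD('b)"]])
  have g_abs: "\<bar>g a b\<bar> \<le> real CARD('b)" for a b
  proof (cases "b = bs a")
    case False
    have "real CARD('b) \<ge> 1" by (simp add: Suc_leI)
    with g_neg[OF False] show ?thesis by linarith
  qed (use g_bs_nn g_bs_le in auto)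
  have F_nn: "F a b \<ge> 0" for a b
  proof (cases "b = bs a")
    case True
    have "q a * pmf (W a) (bs a) \<ge> 0" using q by simp
    with g_bs_nn[of a] show ?thesis unfolding g_def True by linarith
  qed (simp add: F_def u)
  have F_nat: "F a b \<in> \<nat>" for a b
  proof -
    have "u a b' \<in> \<int>" for b' by (simp add: u_def)
    moreover have "q a \<in> \<int>" using q(1) Nats_subset_Ints by blast
    ultimately have "F a b \<in> \<int>" unfolding F_def by (auto intro!: Ints_diff Ints_sum)
    then show ?thesis using F_nn by (simp add: Nats_altdef2)
  qed
  have "(\<Sum>z\<in>UNIV. F (fst z) (snd z) / real n) = (\<Sum>a\<in>UNIV. \<Sum>b\<in>UNIV. F a b / real n)"
    unfolding UNIV_Times_UNIV[symmetric] sum.cartesian_product by (simp add: case_prod_beta')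
  also have "\<dots> = (\<Sum>a\<in>UNIV. q a / real n)" by (simp add: sum_divide_distrib[symmetric] sumF)
  also have "\<dots> = 1" using n by (simp add: q_def)
  finally obtain J where J: "pmf J = (\<lambda>z. F (fst z) (snd z) / real n)"
    using exists_pmf[of "\<lambda>z. F (fst z) (snd z) / real n"] F_nn by auto
  have diff: "pmf J (a, b) = pmf (joint_pmf Q W) (a, b) + g a b / real n" for a b
    using n by (simp add: J pmf_joint_pmf g_def q_def field_simps)
  show ?thesis
  proof (rule that)
    show "is_type n J" using F_nat n by (simp add: is_type_def J)
    show "map_pmf fst J = Q"
      using n by (intro pmf_eqI) (simp add: pmf_map_fst J sum_divide_distrib[symmetric] sumF, simp add: q_def)
    show "\<bar>pmf J z - pmf (joint_pmf Q W) z\<bar> \<le> real CARD('b) / real n" for z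
      using g_abs n by (cases z) (simp add: diff divide_right_mono)
    have "(\<Sum>b\<in>UNIV. g a b * c a b) \<le> 0" for a
    proof -
      \<comment> \<open>The corrections sum to zero, so costs may be measured relative to the
        cheapest letter; then each term is a nonpositive correction times a nonnegative cost
        difference.\<close>
      have "(\<Sum>b\<in>UNIV. g a b * c a b) = (\<Sum>b\<in>UNIV. g a b * (c a b - c a (bs a)))"
        using sumg[of a] by (simp add: right_diff_distrib sum_subtractf sum_distrib_right[symmetric])
      also have "\<dots> \<le> 0"
      proof (rule sum_nonpos)
        fix b show "g a b * (c a b - c a (bs a)) \<le> 0"
          using g_neg(1)[of b a] bs[of a b] by (cases "b = bs a") (auto simp: mult_le_0_iff)
      qed
      finally show ?thesis .
    qed
    then have "(\<Sum>a\<in>UNIV. \<Sum>b\<in>UNIV. g a b * c a b) / real n \<le> 0"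
      by (simp add: sum_nonpos divide_le_0_iff)
    then show "measure_pmf.expectation J (\<lambda>(a, b). c a b) \<le> measure_pmf.expectation (joint_pmf Q W) (\<lambda>(a, b). c a b)"
      unfolding expectation_prod diff by (simp add: distrib_right sum.distrib sum_divide_distrib)
  qed
qed

text \<open>The constraint set of a rate-distortion problem depends lower hemicontinuously on the source,
  even at the minimal distortion level: if some slack is available, a small amount of the cheapest
  channel is mixed in; if not, the constraint already holds letter by letter on the support.\<close>

lemma feasible_types_approx:
  fixes Q :: "'a::finite pmf" and J :: "('a \<times> 'b::finite) pmf" and c :: "'a \<Rightarrow> 'b \<Rightarrow> real"
  assumes N: "\<And>k. N k > 0" "filterlim N at_top sequentially"
    and Qk: "\<And>k. is_type (N k) (Qk k)" and lim: "pmf_tendsto Qk Q"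
    and feas: "\<And>a. \<exists>b. c a b \<le> D"
    and J: "map_pmf fst J = Q" "measure_pmf.expectation J (\<lambda>(a, b). c a b) \<le> D"
  obtains Jk where "\<And>k. is_type (N k) (Jk k)" "\<And>k. map_pmf fst (Jk k) = Qk k"
    "\<And>k. measure_pmf.expectation (Jk k) (\<lambda>(a, b). c a b) \<le> D" "pmf_tendsto Jk J"
proof -
  obtain W where W: "joint_pmf Q W = J" using joint_pmf_surj[OF J(1)] by blast
  have "\<exists>b. \<forall>b'. c a b \<le> c a b'" for a
  proof -
    have "Min (range (c a)) \<in> range (c a)" by (rule Min_in) auto
    then obtain b where "c a b = Min (range (c a))" by force
    then show ?thesis by (intro exI[of _ b]) auto
  qed
  then obtain bs where bs: "\<And>a b. c a (bs a) \<le> c a b" by metis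
  have bsD: "c a (bs a) \<le> D" for a using feas bs order.trans by blast
  define m where "m a = c a (bs a)" for a
  \<comment> \<open>Where Q has no mass the channel is free, but the approximating types may charge
    such letters; the cheapest reproduction keeps their cost at most D.\<close>
  define W1 where "W1 a = (if pmf Q a > 0 then W a else return_pmf (bs a))" for a
  define w where "w a = (\<Sum>b\<in>UNIV. pmf (W1 a) b * c a b)" for a
  have J1: "joint_pmf Q W1 = J"
  proof (rule pmf_eqI)
    fix z show "pmf (joint_pmf Q W1) z = pmf J z"
      unfolding W[symmetric] by (cases z) (auto simp: pmf_joint_pmf W1_def less_le)
  qed
  have w_ret: "(\<Sum>b\<in>UNIV. pmf (return_pmf (bs a)) b * c a b) = m a" for a
  proof -
    have "(\<Sum>b\<in>UNIV. pmf (return_pmf (bs a)) b * c a b) = measure_pmf.expectation (return_pmf (bs a)) (c a)"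
      by (simp add: expectation_finite)
    then show ?thesis by (simp add: m_def)
  qed
  have w_ge: "w a \<ge> m a" for a
  proof -
    have "(\<Sum>b\<in>UNIV. pmf (W1 a) b * m a) \<le> w a"
      unfolding w_def m_def using bs by (intro sum_mono mult_left_mono) auto
    then show ?thesis by (simp add: sum_distrib_right[symmetric])
  qed
  \<comment> \<open>\<open>ex\<close> is the amount by which \<open>W1\<close> violates the
    constraint under q, \<open>sl\<close> the slack of the cheapest channel. The weight
    \<open>s\<close> solves (1 - s) (D + ex) + s (D - sl) = D; if both vanish, division by zero
    yields the desired weight 0.\<close>
  define ex where "ex q = max 0 ((\<Sum>a\<in>UNIV. pmf q a * w a) - D)" for q
  define sl where "sl q = D - (\<Sum>a\<in>UNIV. pmf q a * m a)" for q
  define s where "s q = ex q / (ex q + sl q)" for q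
  have ex_nn: "ex q \<ge> 0" for q by (simp add: ex_def)
  have sl_nn: "sl q \<ge> 0" for q
  proof -
    have "(\<Sum>a\<in>UNIV. pmf q a * m a) \<le> (\<Sum>a\<in>UNIV. pmf q a * D)"
      using bsD by (intro sum_mono mult_left_mono) (auto simp: m_def)
    then show ?thesis by (simp add: sl_def sum_distrib_right[symmetric])
  qed
  have s01: "0 \<le> s q" "s q \<le> 1" for q
    using ex_nn[of q] sl_nn[of q] by (auto simp: s_def divide_le_eq_1)
  have s_feas: "(1 - s q) * (\<Sum>a\<in>UNIV. pmf q a * w a) + s q * (\<Sum>a\<in>UNIV. pmf q a * m a) \<le> D" for q
  proof (cases "ex q = 0")
    case True
    then show ?thesis by (simp add: s_def) (simp add: ex_def max_def split: if_splits)
  next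
    case False
    then have e: "ex q > 0" "(\<Sum>a\<in>UNIV. pmf q a * w a) = D + ex q"
      by (auto simp: ex_def max_def split: if_splits)
    have m: "(\<Sum>a\<in>UNIV. pmf q a * m a) = D - sl q" by (simp add: sl_def)
    have "s q * (ex q + sl q) = ex q" using e sl_nn[of q] by (simp add: s_def)
    then show ?thesis unfolding e m by (simp add: algebra_simps)
  qed
  have ex_lim: "(\<lambda>k. ex (Qk k)) \<longlonglongrightarrow> 0"
  proof -
    have "(\<lambda>k. ex (Qk k)) \<longlonglongrightarrow> ex Q"
      unfolding ex_def using lim by (intro tendsto_intros) (auto simp: pmf_tendsto_def)
    moreover have "ex Q = 0"
      using J(2) unfolding J1[symmetric] expectation_joint by (simp add: ex_def w_def)
    ultimately show ?thesis by simp
  qed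
  have sl_lim: "(\<lambda>k. sl (Qk k)) \<longlonglongrightarrow> sl Q"
    unfolding sl_def using lim by (intro tendsto_intros) (auto simp: pmf_tendsto_def)
  have s_lim: "(\<lambda>k. s (Qk k)) \<longlonglongrightarrow> 0"
  proof (cases "sl Q = 0")
    case False
    then have "(\<lambda>k. s (Qk k)) \<longlonglongrightarrow> 0 / (0 + sl Q)"
      unfolding s_def by (intro tendsto_intros ex_lim sl_lim) auto
    then show ?thesis by simp
  next
    case True
    \<comment> \<open>Without slack every letter of positive mass has minimal cost D and
      \<open>W1\<close> attains it. So \<open>W1\<close> meets the constraint letter by letter,
      hence under every source, and nothing is mixed in.\<close>
    have m_le: "pmf Q a * m a \<le> pmf Q a * D" for a using bsD by (intro mult_left_mono) (auto simp: m_def)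
    have "(\<Sum>a\<in>UNIV. pmf Q a * m a) = (\<Sum>a\<in>UNIV. pmf Q a * D)"
      using True by (simp add: sl_def sum_distrib_right[symmetric])
    then have "\<forall>a\<in>UNIV. pmf Q a * m a = pmf Q a * D" using sum_mono_inv[of "\<lambda>a. pmf Q a * m a" UNIV "\<lambda>a. pmf Q a * D"] m_le by auto
    then have mD: "m a = D" if "pmf Q a > 0" for a using that by (metis UNIV_I less_irrefl mult_cancel_left)
    have "pmf Q a * m a \<le> pmf Q a * w a" for a using w_ge by (intro mult_left_mono) auto
    moreover have "(\<Sum>a\<in>UNIV. pmf Q a * w a) \<le> D"
      using J(2) unfolding J1[symmetric] expectation_joint by (simp add: w_def)
    moreover have "(\<Sum>a\<in>UNIV. pmf Q a * m a) = D" using True by (simp add: sl_def)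
    ultimately have "(\<Sum>a\<in>UNIV. pmf Q a * m a) = (\<Sum>a\<in>UNIV. pmf Q a * w a)"
      using sum_mono[of UNIV "\<lambda>a. pmf Q a * m a" "\<lambda>a. pmf Q a * w a"] by force
    then have "\<forall>a\<in>UNIV. pmf Q a * m a = pmf Q a * w a"
      using sum_mono_inv[of "\<lambda>a. pmf Q a * m a" UNIV "\<lambda>a. pmf Q a * w a"] w_ge by (auto simp: mult_left_mono)
    then have "w a \<le> D" for a
    proof (cases "pmf Q a > 0")
      case True
      have "pmf Q a * m a = pmf Q a * w a"
        using \<open>\<forall>a\<in>UNIV. pmf Q a * m a = pmf Q a * w a\<close> by blast
      then show ?thesis using mD[OF True] True by simp
    next
      case False
      then show ?thesis using w_ret[of a] bsD[of a] by (simp add: w_def W1_def m_def)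
    qed
    then have "(\<Sum>a\<in>UNIV. pmf q a * w a) \<le> (\<Sum>a\<in>UNIV. pmf q a * D)" for q
      by (intro sum_mono mult_left_mono) auto
    then have "ex q = 0" for q by (simp add: ex_def sum_distrib_right[symmetric])
    then show ?thesis by (simp add: s_def)
  qed
  define W2 where "W2 k a = mix_pmf (s (Qk k)) (W1 a) (return_pmf (bs a))" for k a
  have cost: "measure_pmf.expectation (joint_pmf (Qk k) (W2 k)) (\<lambda>(a, b). c a b) \<le> D" for k
  proof -
    have inner: "(\<Sum>b\<in>UNIV. pmf (W2 k a) b * c a b) = (1 - s (Qk k)) * w a + s (Qk k) * m a" for a
      using expectation_mix[OF s01, of "Qk k" "W1 a" "return_pmf (bs a)" "c a"]
      unfolding W2_def expectation_finite w_ret w_def[symmetric] .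
    then have "measure_pmf.expectation (joint_pmf (Qk k) (W2 k)) (\<lambda>(a, b). c a b) =
       (1 - s (Qk k)) * (\<Sum>a\<in>UNIV. pmf (Qk k) a * w a) + s (Qk k) * (\<Sum>a\<in>UNIV. pmf (Qk k) a * m a)"
      unfolding expectation_joint inner by (simp add: distrib_left sum.distrib sum_distrib_left mult.left_commute)
    with s_feas show ?thesis by simp
  qed
  have W2_lim: "pmf_tendsto (\<lambda>k. joint_pmf (Qk k) (W2 k)) J"
    unfolding pmf_tendsto_def
  proof
    fix z :: "'a \<times> 'b"
    obtain a b where z: "z = (a, b)" by force
    have "(\<lambda>k. pmf (W2 k a) b) \<longlonglongrightarrow> pmf (W1 a) b"
      using mix_tendsto[OF s_lim s01, of "W1 a" "return_pmf (bs a)"] by (simp add: W2_def pmf_tendsto_def)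
    then show "(\<lambda>k. pmf (joint_pmf (Qk k) (W2 k)) z) \<longlonglongrightarrow> pmf J z"
      using lim unfolding z pmf_joint_pmf J1[symmetric] by (intro tendsto_intros) (auto simp: pmf_tendsto_def)
  qed
  define approx where "approx k J' \<longleftrightarrow> is_type (N k) J' \<and> map_pmf fst J' = Qk k \<and>
    (\<forall>z. \<bar>pmf J' z - pmf (joint_pmf (Qk k) (W2 k)) z\<bar> \<le> real CARD('b) / real (N k)) \<and>
    measure_pmf.expectation J' (\<lambda>(a, b). c a b) \<le> D" for k J'
  have "\<exists>J'. approx k J'" for k
  proof -
    obtain J' where "is_type (N k) J'" "map_pmf fst J' = Qk k"
      "\<And>z. \<bar>pmf J' z - pmf (joint_pmf (Qk k) (W2 k)) z\<bar> \<le> real CARD('b) / real (N k)"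
      "measure_pmf.expectation J' (\<lambda>(a, b). c a b) \<le> measure_pmf.expectation (joint_pmf (Qk k) (W2 k)) (\<lambda>(a, b). c a b)"
      using round_to_type[where c = c and bs = bs and W = "W2 k", OF N(1)[of k] Qk[of k] bs] by blast
    then show ?thesis using cost[of k] unfolding approx_def by (blast intro: order.trans)
  qed
  then have "\<forall>k. \<exists>J'. approx k J'" by blast
  from choice[OF this] obtain Jk where "\<And>k. approx k (Jk k)" by blast
  then have Jk: "\<And>k. is_type (N k) (Jk k)" "\<And>k. map_pmf fst (Jk k) = Qk k"
    "\<And>k z. \<bar>pmf (Jk k) z - pmf (joint_pmf (Qk k) (W2 k)) z\<bar> \<le> real CARD('b) / real (N k)"
    "\<And>k. measure_pmf.expectation (Jk k) (\<lambda>(a, b). c a b) \<le> D"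
    unfolding approx_def by blast+
  have "pmf_tendsto Jk J"
    unfolding pmf_tendsto_def
  proof
    fix z
    have "(\<lambda>k. real CARD('b) / real (N k)) \<longlonglongrightarrow> 0"
      by (intro real_tendsto_divide_at_top[OF tendsto_const] filterlim_compose[OF filterlim_real_sequentially N(2)])
    then have "(\<lambda>k. pmf (Jk k) z - pmf (joint_pmf (Qk k) (W2 k)) z) \<longlonglongrightarrow> 0"
      by (rule Lim_null_comparison[rotated]) (simp add: Jk(3))
    then have "(\<lambda>k. (pmf (Jk k) z - pmf (joint_pmf (Qk k) (W2 k)) z) + pmf (joint_pmf (Qk k) (W2 k)) z) \<longlonglongrightarrow> 0 + pmf J z"
      using W2_lim unfolding pmf_tendsto_def by (intro tendsto_add) blast+
    then show "(\<lambda>k. pmf (Jk k) z) \<longlonglongrightarrow> pmf J z" by simp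
  qed
  with Jk show ?thesis by (intro that)
qed


section \<open>Rate-distortion functions\<close>

text \<open>By disintegration, optimising over channels is optimising over joint distributions with
  a prescribed first marginal, the form on which limits and types act.\<close>

lemma image_joint_pmf: "joint_pmf Q ` {W. F (joint_pmf Q W)} = {J :: ('a::finite \<times> 'b::finite) pmf. map_pmf fst J = Q \<and> F J}"
proof (intro equalityI subsetI)
  fix J :: "('a \<times> 'b) pmf" assume J: "J \<in> {J. map_pmf fst J = Q \<and> F J}"
  then have "map_pmf fst J = Q" by simp
  then obtain W where "joint_pmf Q W = J" by (rule joint_pmf_surj)
  with J show "J \<in> joint_pmf Q ` {W. F (joint_pmf Q W)}" by (intro image_eqI[of _ _ W]) auto
qed auto

text \<open>Crude entropy bounds suffice: they serve to make the real infima and suprema over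
  channels and sources bounded.\<close>

lemma cond_mutual_info_bounds:
  fixes J :: "(('a::finite \<times> 'b::finite) \<times> 'c::finite) pmf"
  shows "cond_mutual_info J \<ge> - 2 * real (CARD('a) * CARD('b) * CARD('c)) - 2 * real CARD('b)"
    and "cond_mutual_info J \<le> 2 * real (CARD('a) * CARD('b)) + 2 * real (CARD('b) * CARD('c))"
  using ent_nonneg[of "map_pmf fst J"] ent_nonneg[of "map_pmf snd (map_pmf fst J)"] ent_nonneg[of "yv_marg J"] ent_nonneg[of J]
    ent_le[of "map_pmf fst J"] ent_le[of "map_pmf snd (map_pmf fst J)"] ent_le[of "yv_marg J"] ent_le[of J]
  unfolding cond_mutual_info_eq by simp_all

abbreviation cost :: "('a \<Rightarrow> 'b \<Rightarrow> real) \<Rightarrow> ('a \<times> 'b) pmf \<Rightarrow> real" where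
  "cost c J \<equiv> measure_pmf.expectation J (\<lambda>(a, b). c a b)"

abbreviation cost_v :: "('a \<Rightarrow> 'c \<Rightarrow> real) \<Rightarrow> (('a \<times> 'b) \<times> 'c) pmf \<Rightarrow> real" where
  "cost_v c L \<equiv> measure_pmf.expectation L (\<lambda>((a, b), v). c a v)"

lemma cost_v_alt: "cost_v c L = cost (\<lambda>z v. c (fst z) v) L"
  by (simp add: case_prod_beta')

text \<open>Nonemptiness of the feasible set, by a deterministic channel; it guards the infima below
  against the default value of an empty one.\<close>

lemma exists_cheap_joint:
  fixes Q :: "'a::finite pmf" and c :: "'a \<Rightarrow> 'b::finite \<Rightarrow> real"
  assumes "\<And>a. \<exists>b. c a b \<le> D"
  obtains J where "map_pmf fst J = Q" "cost c J \<le> D"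
proof -
  obtain bs where bs: "\<And>a. c a (bs a) \<le> D" using assms by metis
  let ?J = "map_pmf (\<lambda>a. (a, bs a)) Q"
  have "cost c ?J = measure_pmf.expectation Q (\<lambda>a. c a (bs a))" by simp
  also have "\<dots> = (\<Sum>a\<in>UNIV. pmf Q a * c a (bs a))" by (simp add: expectation_finite)
  also have "\<dots> \<le> (\<Sum>a\<in>UNIV. pmf Q a * D)" using bs by (intro sum_mono mult_left_mono) auto
  finally have "cost c ?J \<le> D" by (simp add: sum_distrib_right[symmetric])
  then show ?thesis by (intro that[of ?J]) (auto simp: map_pmf_comp)
qed

lemma rate_dist_alt:
  fixes Q :: "'a::finite pmf" and d :: "'a \<Rightarrow> 'b::finite \<Rightarrow> real"
  shows "rate_dist d Q D = Inf (mutual_info ` {J. map_pmf fst J = Q \<and> cost d J \<le> D})"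
  unfolding rate_dist_def image_joint_pmf[symmetric, of Q "\<lambda>J. cost d J \<le> D"] by (simp add: image_image)

lemma cond_rate_dist_alt:
  fixes J :: "('a::finite \<times> 'b::finite) pmf" and c :: "'a \<Rightarrow> 'c::finite \<Rightarrow> real"
  shows "cond_rate_dist c J D = Inf (cond_mutual_info ` {L. map_pmf fst L = J \<and> cost_v c L \<le> D})"
  unfolding cond_rate_dist_def image_joint_pmf[symmetric, of J "\<lambda>J. cost_v c J \<le> D"] by (simp add: image_image)

lemma max_cond_rate_dist_alt:
  fixes Q :: "'a::finite pmf" and d :: "'a \<Rightarrow> 'b::finite \<Rightarrow> real" and c :: "'a \<Rightarrow> 'c::finite \<Rightarrow> real"
  shows "max_cond_rate_dist d c Q R D De =
    Sup ((\<lambda>J. cond_rate_dist c J De) ` {J. map_pmf fst J = Q \<and> cost d J \<le> D \<and> mutual_info J \<le> R})"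
  unfolding max_cond_rate_dist_def image_joint_pmf[symmetric, of Q "\<lambda>J. cost d J \<le> D \<and> mutual_info J \<le> R"]
  by (simp add: image_image)

lemma bdd_below_mutual_info: "bdd_below (mutual_info ` (A :: ('a::finite \<times> 'b::finite) pmf set))"
  by (rule bdd_belowI2) (rule mutual_info_nonneg)

lemma rate_dist_le:
  fixes J :: "('a::finite \<times> 'b::finite) pmf"
  assumes "map_pmf fst J = Q" "cost d J \<le> D"
  shows "rate_dist d Q D \<le> mutual_info J"
  unfolding rate_dist_alt
  by (rule cInf_lower[OF _ bdd_below_mutual_info]) (use assms in auto)

lemma rate_dist_nonneg:
  fixes Q :: "'a::finite pmf" and d :: "'a \<Rightarrow> 'b::finite \<Rightarrow> real"
  assumes "\<And>a. \<exists>b. d a b \<le> D"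
  shows "rate_dist d Q D \<ge> 0"
proof -
  obtain J where "map_pmf fst J = Q" "cost d J \<le> D" using exists_cheap_joint assms by blast
  then have ne: "{J. map_pmf fst J = Q \<and> cost d J \<le> D} \<noteq> {}" by blast
  show ?thesis unfolding rate_dist_alt by (rule cINF_greatest[OF ne mutual_info_nonneg])
qed

lemma rate_dist_upper:
  fixes Q :: "'a::finite pmf" and d :: "'a \<Rightarrow> 'b::finite \<Rightarrow> real"
  assumes "\<And>a. \<exists>b. d a b \<le> D"
  shows "rate_dist d Q D \<le> 2 * real CARD('a) + 2 * real CARD('b)"
proof -
  obtain J where "map_pmf fst J = Q" "cost d J \<le> D" using exists_cheap_joint assms by blast
  from rate_dist_le[OF this] mutual_info_le[of J] show ?thesis by linarith
qed

lemma rate_dist_less: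
  fixes Q :: "'a::finite pmf" and d :: "'a \<Rightarrow> 'b::finite \<Rightarrow> real"
  assumes "rate_dist d Q D < x" "\<And>a. \<exists>b. d a b \<le> D"
  obtains J where "map_pmf fst J = Q" "cost d J \<le> D" "mutual_info J < x"
proof -
  obtain J where "map_pmf fst J = Q" "cost d J \<le> D" using exists_cheap_joint assms(2) by blast
  then show ?thesis
    using cInf_lessD[OF _ assms(1)[unfolded rate_dist_alt]] that by auto
qed

lemma bdd_below_cond_mutual_info:
  "bdd_below (cond_mutual_info ` (A :: (('a::finite \<times> 'b::finite) \<times> 'c::finite) pmf set))"
  by (rule bdd_belowI2) (rule cond_mutual_info_bounds)

lemma cond_rate_dist_le:
  fixes L :: "(('a::finite \<times> 'b::finite) \<times> 'c::finite) pmf"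
  assumes "map_pmf fst L = J" "cost_v c L \<le> D"
  shows "cond_rate_dist c J D \<le> cond_mutual_info L"
  unfolding cond_rate_dist_alt
  by (rule cInf_lower[OF _ bdd_below_cond_mutual_info]) (use assms in auto)

lemma exists_cheap_joint_v:
  fixes J :: "('a::finite \<times> 'b::finite) pmf" and c :: "'a \<Rightarrow> 'c::finite \<Rightarrow> real"
  assumes "\<And>a. \<exists>v. c a v \<le> D"
  obtains L where "map_pmf fst L = J" "cost_v c L \<le> D"
  using exists_cheap_joint[of "\<lambda>z. c (fst z)" D J] assms unfolding cost_v_alt by blast

lemma cond_rate_dist_less:
  fixes J :: "('a::finite \<times> 'b::finite) pmf" and c :: "'a \<Rightarrow> 'c::finite \<Rightarrow> real"
  assumes "cond_rate_dist c J D < x" "\<And>a. \<exists>v. c a v \<le> D"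
  obtains L where "map_pmf fst L = J" "cost_v c L \<le> D" "cond_mutual_info L < x"
proof -
  obtain L where "map_pmf fst L = J" "cost_v c L \<le> D" using exists_cheap_joint_v assms(2) by blast
  then show ?thesis
    using cInf_lessD[OF _ assms(1)[unfolded cond_rate_dist_alt]] that by auto
qed

lemma cond_rate_dist_upper:
  fixes J :: "('a::finite \<times> 'b::finite) pmf" and c :: "'a \<Rightarrow> 'c::finite \<Rightarrow> real"
  assumes "\<And>a. \<exists>v. c a v \<le> D"
  shows "cond_rate_dist c J D \<le> 2 * real (CARD('a) * CARD('b)) + 2 * real (CARD('b) * CARD('c))"
proof -
  obtain L where "map_pmf fst L = J" "cost_v c L \<le> D" using exists_cheap_joint_v assms by blast
  then show ?thesis by (rule order.trans[OF cond_rate_dist_le cond_mutual_info_bounds(2)])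
qed

lemma cond_rate_dist_lower:
  fixes J :: "('a::finite \<times> 'b::finite) pmf" and c :: "'a \<Rightarrow> 'c::finite \<Rightarrow> real"
  assumes "\<And>a. \<exists>v. c a v \<le> D"
  shows "cond_rate_dist c J D \<ge> - 2 * real (CARD('a) * CARD('b) * CARD('c)) - 2 * real CARD('b)"
proof -
  obtain L where "map_pmf fst L = J" "cost_v c L \<le> D" using exists_cheap_joint_v assms by blast
  then have ne: "{L. map_pmf fst L = J \<and> cost_v c L \<le> D} \<noteq> {}" by blast
  show ?thesis unfolding cond_rate_dist_alt
    by (rule cINF_greatest[OF ne cond_mutual_info_bounds(1)])
qed

lemma max_cond_rate_dist_ge:
  fixes J :: "('a::finite \<times> 'b::finite) pmf" and c :: "'a \<Rightarrow> 'c::finite \<Rightarrow> real"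
  assumes "map_pmf fst J = Q" "cost d J \<le> D" "mutual_info J \<le> R" "\<And>a. \<exists>v. c a v \<le> De"
  shows "cond_rate_dist c J De \<le> max_cond_rate_dist d c Q R D De"
  unfolding max_cond_rate_dist_alt
  by (rule cSup_upper) (use assms in \<open>auto intro!: bdd_aboveI2 cond_rate_dist_upper\<close>)

text \<open>The given J guarantees that the supremum ranges over a nonempty set.\<close>

lemma max_cond_rate_dist_less:
  fixes J :: "('a::finite \<times> 'b::finite) pmf" and c :: "'a \<Rightarrow> 'c::finite \<Rightarrow> real"
  assumes "x < max_cond_rate_dist d c Q R D De" "map_pmf fst J = Q" "cost d J \<le> D" "mutual_info J \<le> R"
  obtains J' :: "('a \<times> 'b) pmf" where "map_pmf fst J' = Q" "cost d J' \<le> D" "mutual_info J' \<le> R" "x < cond_rate_dist c J' De"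
  using less_cSupD[OF _ assms(1)[unfolded max_cond_rate_dist_alt]] assms(2-) by auto

text \<open>Near-optimal channels along an offending subsequence have a limit point that is feasible
  for J, since all constraints are closed. This half of continuity is what achievability uses: the
  eavesdropper's task must not become easier near J.\<close>

lemma cond_rate_dist_lsc:
  fixes J :: "('a::finite \<times> 'b::finite) pmf" and c :: "'a \<Rightarrow> 'c::finite \<Rightarrow> real"
  assumes X: "pmf_tendsto X J" and c: "\<And>a. \<exists>v. c a v \<le> D" and x: "x < cond_rate_dist c J D"
  shows "eventually (\<lambda>k. x < cond_rate_dist c (X k) D) sequentially"
proof (rule ccontr)
  assume "\<not> ?thesis"
  then have "\<forall>m. \<exists>k\<ge>m. cond_rate_dist c (X k) D \<le> x"
    by (auto simp: eventually_sequentially not_less)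
  then have "infinite {k. cond_rate_dist c (X k) D \<le> x}"
    unfolding infinite_nat_iff_unbounded_le by auto
  from infinite_enumerate[OF this]
  have "\<exists>r :: nat \<Rightarrow> nat. strict_mono r \<and> (\<forall>k. cond_rate_dist c (X (r k)) D \<le> x)" by simp
  then obtain r :: "nat \<Rightarrow> nat" where r: "strict_mono r" "\<And>k. cond_rate_dist c (X (r k)) D \<le> x" by blast
  \<comment> \<open>A value strictly in between leaves room for channels that are only nearly
    optimal.\<close>
  define y where "y = (x + cond_rate_dist c J D) / 2"
  have y: "x < y" "y < cond_rate_dist c J D" using x by (auto simp: y_def)
  have "\<exists>L. map_pmf fst L = X (r k) \<and> cost_v c L \<le> D \<and> cond_mutual_info L < y" for k
  proof -
    have "cond_rate_dist c (X (r k)) D < y" using r(2)[of k] y by linarith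
    then obtain L where "map_pmf fst L = X (r k)" "cost_v c L \<le> D" "cond_mutual_info L < y"
      using c by (rule cond_rate_dist_less)
    then show ?thesis by blast
  qed
  then have "\<forall>k. \<exists>L. map_pmf fst L = X (r k) \<and> cost_v c L \<le> D \<and> cond_mutual_info L < y" by blast
  from choice[OF this]
  obtain L where L: "\<And>k. map_pmf fst (L k) = X (r k)" "\<And>k. cost_v c (L k) \<le> D" "\<And>k. cond_mutual_info (L k) < y"
    by blast
  obtain s M where s: "strict_mono s" "pmf_tendsto (L \<circ> s) M" using pmf_compact by blast
  have "pmf_tendsto (\<lambda>k. map_pmf fst ((L \<circ> s) k)) (map_pmf fst M)" by (rule pmf_tendsto_map[OF s(2)])
  moreover have "pmf_tendsto ((X \<circ> r) \<circ> s) J" by (intro pmf_tendsto_subseq X r s)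
  ultimately have M1: "map_pmf fst M = J" by (simp add: L comp_def pmf_tendsto_unique)
  have "cost_v c M \<le> D"
    by (rule LIMSEQ_le_const2[OF pmf_tendsto_expectation[OF s(2)]]) (auto simp: L(2))
  moreover have "cond_mutual_info M \<le> y"
    by (rule LIMSEQ_le_const2[OF cond_mutual_info_tendsto[OF s(2)]]) (auto intro!: exI[of _ 0] less_imp_le simp: L(3))
  ultimately show False using cond_rate_dist_le[OF M1, of c D] y by linarith
qed

text \<open>Trivial side information turns the unconditional quantities into special cases of the
  conditional ones.\<close>

definition unit_ext :: "'a pmf \<Rightarrow> ('a \<times> unit) pmf" where
  "unit_ext Q = map_pmf (\<lambda>x. (x, ())) Q"

text \<open>Appending the constant is a bijection of the feasible joint distributions, and it
  preserves the information because a one-letter marginal has entropy zero.\<close>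

lemma rate_dist_unit:
  fixes Q :: "'a::finite pmf" and c :: "'a \<Rightarrow> 'v::finite \<Rightarrow> real"
  shows "rate_dist c Q D = cond_rate_dist c (unit_ext Q) D"
proof -
  let ?f = "\<lambda>(x :: 'a, v :: 'v). ((x, ()), v)" and ?g = "\<lambda>((x :: 'a, u :: unit), v :: 'v). (x, v)"
  have gf: "?g (?f z) = z" for z by (cases z) auto
  have fg: "?f (?g z) = z" for z by (cases z) auto
  have unit0: "ent (p :: unit pmf) = 0" for p
  proof -
    have "pmf p () = 1" using sum_pmf_UNIV[of p] by (simp add: UNIV_unit)
    then show ?thesis by (simp add: ent_def UNIV_unit)
  qed
  have info: "cond_mutual_info (map_pmf ?f J) = mutual_info J" for J
  proof -
    have 1: "ent (map_pmf fst (map_pmf ?f J)) = ent (map_pmf fst J)"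
      using ent_map_inj[of "\<lambda>x. (x, ())" "map_pmf fst J"] by (simp add: map_pmf_comp case_prod_beta' inj_on_def)
    have 2: "ent (yv_marg (map_pmf ?f J)) = ent (map_pmf snd J)"
      using ent_map_inj[of "\<lambda>x. ((), x)" "map_pmf snd J"] by (simp add: yv_marg_def map_pmf_comp case_prod_beta' inj_on_def)
    have 3: "ent (map_pmf ?f J) = ent J" by (rule ent_map_inj) (auto simp: inj_on_def)
    show ?thesis unfolding cond_mutual_info_eq mutual_info_eq 1 2 3 unit0 by simp
  qed
  have "map_pmf ?f ` {J. map_pmf fst J = Q \<and> cost c J \<le> D} = {L. map_pmf fst L = unit_ext Q \<and> cost_v c L \<le> D}"
  proof (intro equalityI subsetI)
    fix L assume "L \<in> map_pmf ?f ` {J. map_pmf fst J = Q \<and> cost c J \<le> D}"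
    then show "L \<in> {L. map_pmf fst L = unit_ext Q \<and> cost_v c L \<le> D}"
      by (auto simp: unit_ext_def map_pmf_comp case_prod_beta')
  next
    fix L assume L: "L \<in> {L. map_pmf fst L = unit_ext Q \<and> cost_v c L \<le> D}"
    have "L = map_pmf ?f (map_pmf ?g L)" by (simp add: map_pmf_comp fg)
    moreover have "map_pmf fst (map_pmf ?g L) = map_pmf fst (map_pmf fst L)"
      by (simp add: map_pmf_comp case_prod_beta')
    then have "map_pmf fst (map_pmf ?g L) = Q"
      using L by (simp add: unit_ext_def map_pmf_comp[of fst "\<lambda>x. (x, ())"])
    moreover have "cost c (map_pmf ?g L) \<le> D" using L by (simp add: case_prod_beta')
    ultimately show "L \<in> map_pmf ?f ` {J. map_pmf fst J = Q \<and> cost c J \<le> D}" by blast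
  qed
  then show ?thesis unfolding rate_dist_alt cond_rate_dist_alt by (metis (no_types, lifting) image_cong image_image info)
qed

section \<open>Counting by types\<close>

text \<open>The empirical distribution, encoded as the law of the entry at a uniform position, so
  that marginals of joint types come from functoriality of \<open>map_pmf\<close>. It is unspecified
  for the empty list.\<close>

definition emp :: "'a list \<Rightarrow> 'a pmf" where
  "emp xs = map_pmf (nth xs) (pmf_of_set {..<length xs})"

definition tclass :: "nat \<Rightarrow> 'a pmf \<Rightarrow> 'a list set" where
  "tclass n Q = {xs \<in> seqs n. emp xs = Q}"

lemma seqs_length [simp]: "xs \<in> seqs n \<longleftrightarrow> length xs = n"
  by (simp add: seqs_def)

lemma finite_seqs [simp]: "finite (seqs n :: 'a::finite list set)"
  using finite_lists_length_eq[of "UNIV :: 'a set" n] by (simp add: seqs_def)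

lemma finite_seqs_Collect [simp]: "finite {xs :: 'a::finite list. length xs = n \<and> P xs}"
  by (rule finite_subset[of _ "seqs n"]) auto

lemma finite_tclass [simp]: "finite (tclass n (Q :: 'a::finite pmf))"
  by (rule finite_subset[of _ "seqs n"]) (auto simp: tclass_def)

lemma tclass_length: "xs \<in> tclass n Q \<Longrightarrow> length xs = n"
  by (simp add: tclass_def)

lemma map_emp: "xs \<noteq> [] \<Longrightarrow> map_pmf f (emp xs) = emp (map f xs)"
  unfolding emp_def map_pmf_comp by (intro map_pmf_cong) (auto simp: set_pmf_of_set lessThan_empty_iff)

lemma pmf_emp: "xs \<noteq> [] \<Longrightarrow> pmf (emp xs) a = real (count (mset xs) a) / real (length xs)"
proof -
  assume "xs \<noteq> []"
  then have "pmf (emp xs) a = real (card ({..<length xs} \<inter> nth xs -` {a})) / real (length xs)"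
    unfolding emp_def by (subst pmf_map, subst measure_pmf_of_set) auto
  also have "{..<length xs} \<inter> nth xs -` {a} = {i. i < length xs \<and> a = xs ! i}" by auto
  finally show ?thesis
    by (simp add: count_mset count_list_eq_length_filter length_filter_conv_card)
qed

lemma emp_eq_iff:
  assumes "length xs = n" "length ys = n" "n > 0"
  shows "emp xs = emp ys \<longleftrightarrow> mset xs = mset ys"
proof -
  have ne: "xs \<noteq> []" "ys \<noteq> []" using assms by auto
  have "emp xs = emp ys \<longleftrightarrow> (\<forall>a. count (mset xs) a = count (mset ys) a)"
    using assms by (simp add: pmf_eq_iff pmf_emp[OF ne(1)] pmf_emp[OF ne(2)])
  then show ?thesis by (simp add: multiset_eq_iff)
qed

lemma expectation_emp:
  fixes f :: "'a \<Rightarrow> real"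
  assumes "xs \<noteq> []"
  shows "measure_pmf.expectation (emp xs) f = (\<Sum>i<length xs. f (xs ! i)) / real (length xs)"
  unfolding emp_def using assms by (simp, subst integral_pmf_of_set) auto

lemma seq_dist_emp:
  assumes "length xs = n" "length ys = n" "n > 0"
  shows "seq_dist n d xs ys = cost d (emp (zip xs ys))"
proof -
  have "zip xs ys \<noteq> []" using assms by (cases xs; cases ys) auto
  then show ?thesis using assms by (simp add: expectation_emp seq_dist_def)
qed

lemma is_type_emp: "length xs = n \<Longrightarrow> n > 0 \<Longrightarrow> is_type n (emp xs)"
  by (cases "xs = []") (auto simp: is_type_def pmf_emp)

definition tcount :: "nat \<Rightarrow> 'a pmf \<Rightarrow> 'a \<Rightarrow> nat" where
  "tcount n Q a = nat \<lfloor>real n * pmf Q a\<rfloor>"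

lemma tcount: "is_type n Q \<Longrightarrow> real (tcount n Q a) = real n * pmf Q a"
  unfolding is_type_def tcount_def by (metis Nats_cases floor_of_nat nat_int)

lemma tcount_emp: "length xs = n \<Longrightarrow> n > 0 \<Longrightarrow> tcount n (emp xs) a = count (mset xs) a"
  by (cases "xs = []") (auto simp: tcount_def pmf_emp)

lemma tclass_nonempty:
  fixes Q :: "'a::finite pmf"
  assumes "is_type n Q" "n > 0"
  shows "tclass n Q \<noteq> {}"
proof -
  define M where "M = (\<Sum>a\<in>UNIV. replicate_mset (tcount n Q a) a)"
  have cM: "count M a = tcount n Q a" for a
    unfolding M_def by (simp add: count_sum)
  have "real (size M) = (\<Sum>a\<in>UNIV. real (tcount n Q a))" by (simp add: M_def)
  also have "\<dots> = real n" by (simp add: tcount[OF assms(1)] sum_distrib_left[symmetric])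
  finally have sM: "size M = n" by simp
  obtain xs where xs: "mset xs = M" using ex_mset by blast
  then have len: "length xs = n" using sM by auto
  then have "xs \<noteq> []" using assms by auto
  then have "emp xs = Q"
    using assms len by (intro pmf_eqI) (simp add: pmf_emp xs cM tcount)
  then show ?thesis using len by (auto simp: tclass_def)
qed

lemma is_type_map:
  fixes J :: "'a::finite pmf"
  assumes "is_type n J"
  shows "is_type n (map_pmf f J)"
  unfolding is_type_def
proof
  fix b
  have "real n * pmf (map_pmf f J) b = real (\<Sum>a | f a = b. tcount n J a)"
    using assms by (simp add: pmf_map_finite sum_distrib_left tcount)
  then show "real n * pmf (map_pmf f J) b \<in> \<nat>" by (simp only: of_nat_in_Nats)
qed

lemma card_types:
  assumes "n > 0"
  shows "finite {J :: 'a::finite pmf. is_type n J}"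
    and "card {J :: 'a::finite pmf. is_type n J} \<le> (n + 1) ^ CARD('a)"
proof -
  let ?T = "{J :: 'a pmf. is_type n J}"
  have le: "tcount n Q a \<le> n" if "is_type n Q" for Q :: "'a pmf" and a
  proof -
    have "real (tcount n Q a) \<le> real n * 1" unfolding tcount[OF that] by (intro mult_left_mono) (auto simp: pmf_le_1)
    then show ?thesis by simp
  qed
  have sub: "tcount n ` ?T \<subseteq> (UNIV \<rightarrow>\<^sub>E {0..n})" using le by auto
  have fin: "finite ((UNIV :: 'a set) \<rightarrow>\<^sub>E {0..n})" by (intro finite_PiE) auto
  have inj: "inj_on (tcount n) ?T"
  proof (rule inj_onI)
    fix P Q :: "'a pmf" assume PQ: "P \<in> ?T" "Q \<in> ?T" and eq: "tcount n P = tcount n Q"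
    have "real n * pmf P a = real n * pmf Q a" for a
      using PQ by (metis eq mem_Collect_eq tcount)
    then show "P = Q" using assms by (intro pmf_eqI) simp
  qed
  show "finite ?T" using finite_subset[OF sub fin] inj by (simp add: finite_image_iff)
  have "card ?T \<le> card ((UNIV :: 'a set) \<rightarrow>\<^sub>E {0..n})"
    using card_mono[OF fin sub] by (simp add: card_image[OF inj])
  then show "card ?T \<le> (n + 1) ^ CARD('a)" by (simp add: card_PiE)
qed

text \<open>Sequences of equal type differ by a permutation of positions. Permuting positions
  preserves the type L and commutes with \<open>map f\<close>, so all fibres over one type class
  have the same size. Every conditional count below is an instance.\<close>

lemma card_fibre:
  fixes L :: "'c::finite pmf" and f :: "'c \<Rightarrow> 'b::finite"
  assumes n: "n > 0" and y: "y \<in> tclass n (map_pmf f L)"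
  shows "card {w \<in> tclass n L. map f w = y} * card (tclass n (map_pmf f L)) = card (tclass n L)"
proof -
  let ?F = "\<lambda>y. {w \<in> tclass n L. map f w = y}"
  \<comment> \<open>One inequality for arbitrary y and y' is enough, by symmetry.\<close>
  have le: "card (?F y) \<le> card (?F y')" if yy: "y \<in> tclass n (map_pmf f L)" "y' \<in> tclass n (map_pmf f L)" for y y'
  proof -
    have "mset y' = mset y" using yy n emp_eq_iff[of y' n y] by (auto simp: tclass_def)
    then obtain p where p: "p permutes {..<length y}" "permute_list p y = y'" by (rule mset_eq_permutation)
    have ly: "length y = n" using yy by (simp add: tclass_def)
    have "permute_list p ` ?F y \<subseteq> ?F y'"
    proof
      fix w' assume "w' \<in> permute_list p ` ?F y"
      then obtain w where w: "w' = permute_list p w" "length w = n" "emp w = L" "map f w = y"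
        by (auto simp: tclass_def)
      have pw: "p permutes {..<length w}" using p ly w by simp
      have "map f w' = y'" using permute_list_map[OF pw, of f] p w by simp
      moreover have "emp w' = L"
        using w n pw emp_eq_iff[of w' n w] by simp
      ultimately show "w' \<in> ?F y'" using w by (simp add: tclass_def)
    qed
    moreover have "inj_on (permute_list p) (?F y)"
    proof (rule inj_onI)
      fix u w assume uw: "u \<in> ?F y" "w \<in> ?F y" and eq: "permute_list p u = permute_list p w"
      have l: "length u = n" "length w = n" using uw by (auto simp: tclass_def)
      show "u = w"
      proof (rule nth_equalityI)
        show "length u = length w" using l by simp
        fix i assume i: "i < length u"
        have "i \<in> p ` {..<length y}" using permutes_image[OF p(1)] i l ly by simp
        then obtain j where j: "j < n" "p j = i" using ly by auto
        then show "u ! i = w ! i"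
          using permute_list_nth[of p u j] permute_list_nth[of p w j] p(1) ly l eq by simp
      qed
    qed
    ultimately show ?thesis by (intro card_inj_on_le[of "permute_list p"]) auto
  qed
  have "card (tclass n L) = card (\<Union>y'\<in>tclass n (map_pmf f L). ?F y')"
  proof -
    have "tclass n L = (\<Union>y'\<in>tclass n (map_pmf f L). ?F y')"
      using n by (auto simp: tclass_def) (metis list.size(3) map_emp less_irrefl)
    then show ?thesis by simp
  qed
  also have "\<dots> = (\<Sum>y'\<in>tclass n (map_pmf f L). card (?F y'))"
    by (intro card_UN_disjoint) auto
  also have "\<dots> = (\<Sum>y'\<in>tclass n (map_pmf f L). card (?F y))"
    by (intro sum.cong refl antisym le y)
  finally show ?thesis by simp
qed

section \<open>Stirling bounds and polynomial factors\<close>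

lemma fact_lower: "real n ^ n \<le> fact n * exp (real n)"
proof -
  have "(\<Sum>k\<in>{n}. real n ^ k /\<^sub>R fact k) \<le> (\<Sum>k. real n ^ k /\<^sub>R fact k)"
    by (intro sum_le_suminf summable_exp_generic) auto
  then have "real n ^ n / fact n \<le> exp (real n)" by (simp add: exp_def field_simps)
  then show ?thesis by (simp add: field_simps)
qed

text \<open>By induction; the step amounts to (1 + 1/k)^(k+1) \<ge> e, which follows from ln y \<le>
  y - 1 at y = k / (k + 1).\<close>

lemma fact_upper:
  assumes "k \<ge> 1"
  shows "fact k * exp (real k) \<le> exp 1 * real k * real k ^ k"
  using assms
proof (induction k rule: nat_induct_at_least)
  case (Suc k)
  have "ln (real k / real (k + 1)) \<le> real k / real (k + 1) - 1"
    using Suc by (intro ln_le_minus_one) auto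
  then have "1 / real (k + 1) \<le> ln (real (k + 1) / real k)"
    using Suc by (simp add: ln_div field_simps)
  then have "1 \<le> real (k + 1) * ln (real (k + 1) / real k)"
    by (simp add: field_simps)
  then have "exp 1 \<le> exp (real (k + 1) * ln (real (k + 1) / real k))" by simp
  also have "\<dots> = (real (k + 1) / real k) ^ (k + 1)"
    using Suc by (simp only: exp_of_nat_mult) simp
  finally have key: "exp 1 * real k ^ (k + 1) \<le> real (k + 1) ^ (k + 1)"
    using Suc by (simp add: power_divide field_simps del: power_Suc of_nat_Suc)
  have "fact (Suc k) * exp (real (Suc k)) = real (k + 1) * exp 1 * (fact k * exp (real k))"
    by (simp add: exp_add algebra_simps)
  also have "\<dots> \<le> real (k + 1) * exp 1 * (exp 1 * real k * real k ^ k)"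
    using Suc.IH by (intro mult_left_mono) auto
  also have "\<dots> = real (k + 1) * exp 1 * (exp 1 * real k ^ (k + 1))" by simp
  also have "\<dots> \<le> real (k + 1) * exp 1 * real (k + 1) ^ (k + 1)"
    using key by (intro mult_left_mono) auto
  finally show ?case by (simp add: mult_ac)
qed simp

text \<open>Polynomial factor that absorbs the Stirling errors and the number of types.\<close>

definition pc :: "nat \<Rightarrow> nat \<Rightarrow> real" where
  "pc n a = (3 * (real n + 1)) ^ a"

lemma pc_ge_1: "pc n a \<ge> 1"
  unfolding pc_def by (intro one_le_power) auto

lemma pc_pos [simp]: "pc n a > 0"
  using pc_ge_1[of n a] by linarith

lemma pc_nonneg [simp]: "pc n a \<ge> 0"
  by (rule less_imp_le) simp

lemma pc_mult: "pc n a * pc n b = pc n (a + b)"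
  by (simp add: pc_def power_add)

lemma pc_mono: "a \<le> b \<Longrightarrow> pc n a \<le> pc n b"
  unfolding pc_def by (intro power_increasing) auto

lemma card_types_pc:
  assumes "n > 0"
  shows "real (card {J :: 'a::finite pmf. is_type n J}) \<le> pc n CARD('a)"
proof -
  have "real (card {J :: 'a pmf. is_type n J}) \<le> real ((n + 1) ^ CARD('a))"
    using card_types(2)[OF assms] of_nat_le_iff by blast
  also have "\<dots> \<le> pc n CARD('a)" unfolding pc_def of_nat_power by (intro power_mono) auto
  finally show ?thesis .
qed

section \<open>Sizes and probabilities of type classes\<close>

lemma prod_pmf_emp:
  assumes "xs \<noteq> []" "\<And>x. x \<in> set xs \<Longrightarrow> pmf P x > 0"
  shows "prod_list (map (pmf P) xs) =
    2 powr (real (length xs) * measure_pmf.expectation (emp xs) (\<lambda>a. log 2 (pmf P a)))"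
proof -
  have "real (length xs) * measure_pmf.expectation (emp xs) (\<lambda>a. log 2 (pmf P a)) = (\<Sum>i<length xs. log 2 (pmf P (xs ! i)))"
    using assms by (simp add: expectation_emp)
  also have "2 powr \<dots> = (\<Prod>i<length xs. 2 powr log 2 (pmf P (xs ! i)))"
    by (subst powr_sum) auto
  also have "\<dots> = (\<Prod>i<length xs. pmf P (xs ! i))"
    using assms by (intro prod.cong) auto
  also have "\<dots> = prod_list (map (pmf P) xs)"
    by (simp add: prod.list_conv_set_nth atLeast0LessThan)
  finally show ?thesis by simp
qed

lemma pmf_replicate: "pmf (replicate_pmf n P) xs = (if length xs = n then prod_list (map (pmf P) xs) else 0)"
proof (induction n arbitrary: xs)
  case (Suc n)
  have eq: "replicate_pmf (Suc n) P = map_pmf (\<lambda>(x, xs). x # xs) (pair_pmf P (replicate_pmf n P))"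
    by (simp add: pair_pmf_def map_bind_pmf)
  show ?case
  proof (cases xs)
    case (Cons y ys)
    have inj: "inj (\<lambda>(x, xs). x # xs)" by (auto simp: inj_on_def)
    have "pmf (replicate_pmf (Suc n) P) xs = pmf (pair_pmf P (replicate_pmf n P)) (y, ys)"
      unfolding eq Cons using pmf_map_inj'[OF inj, of "pair_pmf P (replicate_pmf n P)" "(y, ys)"] by simp
    then show ?thesis using Suc Cons by (simp add: pmf_pair)
  next
    case Nil
    then show ?thesis unfolding eq by (subst pmf_map_outside) auto
  qed
qed (auto simp: indicator_def)

lemma set_tclass: "xs \<in> tclass n Q \<Longrightarrow> n > 0 \<Longrightarrow> x \<in> set xs \<Longrightarrow> pmf Q x > 0"
  by (cases "xs = []") (auto simp: tclass_def pmf_emp)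

text \<open>A sequence of type Q has probability exactly \<open>2 powr (- (real n * ent Q))\<close>
  under Q itself, and the total is at most 1. If Q is not a type for n, the class is empty.\<close>

lemma card_tclass_upper:
  fixes Q :: "'a::finite pmf"
  assumes "n > 0"
  shows "real (card (tclass n Q)) \<le> 2 powr (real n * ent Q)"
proof -
  have "pmf (replicate_pmf n Q) xs = 2 powr (- (real n * ent Q))" if xs: "xs \<in> tclass n Q" for xs
  proof -
    have "xs \<noteq> []" "length xs = n" "emp xs = Q" using xs assms by (auto simp: tclass_def)
    then show ?thesis
      using set_tclass[OF xs assms] by (simp add: pmf_replicate prod_pmf_emp ent_expectation)
  qed
  then have "(\<Sum>xs\<in>tclass n Q. pmf (replicate_pmf n Q) xs) = real (card (tclass n Q)) * 2 powr (- (real n * ent Q))"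
    by simp
  moreover have "(\<Sum>xs\<in>tclass n Q. pmf (replicate_pmf n Q) xs) \<le> 1"
    using measure_measure_pmf_finite[of "tclass n Q" "replicate_pmf n Q"] by (metis finite_tclass measure_pmf.prob_le_1)
  ultimately have "real (card (tclass n Q)) * 2 powr (- (real n * ent Q)) * 2 powr (real n * ent Q) \<le> 1 * 2 powr (real n * ent Q)"
    by (intro mult_right_mono) auto
  then show ?thesis by (simp add: mult.assoc powr_add[symmetric])
qed

text \<open>The class size is a multinomial coefficient. Stirling is applied from below to n! and
  from above to the other factorials; the exponentials cancel because the counts sum to n, and 0^0 =
  1 covers letters that do not occur.\<close>

lemma card_tclass_lower:
  fixes Q :: "'a::finite pmf"
  assumes n: "n > 0" and Q: "is_type n Q"
  shows "real (card (tclass n Q)) * pc n CARD('a) \<ge> 2 powr (real n * ent Q)"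
proof -
  let ?t = "tcount n Q"
  obtain xs where xs: "xs \<in> tclass n Q" using tclass_nonempty[OF Q n] by blast
  then have len: "length xs = n" and emp: "emp xs = Q" by (auto simp: tclass_def)
  have cnt: "count (mset xs) a = ?t a" for a using tcount_emp[OF len n, of a] emp by simp
  have "tclass n Q = permutations_of_multiset (mset xs)"
  proof (rule set_eqI)
    fix x show "x \<in> tclass n Q \<longleftrightarrow> x \<in> permutations_of_multiset (mset xs)"
      using emp_eq_iff[OF _ len n, of x] emp mset_eq_length[of x xs] len
      by (auto simp: tclass_def permutations_of_multiset_def)
  qed
  then have "card (tclass n Q) * (\<Prod>a\<in>set_mset (mset xs). fact (?t a)) = fact n"
    using card_permutations_of_multiset_aux[of "mset xs"] by (simp add: cnt len)
  also have "(\<Prod>a\<in>set_mset (mset xs). fact (?t a)) = (\<Prod>a\<in>UNIV. fact (?t a) :: nat)"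
    by (rule prod.mono_neutral_left) (auto simp: cnt[symmetric] count_mset count_list_0_iff)
  finally have "real (card (tclass n Q) * (\<Prod>a\<in>UNIV. fact (?t a))) = real (fact n)" by (rule arg_cong)
  then have card: "real (card (tclass n Q)) * (\<Prod>a\<in>UNIV. fact (?t a)) = fact n" by (simp add: of_nat_prod)
  have t_le: "?t a \<le> n" for a
    using cnt[of a] count_le_length[of xs a] len by (simp add: count_mset)
  \<comment> \<open>The 3 in \<open>pc\<close> bounds exp 1, and n + 1 bounds the count while
    staying positive for letters with count zero.\<close>
  have fac: "fact (?t a) * exp (real (?t a)) \<le> 3 * (real n + 1) * real (?t a) ^ ?t a" for a
  proof (cases "?t a = 0")
    case False
    then have "fact (?t a) * exp (real (?t a)) \<le> exp 1 * real (?t a) * real (?t a) ^ ?t a"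
      by (intro fact_upper) auto
    also have "\<dots> \<le> 3 * (real n + 1) * real (?t a) ^ ?t a"
      using t_le[of a] exp_le by (intro mult_right_mono mult_mono) auto
    finally show ?thesis .
  qed simp
  have sum_t: "(\<Sum>a\<in>UNIV. real (?t a)) = real n"
    by (simp add: tcount[OF Q] sum_distrib_left[symmetric])
  have "real n ^ n \<le> fact n * exp (real n)" by (rule fact_lower)
  also have "\<dots> = real (card (tclass n Q)) * (\<Prod>a\<in>UNIV. fact (?t a) * exp (real (?t a)))"
    by (simp add: card[symmetric] prod.distrib exp_sum[symmetric] sum_t)
  also have "\<dots> \<le> real (card (tclass n Q)) * (\<Prod>a\<in>UNIV. 3 * (real n + 1) * real (?t a) ^ ?t a)"
    by (intro mult_left_mono prod_mono conjI fac) auto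
  also have "\<dots> = real (card (tclass n Q)) * pc n CARD('a) * (\<Prod>a\<in>UNIV. real (?t a) ^ ?t a)"
    by (simp add: prod.distrib pc_def power_mult_distrib)
  finally have main: "real n ^ n \<le> real (card (tclass n Q)) * pc n CARD('a) * (\<Prod>a\<in>UNIV. real (?t a) ^ ?t a)" .
  have "2 powr (real n * ent Q) = 2 powr (\<Sum>a\<in>UNIV. - (real (?t a) * log 2 (pmf Q a)))"
    by (simp add: ent_def sum_negf sum_distrib_left tcount[OF Q] mult.assoc)
  also have "\<dots> = (\<Prod>a\<in>UNIV. 2 powr (- (real (?t a) * log 2 (pmf Q a))))" by (rule powr_sum) auto
  also have "\<dots> = (\<Prod>a\<in>UNIV. real n ^ ?t a / real (?t a) ^ ?t a)"
  proof (rule prod.cong)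
    fix a show "2 powr (- (real (?t a) * log 2 (pmf Q a))) = real n ^ ?t a / real (?t a) ^ ?t a"
    proof (cases "?t a = 0")
      case False
      then have pos: "pmf Q a > 0" using tcount[OF Q, of a] by (metis less_eq_real_def mult_zero_right of_nat_eq_0_iff pmf_nonneg)
      have "2 powr (- (real (?t a) * log 2 (pmf Q a))) = (2 powr log 2 (pmf Q a)) powr (- real (?t a))"
        by (simp add: powr_powr mult.commute)
      also have "\<dots> = 1 / pmf Q a ^ ?t a"
        using pos by (simp add: powr_minus powr_realpow divide_inverse)
      also have "\<dots> = real n ^ ?t a / real (?t a) ^ ?t a"
        using n tcount[OF Q, of a] by (simp add: power_mult_distrib)
      finally show ?thesis .
    qed simp
  qed simp
  also have "\<dots> = real n ^ n / (\<Prod>a\<in>UNIV. real (?t a) ^ ?t a)"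
  proof -
    have "(\<Sum>a\<in>UNIV. ?t a) = n" using sum_t by (metis of_nat_eq_iff of_nat_sum)
    then show ?thesis by (simp add: prod_dividef power_sum[symmetric])
  qed
  also have "\<dots> \<le> real (card (tclass n Q)) * pc n CARD('a)"
  proof -
    have "(\<Prod>a\<in>UNIV. real (?t a) ^ ?t a) > 0" by (intro prod_pos) auto
    then show ?thesis using main by (simp add: pos_divide_le_eq)
  qed
  finally show ?thesis .
qed

lemma prob_seq_type:
  fixes P Q :: "'a::finite pmf"
  assumes n: "n > 0" and P: "set_pmf P = UNIV" and xs: "xs \<in> tclass n Q"
  shows "pmf (replicate_pmf n P) xs = 2 powr (- (real n * (KL Q P + ent Q)))"
proof -
  have "xs \<noteq> []" "length xs = n" "emp xs = Q" using xs n by (auto simp: tclass_def)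
  moreover have "pmf P x > 0" for x using P by (simp add: pmf_positive)
  moreover have e: "measure_pmf.expectation Q (\<lambda>a. log 2 (pmf P a)) = - (KL Q P + ent Q)"
    by (simp add: KL_altdef[OF P] expectation_finite)
  ultimately have "pmf (replicate_pmf n P) xs = 2 powr (real n * measure_pmf.expectation Q (\<lambda>a. log 2 (pmf P a)))"
    using prod_pmf_emp[of xs P] by (simp add: pmf_replicate)
  also have "real n * measure_pmf.expectation Q (\<lambda>a. log 2 (pmf P a)) = - (real n * (KL Q P + ent Q))"
    unfolding e by (simp only: mult_minus_right)
  finally show ?thesis .
qed

lemma prob_tclass:
  fixes P Q :: "'a::finite pmf"
  assumes n: "n > 0" and P: "set_pmf P = UNIV"
  shows "measure_pmf.prob (replicate_pmf n P) (tclass n Q) = real (card (tclass n Q)) * 2 powr (- (real n * (KL Q P + ent Q)))"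
  using prob_seq_type[OF assms] by (simp add: measure_measure_pmf_finite)

lemma prob_tclass_bounds:
  fixes P Q :: "'a::finite pmf"
  assumes n: "n > 0" and P: "set_pmf P = UNIV"
  shows "measure_pmf.prob (replicate_pmf n P) (tclass n Q) \<le> 2 powr (- (real n * KL Q P))"
    and "is_type n Q \<Longrightarrow> measure_pmf.prob (replicate_pmf n P) (tclass n Q) * pc n CARD('a) \<ge> 2 powr (- (real n * KL Q P))"
proof -
  have e: "2 powr (- (real n * KL Q P)) = 2 powr (real n * ent Q) * 2 powr (- (real n * (KL Q P + ent Q)))"
    by (simp add: powr_add[symmetric] algebra_simps)
  show "measure_pmf.prob (replicate_pmf n P) (tclass n Q) \<le> 2 powr (- (real n * KL Q P))"
    unfolding prob_tclass[OF assms] e by (intro mult_right_mono card_tclass_upper n) auto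
  assume "is_type n Q"
  then have "2 powr (real n * ent Q) * 2 powr (- (real n * (KL Q P + ent Q))) \<le>
    (real (card (tclass n Q)) * pc n CARD('a)) * 2 powr (- (real n * (KL Q P + ent Q)))"
    by (intro mult_right_mono card_tclass_lower n) auto
  then show "measure_pmf.prob (replicate_pmf n P) (tclass n Q) * pc n CARD('a) \<ge> 2 powr (- (real n * KL Q P))"
    unfolding prob_tclass[OF assms] e by (simp add: mult_ac)
qed


text \<open>The conditional type classes (shells): \<open>jfib\<close> for sources given a
  reproduction, \<open>jfib'\<close> for reproductions given a source, \<open>cfib\<close> for
  sources given reproduction and estimate. As \<open>zip\<close> truncates, they are meant for given
  sequences of length n.\<close>

definition jfib :: "nat \<Rightarrow> ('a \<times> 'b) pmf \<Rightarrow> 'b list \<Rightarrow> 'a list set" where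
  "jfib n J y = {x \<in> seqs n. emp (zip x y) = J}"

definition jfib' :: "nat \<Rightarrow> ('a \<times> 'b) pmf \<Rightarrow> 'a list \<Rightarrow> 'b list set" where
  "jfib' n J x = {y \<in> seqs n. emp (zip x y) = J}"

definition cfib :: "nat \<Rightarrow> (('a \<times> 'b) \<times> 'c) pmf \<Rightarrow> 'b list \<Rightarrow> 'c list \<Rightarrow> 'a list set" where
  "cfib n L y v = {x \<in> seqs n. emp (zip (zip x y) v) = L}"

lemma finite_fibs [simp]:
  "finite (jfib n (J :: ('a::finite \<times> 'b) pmf) y)" "finite (jfib' n (J' :: ('a \<times> 'b::finite) pmf) x)"
  "finite (cfib n (L :: (('a::finite \<times> 'b) \<times> 'c) pmf) y v)"
  unfolding jfib_def jfib'_def cfib_def by simp_all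

lemma zip_ne: "length xs = n \<Longrightarrow> length ys = n \<Longrightarrow> n > 0 \<Longrightarrow> zip xs ys \<noteq> []"
  by (cases xs; cases ys) auto

lemma emp_zip_marg:
  assumes "length x = n" "length y = n" "n > 0"
  shows "map_pmf fst (emp (zip x y)) = emp x" "map_pmf snd (emp (zip x y)) = emp y"
  using assms zip_ne[OF assms] by (simp_all add: map_emp)

lemma jfib_in_tclass:
  assumes "x \<in> jfib n J y" "length y = n" "n > 0"
  shows "x \<in> tclass n (map_pmf fst J)" "y \<in> tclass n (map_pmf snd J)"
  using assms emp_zip_marg[of x n y] by (auto simp: jfib_def tclass_def)

text \<open>Zipping with y identifies the shell with a fibre of the second projection, so
  \<open>card_fibre\<close> applies; \<open>card_jfib'\<close> and \<open>card_cfib\<close> do the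
  same for other projections.\<close>

lemma card_jfib:
  fixes J :: "('a::finite \<times> 'b::finite) pmf"
  assumes "n > 0" "y \<in> tclass n (map_pmf snd J)"
  shows "card (jfib n J y) * card (tclass n (map_pmf snd J)) = card (tclass n J)"
proof -
  have y: "length y = n" using assms by (simp add: tclass_def)
  have "bij_betw (\<lambda>x. zip x y) (jfib n J y) {w \<in> tclass n J. map snd w = y}"
  proof (rule bij_betwI[where g = "map fst"])
    show "(\<lambda>x. zip x y) \<in> jfib n J y \<rightarrow> {w \<in> tclass n J. map snd w = y}"
      by (simp add: jfib_def tclass_def y)
    show "map fst \<in> {w \<in> tclass n J. map snd w = y} \<rightarrow> jfib n J y"
    proof
      fix w assume w: "w \<in> {w \<in> tclass n J. map snd w = y}"
      then have "zip (map fst w) y = w" using zip_map_fst_snd[of w] by simp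
      with w show "map fst w \<in> jfib n J y" by (simp add: jfib_def tclass_def)
    qed
    show "map fst (zip x y) = x" if "x \<in> jfib n J y" for x using that by (simp add: jfib_def y)
    show "zip (map fst w) y = w" if "w \<in> {w \<in> tclass n J. map snd w = y}" for w
      using that zip_map_fst_snd[of w] by simp
  qed
  from bij_betw_same_card[OF this] show ?thesis using card_fibre[OF assms] by simp
qed

lemma card_jfib':
  fixes J :: "('a::finite \<times> 'b::finite) pmf"
  assumes "n > 0" "x \<in> tclass n (map_pmf fst J)"
  shows "card (jfib' n J x) * card (tclass n (map_pmf fst J)) = card (tclass n J)"
proof -
  have x: "length x = n" using assms by (simp add: tclass_def)
  have "bij_betw (\<lambda>y. zip x y) (jfib' n J x) {w \<in> tclass n J. map fst w = x}"
  proof (rule bij_betwI[where g = "map snd"])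
    show "(\<lambda>y. zip x y) \<in> jfib' n J x \<rightarrow> {w \<in> tclass n J. map fst w = x}"
      by (simp add: jfib'_def tclass_def x)
    show "map snd \<in> {w \<in> tclass n J. map fst w = x} \<rightarrow> jfib' n J x"
    proof
      fix w assume w: "w \<in> {w \<in> tclass n J. map fst w = x}"
      then have "zip x (map snd w) = w" using zip_map_fst_snd[of w] by simp
      with w show "map snd w \<in> jfib' n J x" by (simp add: jfib'_def tclass_def)
    qed
    show "map snd (zip x y) = y" if "y \<in> jfib' n J x" for y using that by (simp add: jfib'_def x)
    show "zip x (map snd w) = w" if "w \<in> {w \<in> tclass n J. map fst w = x}" for w
      using that zip_map_fst_snd[of w] by simp
  qed
  from bij_betw_same_card[OF this] show ?thesis using card_fibre[OF assms] by simp
qed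

lemma map_yv_zip:
  "length x = n \<Longrightarrow> length y = n \<Longrightarrow> length v = n \<Longrightarrow> map (\<lambda>((x, y), v). (y, v)) (zip (zip x y) v) = zip y v"
  by (auto intro!: nth_equalityI)

lemma card_cfib:
  fixes L :: "(('a::finite \<times> 'b::finite) \<times> 'c::finite) pmf"
  assumes "n > 0" "zip y v \<in> tclass n (yv_marg L)" "length y = n" "length v = n"
  shows "card (cfib n L y v) * card (tclass n (yv_marg L)) = card (tclass n L)"
proof -
  let ?f = "\<lambda>((x, y), v). (y, v)"
  have "bij_betw (\<lambda>x. zip (zip x y) v) (cfib n L y v) {w \<in> tclass n L. map ?f w = zip y v}"
  proof (intro bij_betwI[where g = "map (\<lambda>((x, y), v). x)"])
    show "(\<lambda>x. zip (zip x y) v) \<in> cfib n L y v \<rightarrow> {w \<in> tclass n L. map ?f w = zip y v}"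
      using assms map_yv_zip[of _ n y v] by (auto simp: cfib_def tclass_def)
    have inv: "zip (zip (map (\<lambda>((x, y), v). x) w) y) v = w" if w: "w \<in> tclass n L" "map ?f w = zip y v" for w
    proof (rule nth_equalityI)
      have l: "length w = n" using w by (simp add: tclass_def)
      then show "length (zip (zip (map (\<lambda>((x, y), v). x) w) y) v) = length w" using assms by simp
      fix i assume "i < length (zip (zip (map (\<lambda>((x, y), v). x) w) y) v)"
      then have i: "i < n" using assms l by simp
      have "map ?f w ! i = zip y v ! i" by (simp add: w)
      then show "zip (zip (map (\<lambda>((x, y), v). x) w) y) v ! i = w ! i"
        using i l assms by (cases "w ! i") (auto split: prod.splits)
    qed
    show "map (\<lambda>((x, y), v). x) \<in> {w \<in> tclass n L. map ?f w = zip y v} \<rightarrow> cfib n L y v"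
      using inv by (auto simp: cfib_def tclass_def)
    show "zip (zip (map (\<lambda>((x, y), v). x) w) y) v = w" if "w \<in> {w \<in> tclass n L. map ?f w = zip y v}" for w
      using that inv by blast
    show "map (\<lambda>((x, y), v). x) (zip (zip x y) v) = x" if "x \<in> cfib n L y v" for x
      using that assms by (auto simp: cfib_def intro!: nth_equalityI)
  qed
  from bij_betw_same_card[OF this] show ?thesis
    using card_fibre[OF assms(1), of "zip y v" ?f L] assms(2) by (simp add: yv_marg_def)
qed

lemma is_type_tclass_pos: "is_type n (Q :: 'a::finite pmf) \<Longrightarrow> n > 0 \<Longrightarrow> card (tclass n Q) > 0"
  using tclass_nonempty[of n Q] by (simp add: card_gt_0_iff)

text \<open>\<open>card (tclass n J) / S\<close> is the probability that independent uniform
  sequences of the two marginal types have joint type J. The estimates are multiplied out to avoid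
  divisions.\<close>

lemma mutual_info_count:
  fixes J :: "('a::finite \<times> 'b::finite) pmf"
  assumes n: "n > 0" and J: "is_type n J"
  defines "S \<equiv> real (card (tclass n (map_pmf fst J))) * real (card (tclass n (map_pmf snd J)))"
  shows "real (card (tclass n J)) \<le> S * (pc n (CARD('a) + CARD('b)) * 2 powr (- (real n * mutual_info J)))"
    and "S * 2 powr (- (real n * mutual_info J)) \<le> real (card (tclass n J)) * pc n (CARD('a) * CARD('b))"
proof -
  let ?X = "map_pmf fst J" and ?Y = "map_pmf snd J"
  have e: "2 powr (real n * ent J) = 2 powr (real n * ent ?X) * 2 powr (real n * ent ?Y) * 2 powr (- (real n * mutual_info J))"
    by (simp add: mutual_info_eq powr_add[symmetric] algebra_simps)
  have ty: "is_type n ?X" "is_type n ?Y" using J by (auto intro: is_type_map)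
  have "real (card (tclass n J)) \<le> 2 powr (real n * ent ?X) * 2 powr (real n * ent ?Y) * 2 powr (- (real n * mutual_info J))"
    using card_tclass_upper[OF n, of J] by (simp add: e)
  also have "\<dots> \<le> (real (card (tclass n ?X)) * pc n CARD('a)) * (real (card (tclass n ?Y)) * pc n CARD('b)) * 2 powr (- (real n * mutual_info J))"
    by (intro mult_right_mono mult_mono card_tclass_lower n ty) auto
  finally show "real (card (tclass n J)) \<le> S * (pc n (CARD('a) + CARD('b)) * 2 powr (- (real n * mutual_info J)))"
    by (simp add: S_def pc_mult[symmetric] mult_ac)
  have "S * 2 powr (- (real n * mutual_info J)) \<le> 2 powr (real n * ent ?X) * 2 powr (real n * ent ?Y) * 2 powr (- (real n * mutual_info J))"
    unfolding S_def by (intro mult_right_mono mult_mono card_tclass_upper n) auto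
  also have "\<dots> \<le> real (card (tclass n J)) * pc n CARD('a \<times> 'b)"
    unfolding e[symmetric] by (rule card_tclass_lower[OF n J])
  finally show "S * 2 powr (- (real n * mutual_info J)) \<le> real (card (tclass n J)) * pc n (CARD('a) * CARD('b))" by simp
qed

text \<open>The quotient u / w has two readings: the fraction of the shell of y that forms joint
  type L with (y, v), and the probability that v drawn uniformly from its shell given y completes
  (x, y) to L. The upper estimate serves achievability in \<open>cond_ball_bound\<close>, the lower
  one the converse in \<open>guess_count\<close>.\<close>

lemma cond_mutual_info_count:
  fixes L :: "(('a::finite \<times> 'b::finite) \<times> 'c::finite) pmf"
  assumes n: "n > 0" and L: "is_type n L"
  defines "u \<equiv> real (card (tclass n L)) * real (card (tclass n (map_pmf snd (map_pmf fst L))))"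
    and "w \<equiv> real (card (tclass n (map_pmf fst L))) * real (card (tclass n (yv_marg L)))"
  shows "u \<le> w * (pc n (CARD('a) * CARD('b) + CARD('b) * CARD('c)) * 2 powr (- (real n * cond_mutual_info L)))"
    and "w * 2 powr (- (real n * cond_mutual_info L)) \<le> u * pc n (CARD('a) * CARD('b) * CARD('c) + CARD('b))"
proof -
  let ?J = "map_pmf fst L" and ?Y = "map_pmf snd (map_pmf fst L)" and ?V = "yv_marg L"
  have e: "2 powr (real n * ent L) * 2 powr (real n * ent ?Y) = 2 powr (real n * ent ?J) * 2 powr (real n * ent ?V) * 2 powr (- (real n * cond_mutual_info L))"
    unfolding cond_mutual_info_eq powr_add[symmetric] by (simp add: algebra_simps)
  have ty: "is_type n ?J" "is_type n ?Y" "is_type n ?V" unfolding yv_marg_def using L by (auto intro!: is_type_map)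
  have "u \<le> 2 powr (real n * ent L) * 2 powr (real n * ent ?Y)"
    unfolding u_def by (intro mult_mono card_tclass_upper n) auto
  also have "\<dots> \<le> (real (card (tclass n ?J)) * pc n CARD('a \<times> 'b)) * (real (card (tclass n ?V)) * pc n CARD('b \<times> 'c)) * 2 powr (- (real n * cond_mutual_info L))"
    unfolding e by (intro mult_right_mono mult_mono card_tclass_lower n ty) auto
  finally show "u \<le> w * (pc n (CARD('a) * CARD('b) + CARD('b) * CARD('c)) * 2 powr (- (real n * cond_mutual_info L)))"
    by (simp add: w_def pc_mult[symmetric] mult_ac)
  have "w * 2 powr (- (real n * cond_mutual_info L)) \<le> 2 powr (real n * ent ?J) * 2 powr (real n * ent ?V) * 2 powr (- (real n * cond_mutual_info L))"
    unfolding w_def by (intro mult_right_mono mult_mono card_tclass_upper n) auto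
  also have "\<dots> \<le> (real (card (tclass n L)) * pc n CARD(('a \<times> 'b) \<times> 'c)) * (real (card (tclass n ?Y)) * pc n CARD('b))"
    unfolding e[symmetric] by (intro mult_mono card_tclass_lower n L ty) auto
  finally show "w * 2 powr (- (real n * cond_mutual_info L)) \<le> u * pc n (CARD('a) * CARD('b) * CARD('c) + CARD('b))"
    by (simp add: u_def pc_mult[symmetric] mult_ac)
qed

section \<open>Shells, distortion balls and random guesses\<close>

lemma jfib_bound:
  fixes J :: "('a::finite \<times> 'b::finite) pmf"
  assumes n: "n > 0" and J: "is_type n J" and y: "length y = n"
  shows "real (card (jfib n J y)) \<le> real (card (tclass n (map_pmf fst J))) * (pc n (CARD('a) + CARD('b)) * 2 powr (- (real n * mutual_info J)))"
proof (cases "y \<in> tclass n (map_pmf snd J)")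
  case True
  let ?Y = "real (card (tclass n (map_pmf snd J)))"
  have pos: "?Y > 0" using True by (simp add: card_gt_0_iff) blast
  have c: "real (card (jfib n J y)) * ?Y = real (card (tclass n J))"
    using card_jfib[OF n True] by (metis of_nat_mult)
  have "real (card (jfib n J y)) * ?Y \<le> (real (card (tclass n (map_pmf fst J))) * (pc n (CARD('a) + CARD('b)) * 2 powr (- (real n * mutual_info J)))) * ?Y"
    using mutual_info_count(1)[OF n J] unfolding c by (simp only: mult_ac)
  then show ?thesis by (rule mult_right_le_imp_le[OF _ pos])
next
  case False
  then have "jfib n J y = {}" using jfib_in_tclass(2)[OF _ y n] by blast
  then show ?thesis by (simp add: less_imp_le)
qed

text \<open>The ball splits by the joint type L of (x, y, v). Each admissible L has conditional
  information at least \<open>cond_rate_dist c J D\<close>, an infimum over a set containing L. In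
  the exponent of \<open>pc\<close>, the first summand counts the types L, the rest is the Stirling
  loss.\<close>

lemma cond_ball_bound:
  fixes J :: "('a::finite \<times> 'b::finite) pmf" and c :: "'a \<Rightarrow> 'c::finite \<Rightarrow> real"
  assumes n: "n > 0" and J: "is_type n J" and y: "y \<in> tclass n (map_pmf snd J)" and v: "length v = n"
  shows "real (card {x \<in> jfib n J y. seq_dist n c x v \<le> D}) \<le> real (card (jfib n J y)) *
    (pc n (CARD('a) * CARD('b) * CARD('c) + (CARD('a) * CARD('b) + CARD('b) * CARD('c))) * 2 powr (- (real n * cond_rate_dist c J D)))"
proof -
  let ?A = "CARD('a) * CARD('b) + CARD('b) * CARD('c)"
  let ?B = "real (card (jfib n J y)) * (pc n ?A * 2 powr (- (real n * cond_rate_dist c J D)))"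
  have ly: "length y = n" using y by (simp add: tclass_def)
  define S where "S = {L :: (('a \<times> 'b) \<times> 'c) pmf. is_type n L \<and> map_pmf fst L = J \<and> cost_v c L \<le> D}"
  have sub: "S \<subseteq> {L. is_type n L}" by (auto simp: S_def)
  then have finS: "finite S" by (rule finite_subset[OF _ card_types(1)[OF n]])
  have "real (card S) \<le> real (card {L :: (('a \<times> 'b) \<times> 'c) pmf. is_type n L})"
    using card_mono[OF card_types(1)[OF n] sub] by simp
  also have "\<dots> \<le> pc n (CARD('a) * CARD('b) * CARD('c))" using card_types_pc[OF n, where 'a = "('a \<times> 'b) \<times> 'c"] by simp
  finally have cardS: "real (card S) \<le> pc n (CARD('a) * CARD('b) * CARD('c))" .
  have "{x \<in> jfib n J y. seq_dist n c x v \<le> D} \<subseteq> (\<Union>L\<in>S. cfib n L y v)"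
  proof
    fix x assume x: "x \<in> {x \<in> jfib n J y. seq_dist n c x v \<le> D}"
    then have lx: "length x = n" and Jx: "emp (zip x y) = J" and dx: "seq_dist n c x v \<le> D" by (auto simp: jfib_def)
    let ?L = "emp (zip (zip x y) v)"
    have "is_type n ?L" using lx ly v n by (intro is_type_emp) auto
    moreover have "map_pmf fst ?L = J" using emp_zip_marg(1)[of "zip x y" n v] lx ly v n Jx by simp
    moreover have "cost_v c ?L = seq_dist n c x v"
      using lx ly v n zip_ne[of "zip x y" n v] by (simp add: expectation_emp seq_dist_def)
    ultimately have "?L \<in> S" using dx by (simp add: S_def)
    moreover have "x \<in> cfib n ?L y v" using lx by (simp add: cfib_def)
    ultimately show "x \<in> (\<Union>L\<in>S. cfib n L y v)" by blast
  qed
  then have "card {x \<in> jfib n J y. seq_dist n c x v \<le> D} \<le> card (\<Union>L\<in>S. cfib n L y v)"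
    using finS by (intro card_mono) auto
  also have "\<dots> \<le> (\<Sum>L\<in>S. card (cfib n L y v))" by (rule card_UN_le[OF finS])
  finally have "real (card {x \<in> jfib n J y. seq_dist n c x v \<le> D}) \<le> real (\<Sum>L\<in>S. card (cfib n L y v))"
    by (rule of_nat_mono)
  also have "\<dots> = (\<Sum>L\<in>S. real (card (cfib n L y v)))" by (rule of_nat_sum)
  also have "\<dots> \<le> (\<Sum>L\<in>S. ?B)"
  proof (rule sum_mono)
    fix L assume L: "L \<in> S"
    show "real (card (cfib n L y v)) \<le> ?B"
    proof (cases "zip y v \<in> tclass n (yv_marg L)")
      case True
      have LJ: "map_pmf fst L = J" and ty: "is_type n L" using L by (auto simp: S_def)
      have pos: "real (card (tclass n (yv_marg L))) > 0" "real (card (tclass n (map_pmf snd J))) > 0"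
        using True y by (simp_all add: card_gt_0_iff) blast+
      have c1: "real (card (cfib n L y v)) * real (card (tclass n (yv_marg L))) = real (card (tclass n L))"
        unfolding of_nat_mult[symmetric] by (rule arg_cong[OF card_cfib[OF n True ly v]])
      have c2: "real (card (jfib n J y)) * real (card (tclass n (map_pmf snd J))) = real (card (tclass n J))"
        unfolding of_nat_mult[symmetric] by (rule arg_cong[OF card_jfib[OF n y]])
      have "real (card (cfib n L y v)) * (real (card (tclass n (yv_marg L))) * real (card (tclass n (map_pmf snd J))))
        \<le> real (card (jfib n J y)) * (pc n ?A * 2 powr (- (real n * cond_mutual_info L))) * (real (card (tclass n (yv_marg L))) * real (card (tclass n (map_pmf snd J))))"
        using cond_mutual_info_count(1)[OF n ty] unfolding LJ c1[symmetric] c2[symmetric] by (simp only: mult_ac)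
      then have "real (card (cfib n L y v)) \<le> real (card (jfib n J y)) * (pc n ?A * 2 powr (- (real n * cond_mutual_info L)))"
        by (rule mult_right_le_imp_le) (use pos in simp)
      also have "\<dots> \<le> ?B"
        using cond_rate_dist_le[OF LJ, of c D] L by (intro mult_left_mono) (auto simp: S_def intro!: mult_left_mono)
      finally show ?thesis .
    next
      case False
      have "cfib n L y v = {}"
      proof (rule ccontr)
        assume "cfib n L y v \<noteq> {}"
        then obtain x where x: "length x = n" "emp (zip (zip x y) v) = L" by (auto simp: cfib_def)
        have "yv_marg L = emp (zip y v)"
          unfolding x(2)[symmetric] yv_marg_def using x ly v n
          by (subst map_emp) (auto simp: map_yv_zip intro!: zip_ne[of _ n])
        then show False using False ly v by (simp add: tclass_def)
      qed
      then show ?thesis by (simp add: less_imp_le)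
    qed
  qed
  also have "\<dots> = real (card S) * ?B" by simp
  also have "\<dots> \<le> pc n (CARD('a) * CARD('b) * CARD('c)) * ?B"
    by (intro mult_right_mono cardS) (simp add: less_imp_le)
  finally show ?thesis by (simp add: pc_mult[symmetric] mult_ac)
qed

lemma emp_unit_zip:
  assumes "length x = n" "n > 0"
  shows "emp (zip x (replicate n ())) = unit_ext (emp x)"
proof -
  have "zip x (replicate n ()) = map (\<lambda>x. (x, ())) x" using assms(1) by (auto intro!: nth_equalityI)
  moreover have "x \<noteq> []" using assms by auto
  ultimately show ?thesis unfolding unit_ext_def by (simp add: map_emp)
qed

lemma map_unit_ext [simp]: "map_pmf fst (unit_ext Q) = Q" "map_pmf snd (unit_ext Q) = return_pmf ()"
  by (simp_all add: unit_ext_def map_pmf_comp)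

lemma unit_ext_inj: "unit_ext P = unit_ext Q \<longleftrightarrow> P = Q"
  by (metis map_unit_ext(1))

lemma jfib_unit: "n > 0 \<Longrightarrow> jfib n (unit_ext Q) (replicate n ()) = tclass n Q"
  unfolding jfib_def tclass_def by (auto simp: emp_unit_zip unit_ext_inj)

lemma is_type_unit_ext: "is_type n (Q :: 'a::finite pmf) \<Longrightarrow> is_type n (unit_ext Q)"
  unfolding unit_ext_def by (rule is_type_map)

lemma unit_tclass: "n > 0 \<Longrightarrow> replicate n () \<in> tclass n (return_pmf ())"
proof -
  have "pmf (p :: unit pmf) () = 1" for p using sum_pmf_UNIV[of p] by (simp add: UNIV_unit)
  then have "(p :: unit pmf) = return_pmf ()" for p by (intro pmf_eqI) simp
  then show ?thesis by (simp add: tclass_def)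
qed

lemma ball_bound:
  fixes Q :: "'a::finite pmf" and c :: "'a \<Rightarrow> 'c::finite \<Rightarrow> real"
  assumes n: "n > 0" and Q: "is_type n Q" and v: "length v = n"
  shows "real (card {x \<in> tclass n Q. seq_dist n c x v \<le> D}) \<le> real (card (tclass n Q)) *
    (pc n (CARD('a) * CARD('c) + (CARD('a) + CARD('c))) * 2 powr (- (real n * rate_dist c Q D)))"
  using cond_ball_bound[OF n is_type_unit_ext[OF Q], of "replicate n ()" v c D] unit_tclass[OF n] v
  by (simp add: jfib_unit[OF n] rate_dist_unit)

text \<open>Compares the estimates that complete (x, y) to L with all estimates of the right type
  relative to y alone; the quotient is the success probability of a uniform guess.\<close>

lemma guess_count:
  fixes L :: "(('a::finite \<times> 'b::finite) \<times> 'c::finite) pmf"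
  assumes n: "n > 0" and L: "is_type n L" and xy: "zip x y \<in> tclass n (map_pmf fst L)" "length x = n" "length y = n"
  shows "real (card (jfib' n (yv_marg L) y)) * 2 powr (- (real n * cond_mutual_info L)) \<le>
    real (card (jfib' n L (zip x y))) * pc n (CARD('a) * CARD('b) * CARD('c) + CARD('b))"
proof -
  let ?J = "map_pmf fst L" and ?Y = "map_pmf snd (map_pmf fst L)" and ?V = "yv_marg L"
  have V1: "map_pmf fst ?V = ?Y" unfolding yv_marg_def map_pmf_comp by (rule map_pmf_cong) auto
  have y: "y \<in> tclass n ?Y" using xy emp_zip_marg(2)[of x n y] n by (simp add: tclass_def)
  have c1: "real (card (jfib' n L (zip x y))) * real (card (tclass n ?J)) = real (card (tclass n L))"
    using card_jfib'[OF n xy(1)] by (metis of_nat_mult)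
  have c2: "real (card (jfib' n ?V y)) * real (card (tclass n ?Y)) = real (card (tclass n ?V))"
    using card_jfib'[OF n, of y ?V] y by (metis V1 of_nat_mult)
  have pos: "real (card (tclass n ?J)) > 0" "real (card (tclass n ?Y)) > 0"
    using xy y by (simp_all add: card_gt_0_iff) blast+
  have "real (card (jfib' n ?V y)) * 2 powr (- (real n * cond_mutual_info L)) * (real (card (tclass n ?J)) * real (card (tclass n ?Y)))
     \<le> real (card (jfib' n L (zip x y))) * pc n (CARD('a) * CARD('b) * CARD('c) + CARD('b)) * (real (card (tclass n ?J)) * real (card (tclass n ?Y)))"
    using cond_mutual_info_count(2)[OF n L] unfolding c1[symmetric] c2[symmetric] by (simp only: mult_ac)
  then show ?thesis by (rule mult_right_le_imp_le) (use pos in simp)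
qed

section \<open>Random codebooks\<close>

text \<open>The exponential first-moment method: T lists the requirements and \<open>A t\<close> the
  codewords that t looks at. For independent uniform codewords the expected sum of exp (deviation
  from the threshold) factorises and is below 1, so some codebook has this sum below 1.\<close>

lemma codebook_exists:
  fixes I :: "'i set" and Y :: "'y set" and T :: "'t set" and A :: "'t \<Rightarrow> 'i set"
    and \<phi> :: "'t \<Rightarrow> 'y \<Rightarrow> real" and \<theta> :: "'t \<Rightarrow> real"
  assumes fin: "finite I" "finite Y" "Y \<noteq> {}" and A: "\<And>t. t \<in> T \<Longrightarrow> A t \<subseteq> I"
    and small: "(\<Sum>t\<in>T. exp (- \<theta> t) * ((\<Sum>y\<in>Y. exp (\<phi> t y)) / card Y) ^ card (A t)) < 1"
    and finT: "finite T"
  obtains cb where "\<And>i. i \<in> I \<Longrightarrow> cb i \<in> Y" "\<And>t. t \<in> T \<Longrightarrow> (\<Sum>i\<in>A t. \<phi> t (cb i)) < \<theta> t"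
proof -
  let ?C = "PiE I (\<lambda>_. Y)"
  let ?W = "\<lambda>cb. \<Sum>t\<in>T. exp (- \<theta> t) * exp (\<Sum>i\<in>A t. \<phi> t (cb i))"
  have cY: "real (card Y) > 0" using fin by (simp add: card_gt_0_iff)
  have finC: "finite ?C" using fin by (intro finite_PiE) auto
  have cardC: "real (card ?C) = real (card Y) ^ card I" using fin by (simp add: card_PiE)
  have inner: "(\<Sum>cb\<in>?C. exp (\<Sum>i\<in>A t. \<phi> t (cb i))) = real (card ?C) * ((\<Sum>y\<in>Y. exp (\<phi> t y)) / card Y) ^ card (A t)"
    if t: "t \<in> T" for t
  proof -
    have fA: "finite (A t)" using A[OF t] fin finite_subset by blast
    have "(\<Sum>cb\<in>?C. exp (\<Sum>i\<in>A t. \<phi> t (cb i))) = (\<Sum>cb\<in>?C. \<Prod>i\<in>I. if i \<in> A t then exp (\<phi> t (cb i)) else 1)"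
    proof (rule sum.cong)
      fix cb
      have "(\<Prod>i\<in>I. if i \<in> A t then exp (\<phi> t (cb i)) else 1) = (\<Prod>i\<in>A t. exp (\<phi> t (cb i)))"
        using A[OF t] fin by (intro prod.mono_neutral_cong_right) auto
      then show "exp (\<Sum>i\<in>A t. \<phi> t (cb i)) = (\<Prod>i\<in>I. if i \<in> A t then exp (\<phi> t (cb i)) else 1)"
        using fA by (simp add: exp_sum)
    qed simp
    also have "\<dots> = (\<Prod>i\<in>I. \<Sum>y\<in>Y. if i \<in> A t then exp (\<phi> t y) else 1)"
      using fin by (intro prod_sum_PiE[symmetric]) auto
    also have "\<dots> = (\<Prod>i\<in>I. real (card Y) * (if i \<in> A t then (\<Sum>y\<in>Y. exp (\<phi> t y)) / card Y else 1))"
      using cY by (intro prod.cong) auto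
    also have "\<dots> = real (card Y) ^ card I * (\<Prod>i\<in>I. if i \<in> A t then (\<Sum>y\<in>Y. exp (\<phi> t y)) / card Y else 1)"
      by (simp add: prod.distrib)
    also have "(\<Prod>i\<in>I. if i \<in> A t then (\<Sum>y\<in>Y. exp (\<phi> t y)) / card Y else 1) = (\<Prod>i\<in>A t. (\<Sum>y\<in>Y. exp (\<phi> t y)) / card Y)"
      using A[OF t] fin by (intro prod.mono_neutral_cong_right) auto
    finally show ?thesis by (simp add: cardC)
  qed
  have "(\<Sum>cb\<in>?C. ?W cb) = (\<Sum>t\<in>T. exp (- \<theta> t) * (\<Sum>cb\<in>?C. exp (\<Sum>i\<in>A t. \<phi> t (cb i))))"
    by (subst sum.swap) (simp add: sum_distrib_left)
  also have "\<dots> = (\<Sum>t\<in>T. exp (- \<theta> t) * (real (card ?C) * ((\<Sum>y\<in>Y. exp (\<phi> t y)) / card Y) ^ card (A t)))"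
    using inner by (intro sum.cong) auto
  also have "\<dots> = real (card ?C) * (\<Sum>t\<in>T. exp (- \<theta> t) * ((\<Sum>y\<in>Y. exp (\<phi> t y)) / card Y) ^ card (A t))"
    by (simp add: sum_distrib_left mult.left_commute)
  also have "\<dots> < real (card ?C) * 1"
    using small cY cardC by (intro mult_strict_left_mono) auto
  finally have less: "(\<Sum>cb\<in>?C. ?W cb) < (\<Sum>cb\<in>?C. 1)" by simp
  have "\<exists>cb\<in>?C. ?W cb < 1"
  proof (rule ccontr)
    assume "\<not> ?thesis"
    then have "(\<Sum>cb\<in>?C. 1) \<le> (\<Sum>cb\<in>?C. ?W cb)" by (intro sum_mono) (auto simp: not_less)
    with less show False by linarith
  qed
  then obtain cb where cb: "cb \<in> ?C" "?W cb < 1" by blast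
  show ?thesis
  proof (rule that)
    show "cb i \<in> Y" if "i \<in> I" for i using cb that by auto
    fix t assume t: "t \<in> T"
    \<comment> \<open>All summands are positive, so a total below 1 keeps each below 1 and every
      requirement holds at once.\<close>
    have "exp (- \<theta> t) * exp (\<Sum>i\<in>A t. \<phi> t (cb i)) \<le> ?W cb"
      using finT t by (intro member_le_sum) auto
    then have "exp (- \<theta> t + (\<Sum>i\<in>A t. \<phi> t (cb i))) < 1" using cb by (simp only: exp_add)
    then show "(\<Sum>i\<in>A t. \<phi> t (cb i)) < \<theta> t" by simp
  qed
qed

lemma jfib'_eq:
  assumes "length x = n" "n > 0"
  shows "jfib' n J x = {y \<in> tclass n (map_pmf snd J). emp (zip x y) = J}"
proof (intro equalityI subsetI)
  fix y assume "y \<in> jfib' n J x"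
  then show "y \<in> {y \<in> tclass n (map_pmf snd J). emp (zip x y) = J}"
    using emp_zip_marg(2)[of x n y] assms by (auto simp: jfib'_def tclass_def)
qed (auto simp: jfib'_def tclass_def)

lemma exp_le_chord:
  fixes z :: real
  assumes "0 \<le> z" "z \<le> 1"
  shows "exp z \<le> 1 + 2 * z"
proof -
  have "exp z \<le> 1 + z + z\<^sup>2" using assms by (rule exp_bound)
  also have "z\<^sup>2 \<le> z" using assms by (simp add: power2_eq_square mult_left_le)
  finally show ?thesis by simp
qed

text \<open>Since exp z \<le> 1 + 2 z on [0, 1], the exponential moment is at most exp of twice the
  mean. This 2 reappears in front of \<beta> in \<open>type_code\<close>.\<close>

lemma chernoff_upper:
  fixes \<phi> :: "'y \<Rightarrow> real"
  assumes "finite Y" "Y \<noteq> {}" "\<And>y. y \<in> Y \<Longrightarrow> 0 \<le> \<phi> y" "\<And>y. y \<in> Y \<Longrightarrow> \<phi> y \<le> 1"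
  shows "((\<Sum>y\<in>Y. exp (\<phi> y)) / card Y) ^ N \<le> exp (2 * real N * ((\<Sum>y\<in>Y. \<phi> y) / card Y))"
proof -
  have cY: "real (card Y) > 0" using assms by (simp add: card_gt_0_iff)
  have "(\<Sum>y\<in>Y. exp (\<phi> y)) \<le> (\<Sum>y\<in>Y. 1 + 2 * \<phi> y)"
    using assms by (intro sum_mono exp_le_chord) auto
  also have "\<dots> = card Y + 2 * (\<Sum>y\<in>Y. \<phi> y)"
    by (simp add: sum.distrib sum_distrib_left)
  also have "\<dots> = card Y * (1 + 2 * ((\<Sum>y\<in>Y. \<phi> y) / card Y))"
    using cY by (simp add: distrib_left)
  finally have "(\<Sum>y\<in>Y. exp (\<phi> y)) / card Y \<le> 1 + 2 * ((\<Sum>y\<in>Y. \<phi> y) / card Y)"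
    using cY by (simp add: pos_divide_le_eq mult.commute)
  also have "\<dots> \<le> exp (2 * ((\<Sum>y\<in>Y. \<phi> y) / card Y))" by (rule exp_ge_add_one_self)
  finally have "((\<Sum>y\<in>Y. exp (\<phi> y)) / card Y) ^ N \<le> exp (2 * ((\<Sum>y\<in>Y. \<phi> y) / card Y)) ^ N"
    by (intro power_mono) (auto intro!: divide_nonneg_nonneg sum_nonneg)
  then show ?thesis by (simp add: exp_of_nat_mult[symmetric] mult_ac)
qed

text \<open>Since exp (-1) \<le> 1/2, each draw lowers the moment by at least half its success
  probability. Against the threshold of a quarter of the mean in \<open>type_code\<close>, a quarter
  is left in the exponent.\<close>

lemma chernoff_lower:
  assumes "finite Y" "Y \<noteq> {}"
  shows "((\<Sum>y\<in>Y. exp (- of_bool (P y))) / card Y) ^ N \<le> exp (- real N * (card {y \<in> Y. P y} / card Y) / 2)"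
proof -
  have cY: "real (card Y) > 0" using assms by (simp add: card_gt_0_iff)
  have e1: "exp (- 1 :: real) \<le> 1 / 2"
  proof -
    have "(2 :: real) \<le> exp 1" using exp_ge_add_one_self[of "1 :: real"] by simp
    then show ?thesis by (simp add: exp_minus field_simps)
  qed
  have "(\<Sum>y\<in>Y. exp (- of_bool (P y))) \<le> (\<Sum>y\<in>Y. 1 - of_bool (P y) / 2 :: real)"
    using e1 by (intro sum_mono) auto
  also have "\<dots> = card Y * (1 - (card {y \<in> Y. P y} / card Y) / 2)"
    using cY assms by (simp add: sum_subtractf sum_divide_distrib[symmetric] Int_def algebra_simps)
  finally have "(\<Sum>y\<in>Y. exp (- of_bool (P y))) / card Y \<le> 1 - (card {y \<in> Y. P y} / card Y) / 2"
    using cY by (simp add: pos_divide_le_eq mult.commute)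
  also have "\<dots> \<le> exp (- ((card {y \<in> Y. P y} / card Y) / 2))"
    using exp_ge_add_one_self[of "- ((card {y \<in> Y. P y} / card Y) / 2) :: real"] by simp
  finally have "((\<Sum>y\<in>Y. exp (- of_bool (P y))) / card Y) ^ N \<le> exp (- ((card {y \<in> Y. P y} / card Y) / 2)) ^ N"
    by (intro power_mono) (auto intro!: divide_nonneg_nonneg sum_nonneg)
  then show ?thesis by (simp add: exp_of_nat_mult[symmetric] mult_ac)
qed

text \<open>An independent random codebook is drawn for every key. Then the key need not be used as a
  one-time pad: an eavesdropper who sees the message faces \<open>card K\<close> independent candidate
  reproductions.\<close>

lemma type_code:
  fixes J :: "('x::finite \<times> 'y::finite) pmf" and c :: "'x \<Rightarrow> 'v::finite \<Rightarrow> real"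
    and M :: "'m set" and K :: "'k set"
  assumes n: "n > 0" and J: "is_type n J"
    and M: "finite M" "M \<noteq> {}" and K: "finite K" "K \<noteq> {}"
  defines "Q \<equiv> map_pmf fst J"
  defines "TX \<equiv> tclass n Q" and "TY \<equiv> tclass n (map_pmf snd J)"
  defines "p \<equiv> real (card (tclass n J)) / (real (card TX) * real (card TY))"
  defines "a \<equiv> 1 + ln (real (card M) * real CARD('v) ^ n)"
  assumes rate: "real (card M) * p / 4 \<ge> 1 + ln (real (card TX) * real (card K))"
    and \<beta>: "\<And>v. length v = n \<Longrightarrow> real (card {x \<in> TX. seq_dist n c x v \<le> D}) \<le> real (card TX) * \<beta>"
    and \<gamma>: "\<And>y v. y \<in> TY \<Longrightarrow> length v = n \<Longrightarrow>
      real (card {x \<in> jfib n J y. seq_dist n c x v \<le> D}) \<le> real (card (jfib n J y)) * \<gamma>"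
    and \<gamma>0: "\<gamma> > 0"
  obtains cb where
    "\<And>m k. m \<in> M \<Longrightarrow> k \<in> K \<Longrightarrow> cb m k \<in> TY"
    "\<And>x k. x \<in> TX \<Longrightarrow> k \<in> K \<Longrightarrow> {m \<in> M. emp (zip x (cb m k)) = J} \<noteq> {}"
    "\<And>g. (\<And>m. m \<in> M \<Longrightarrow> length (g m) = n) \<Longrightarrow>
      (\<Sum>x\<in>TX. \<Sum>k\<in>K. measure_pmf.prob (pmf_of_set {m \<in> M. emp (zip x (cb m k)) = J}) {m. seq_dist n c x (g m) \<le> D})
      \<le> 4 * real (card TX) * (2 * \<beta> * real (card K) + a * \<gamma>)"
proof -
  define VS where "VS = (seqs n :: 'v list set)"
  \<comment> \<open>\<open>cc y v\<close> counts the sequences of joint type J with the codeword y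
    that the estimate v hits. \<open>cm\<close> is its worst case and scales the summands into
    [0, 1].\<close>
  define cc where "cc y v = real (card {x \<in> jfib n J y. seq_dist n c x v \<le> D})" for y and v :: "'v list"
  define cm where "cm = p * real (card TX) * \<gamma>"
  have tyX: "is_type n Q" and tyY: "is_type n (map_pmf snd J)" using J unfolding Q_def by (auto intro: is_type_map)
  have pos: "real (card TX) > 0" "real (card TY) > 0" "real (card (tclass n J)) > 0" "real (card M) > 0" "real (card K) > 0"
    using is_type_tclass_pos[OF tyX n] is_type_tclass_pos[OF tyY n] is_type_tclass_pos[OF J n] M K
    by (auto simp: TX_def TY_def card_gt_0_iff)
  have p: "p > 0" unfolding p_def using pos by simp
  have cm: "cm > 0" unfolding cm_def using p pos \<gamma>0 by simp
  have finTX: "finite TX" and finTY: "finite TY" and neTY: "TY \<noteq> {}"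
    using pos unfolding TX_def TY_def by (auto simp: card_gt_0_iff)
  have finVS: "finite VS" by (simp add: VS_def)
  have cardVS: "card VS = CARD('v) ^ n"
    unfolding VS_def seqs_def using card_lists_length_eq[of "UNIV :: 'v set" n] by simp
  have fib: "real (card (jfib n J y)) = p * real (card TX)" if "y \<in> TY" for y
  proof -
    have "real (card (jfib n J y)) * real (card TY) = real (card (tclass n J))"
      unfolding of_nat_mult[symmetric] TY_def by (rule arg_cong[OF card_jfib[OF n that[unfolded TY_def]]])
    then show ?thesis using pos unfolding p_def by (simp add: field_simps)
  qed
  have fib': "real (card (jfib' n J x)) = p * real (card TY)" if "x \<in> TX" for x
  proof -
    have "real (card (jfib' n J x)) * real (card TX) = real (card (tclass n J))"
      unfolding of_nat_mult[symmetric] TX_def Q_def by (rule arg_cong[OF card_jfib'[OF n that[unfolded TX_def Q_def]]])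
    then show ?thesis using pos unfolding p_def by (simp add: field_simps)
  qed
  have cc_le: "cc y v \<le> cm" if "y \<in> TY" "v \<in> VS" for y v
    using \<gamma>[of y v] that fib[of y] unfolding cc_def cm_def VS_def by simp
  \<comment> \<open>Double counting: every sequence in the ball around v fits exactly p * card TY
    codewords, so the mean over y is governed by the unconditional bound \<beta>.\<close>
  have sum_cc: "(\<Sum>y\<in>TY. cc y v) / card TY \<le> p * real (card TX) * \<beta>" if v: "v \<in> VS" for v
  proof -
    let ?B = "{x \<in> TX. seq_dist n c x v \<le> D}"
    have "(\<Sum>y\<in>TY. cc y v) = (\<Sum>y\<in>TY. \<Sum>x\<in>?B. of_bool (emp (zip x y) = J))"
    proof (rule sum.cong)
      fix y assume y: "y \<in> TY"
      have ly: "length y = n" using y by (simp add: TY_def tclass_def)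
      have "{x \<in> jfib n J y. seq_dist n c x v \<le> D} = {x \<in> ?B. emp (zip x y) = J}"
        using jfib_in_tclass(1)[OF _ ly n] by (auto simp: TX_def Q_def jfib_def tclass_def)
      then show "cc y v = (\<Sum>x\<in>?B. of_bool (emp (zip x y) = J))"
        using finTX by (simp add: cc_def Int_def)
    qed simp
    also have "\<dots> = (\<Sum>x\<in>?B. \<Sum>y\<in>TY. of_bool (emp (zip x y) = J))" by (rule sum.swap)
    also have "\<dots> = (\<Sum>x\<in>?B. real (card (jfib' n J x)))"
    proof (rule sum.cong)
      fix x assume "x \<in> ?B"
      then have lx: "length x = n" by (simp add: TX_def tclass_def)
      have "jfib' n J x = {y \<in> TY. emp (zip x y) = J}"
        unfolding TY_def by (rule jfib'_eq[OF lx n])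
      then show "(\<Sum>y\<in>TY. of_bool (emp (zip x y) = J)) = real (card (jfib' n J x))"
        using finTY by (simp add: Int_def)
    qed simp
    also have "\<dots> = real (card ?B) * (p * real (card TY))"
      using fib' by simp
    finally have "(\<Sum>y\<in>TY. cc y v) / card TY = p * real (card ?B)" using pos by simp
    also have "\<dots> \<le> p * (real (card TX) * \<beta>)"
      using \<beta>[of v] v p by (intro mult_left_mono) (auto simp: VS_def)
    finally show ?thesis by simp
  qed
  \<comment> \<open>Two families of requirements: \<open>Inl (x, k)\<close> looks at all messages
    under the key k and asks for enough codewords that fit x; \<open>Inr (m, v)\<close> looks at all
    keys for the message m and asks that v hit few sequences.\<close>
  define T where "T = (Inl ` (TX \<times> K) \<union> Inr ` (M \<times> VS) :: ('x list \<times> 'k + 'm \<times> 'v list) set)"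
  define A where "A t = (case t of Inl (x, k) \<Rightarrow> M \<times> {k} | Inr (m, v) \<Rightarrow> {m} \<times> K)" for t :: "'x list \<times> 'k + 'm \<times> 'v list"
  define \<phi> where "\<phi> t y = (case t of Inl (x, k) \<Rightarrow> - of_bool (emp (zip x y) = J) | Inr (m, v) \<Rightarrow> cc y v / cm)"
    for t :: "'x list \<times> 'k + 'm \<times> 'v list" and y
  \<comment> \<open>\<open>B\<close> bounds twice the mean of the scaled sum over the keys. The
    extra a is one plus the logarithm of the number of pairs (m, v), the price of the union bound.
    In the other family a quarter of the expected number of fitting codewords is demanded.\<close>
  define B where "B = 2 * real (card K) * (p * real (card TX) * \<beta>) / cm"
  define \<theta> where "\<theta> t = (case t of Inl (x, k) \<Rightarrow> - real (card M) * p / 4 | Inr (m, v) \<Rightarrow> B + a)"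
    for t :: "'x list \<times> 'k + 'm \<times> 'v list"
  let ?g = "\<lambda>t. exp (- \<theta> t) * ((\<Sum>y\<in>TY. exp (\<phi> t y)) / card TY) ^ card (A t)"
  have gl: "?g (Inl (x, k)) \<le> exp (- (1 + ln (real (card TX) * real (card K))))" if x: "x \<in> TX" for x k
  proof -
    have lx: "length x = n" using x by (simp add: TX_def tclass_def)
    have "{y \<in> TY. emp (zip x y) = J} = jfib' n J x"
      unfolding TY_def by (rule jfib'_eq[OF lx n, symmetric])
    then have "real (card {y \<in> TY. emp (zip x y) = J}) / card TY = p"
      using fib'[OF x] pos by simp
    then have "((\<Sum>y\<in>TY. exp (\<phi> (Inl (x, k)) y)) / card TY) ^ card (A (Inl (x, k))) \<le> exp (- real (card M) * p / 2)"
      using chernoff_lower[OF finTY neTY, of "\<lambda>y. emp (zip x y) = J" "card M"]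
      by (simp add: \<phi>_def A_def card_cartesian_product)
    then have "?g (Inl (x, k)) \<le> exp (- \<theta> (Inl (x, k))) * exp (- real (card M) * p / 2)" by (intro mult_left_mono) auto
    also have "\<dots> = exp (- (real (card M) * p / 4))" by (simp add: \<theta>_def exp_add[symmetric])
    also have "\<dots> \<le> exp (- (1 + ln (real (card TX) * real (card K))))" using rate by simp
    finally show ?thesis .
  qed
  have gr: "?g (Inr (m, v)) \<le> exp (- a)" if v: "v \<in> VS" for m v
  proof -
    have "((\<Sum>y\<in>TY. exp (\<phi> (Inr (m, v)) y)) / card TY) ^ card (A (Inr (m, v))) \<le> exp (2 * real (card K) * ((\<Sum>y\<in>TY. cc y v / cm) / card TY))"
      using chernoff_upper[OF finTY neTY, of "\<lambda>y. cc y v / cm" "card K"] cc_le[OF _ v] cm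
      by (simp add: \<phi>_def A_def card_cartesian_product cc_def)
    also have "\<dots> \<le> exp B"
    proof -
      have "2 * real (card K) * ((\<Sum>y\<in>TY. cc y v / cm) / card TY) = 2 * real (card K) * ((\<Sum>y\<in>TY. cc y v) / card TY) / cm"
        by (simp add: sum_divide_distrib[symmetric])
      also have "\<dots> \<le> B" unfolding B_def using sum_cc[OF v] cm by (intro divide_right_mono mult_left_mono) auto
      finally show ?thesis by simp
    qed
    finally have "?g (Inr (m, v)) \<le> exp (- \<theta> (Inr (m, v))) * exp B" by (intro mult_left_mono) auto
    also have "\<dots> = exp (- a)" by (simp add: \<theta>_def exp_add[symmetric])
    finally show ?thesis .
  qed
  \<comment> \<open>Each of the two families contributes at most exp (-1) to the union
    bound.\<close>
  have e1: "exp (- 1 :: real) < 1 / 2"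
  proof -
    have "(2 :: real) < exp 1" using exp_lower_Taylor_quadratic[of 1] by simp
    then show ?thesis by (simp add: exp_minus field_simps)
  qed
  have expln: "z * exp (- (1 + ln z)) = exp (- 1)" if "z > 0" for z :: real
    using that by (simp add: exp_add exp_minus exp_diff field_simps)
  have "(\<Sum>t\<in>T. ?g t) = (\<Sum>t\<in>Inl ` (TX \<times> K). ?g t) + (\<Sum>t\<in>Inr ` (M \<times> VS). ?g t)"
    unfolding T_def using finTX finVS M K by (intro sum.union_disjoint) auto
  also have "\<dots> = (\<Sum>t\<in>TX \<times> K. ?g (Inl t)) + (\<Sum>t\<in>M \<times> VS. ?g (Inr t))"
    by (simp add: sum.reindex)
  also have "\<dots> \<le> (\<Sum>t\<in>TX \<times> K. exp (- (1 + ln (real (card TX) * real (card K))))) + (\<Sum>t\<in>M \<times> VS. exp (- a))"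
    using gl gr by (intro add_mono sum_mono) auto
  also have "\<dots> = exp (- 1) + exp (- 1)"
    using expln[of "real (card TX) * real (card K)"] expln[of "real (card M) * real CARD('v) ^ n"] pos
    by (simp add: card_cartesian_product cardVS a_def)
  also have "\<dots> < 1" using e1 by simp
  finally have small: "(\<Sum>t\<in>T. ?g t) < 1" .
  have finT: "finite T" unfolding T_def using finTX finVS M K by auto
  have AI: "A t \<subseteq> M \<times> K" if "t \<in> T" for t using that by (auto simp: T_def A_def)
  have finI: "finite (M \<times> K)" using M K by simp
  obtain cb0 where cb0: "\<And>i. i \<in> M \<times> K \<Longrightarrow> cb0 i \<in> TY" "\<And>t. t \<in> T \<Longrightarrow> (\<Sum>i\<in>A t. \<phi> t (cb0 i)) < \<theta> t"
    by (rule codebook_exists[OF finI finTY neTY AI small finT]) (assumption | rule that)+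
  define cb where "cb m k = cb0 (m, k)" for m k
  define N where "N x k = {m \<in> M. emp (zip x (cb m k)) = J}" for x k
  have N: "real (card (N x k)) > real (card M) * p / 4" if "x \<in> TX" "k \<in> K" for x k
  proof -
    have "M \<times> {k} = (\<lambda>m. (m, k)) ` M" by auto
    then have "(\<Sum>i\<in>A (Inl (x, k)). \<phi> (Inl (x, k)) (cb0 i)) = (\<Sum>m\<in>M. - of_bool (emp (zip x (cb m k)) = J))"
      unfolding A_def \<phi>_def by (simp add: sum.reindex inj_on_def cb_def)
    also have "\<dots> = - real (card (N x k))" using M by (simp add: sum_negf N_def Int_def)
    finally show ?thesis using cb0(2)[of "Inl (x, k)"] that by (simp add: T_def \<theta>_def)
  qed
  have S: "(\<Sum>k\<in>K. cc (cb m k) v) \<le> p * real (card TX) * (2 * \<beta> * real (card K) + a * \<gamma>)" if "m \<in> M" "v \<in> VS" for m v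
  proof -
    have "{m} \<times> K = Pair m ` K" by auto
    then have "(\<Sum>i\<in>A (Inr (m, v)). \<phi> (Inr (m, v)) (cb0 i)) = (\<Sum>k\<in>K. cc (cb m k) v) / cm"
      unfolding A_def \<phi>_def by (simp add: sum.reindex inj_on_def cb_def sum_divide_distrib)
    then have "(\<Sum>k\<in>K. cc (cb m k) v) / cm < B + a"
      using cb0(2)[of "Inr (m, v)"] that by (simp add: T_def \<theta>_def)
    then have "(\<Sum>k\<in>K. cc (cb m k) v) \<le> (B + a) * cm" using cm by (simp add: pos_divide_less_eq)
    also have "\<dots> = p * real (card TX) * (2 * \<beta> * real (card K) + a * \<gamma>)"
      using cm by (simp add: B_def distrib_right) (simp add: cm_def algebra_simps)
    finally show ?thesis .
  qed
  show ?thesis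
  proof (rule that[of cb])
    show "cb m k \<in> TY" if "m \<in> M" "k \<in> K" for m k using cb0(1)[of "(m, k)"] that by (simp add: cb_def)
    show ne: "{m \<in> M. emp (zip x (cb m k)) = J} \<noteq> {}" if "x \<in> TX" "k \<in> K" for x k
    proof -
      have "real (card M) * p / 4 > 0" using p pos by simp
      then have "real (card (N x k)) > 0" using N[OF that] by linarith
      then have "N x k \<noteq> {}" by auto
      then show ?thesis by (simp add: N_def)
    qed
    fix g :: "'m \<Rightarrow> 'v list" assume g: "\<And>m. m \<in> M \<Longrightarrow> length (g m) = n"
    let ?E = "\<lambda>x k m. emp (zip x (cb m k)) = J \<and> seq_dist n c x (g m) \<le> D"
    \<comment> \<open>At least card M * p / 4 codewords fit x under the key k, so the uniform
      encoder picks any given message with probability at most 4 / (card M * p).\<close>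
    have step: "measure_pmf.prob (pmf_of_set {m \<in> M. emp (zip x (cb m k)) = J}) {m. seq_dist n c x (g m) \<le> D}
      \<le> 4 / (real (card M) * p) * (\<Sum>m\<in>M. of_bool (?E x k m))" if xk: "x \<in> TX" "k \<in> K" for x k
    proof -
      have finN: "finite (N x k)" using M by (simp add: N_def)
      have "measure_pmf.prob (pmf_of_set (N x k)) {m. seq_dist n c x (g m) \<le> D} = real (card (N x k \<inter> {m. seq_dist n c x (g m) \<le> D})) / real (card (N x k))"
        using ne[OF xk] finN by (subst measure_pmf_of_set) (auto simp: N_def)
      also have "\<dots> \<le> real (card (N x k \<inter> {m. seq_dist n c x (g m) \<le> D})) / (real (card M) * p / 4)"
      proof (rule divide_left_mono)
        have mp: "real (card M) * p / 4 > 0" using p pos by simp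
        show "real (card M) * p / 4 \<le> real (card (N x k))" using N[OF xk] by simp
        show "0 < real (card (N x k)) * (real (card M) * p / 4)"
          using N[OF xk] mp by (intro mult_pos_pos) linarith+
      qed simp
      also have "N x k \<inter> {m. seq_dist n c x (g m) \<le> D} = {m \<in> M. ?E x k m}" by (auto simp: N_def)
      also have "real (card {m \<in> M. ?E x k m}) = (\<Sum>m\<in>M. of_bool (?E x k m))" using M by (simp add: Int_def)
      finally show ?thesis by (simp add: N_def mult.commute)
    qed
    have "(\<Sum>x\<in>TX. \<Sum>k\<in>K. measure_pmf.prob (pmf_of_set {m \<in> M. emp (zip x (cb m k)) = J}) {m. seq_dist n c x (g m) \<le> D})
      \<le> (\<Sum>x\<in>TX. \<Sum>k\<in>K. 4 / (real (card M) * p) * (\<Sum>m\<in>M. of_bool (?E x k m)))"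
      by (intro sum_mono step)
    also have "\<dots> = 4 / (real (card M) * p) * (\<Sum>x\<in>TX. \<Sum>k\<in>K. \<Sum>m\<in>M. of_bool (?E x k m))"
      by (simp add: sum_distrib_left)
    also have "(\<Sum>x\<in>TX. \<Sum>k\<in>K. \<Sum>m\<in>M. of_bool (?E x k m)) = (\<Sum>x\<in>TX. \<Sum>m\<in>M. \<Sum>k\<in>K. of_bool (?E x k m) :: real)"
      by (intro sum.cong refl sum.swap)
    also have "\<dots> = (\<Sum>m\<in>M. \<Sum>x\<in>TX. \<Sum>k\<in>K. of_bool (?E x k m))" by (rule sum.swap)
    also have "\<dots> = (\<Sum>m\<in>M. \<Sum>k\<in>K. \<Sum>x\<in>TX. of_bool (?E x k m))" by (intro sum.cong refl sum.swap)
    \<comment> \<open>With the message outermost, the sum over the keys is what \<open>S\<close>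
      controls for the estimate \<open>g m\<close>. As g may depend on the codebook,
      \<open>S\<close> was established for all v in advance.\<close>
    also have "\<dots> = (\<Sum>m\<in>M. \<Sum>k\<in>K. cc (cb m k) (g m))"
    proof (intro sum.cong refl)
      fix m k assume mk: "m \<in> M" "k \<in> K"
      have "cb m k \<in> TY" using cb0(1)[of "(m, k)"] mk by (simp add: cb_def)
      then have l: "length (cb m k) = n" by (simp add: TY_def tclass_def)
      have "{x \<in> jfib n J (cb m k). seq_dist n c x (g m) \<le> D} = {x \<in> TX. ?E x k m}"
        using jfib_in_tclass(1)[OF _ l n] by (auto simp: TX_def Q_def jfib_def tclass_def)
      then show "(\<Sum>x\<in>TX. of_bool (?E x k m)) = cc (cb m k) (g m)"
        using finTX by (simp add: cc_def Int_def)
    qed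
    also have "4 / (real (card M) * p) * (\<Sum>m\<in>M. \<Sum>k\<in>K. cc (cb m k) (g m))
      \<le> 4 / (real (card M) * p) * (\<Sum>m\<in>M. p * real (card TX) * (2 * \<beta> * real (card K) + a * \<gamma>))"
      using g p pos by (intro mult_left_mono sum_mono S) (auto simp: VS_def)
    also have "\<dots> = 4 * real (card TX) * (2 * \<beta> * real (card K) + a * \<gamma>)"
      using p pos by simp
    finally show "(\<Sum>x\<in>TX. \<Sum>k\<in>K. measure_pmf.prob (pmf_of_set {m \<in> M. emp (zip x (cb m k)) = J}) {m. seq_dist n c x (g m) \<le> D})
      \<le> 4 * real (card TX) * (2 * \<beta> * real (card K) + a * \<gamma>)" .
  qed
qed

section \<open>The cipher system as finite sums\<close>

lemma prob_bind_pmf: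
  "measure_pmf.prob (bind_pmf p q) A = measure_pmf.expectation p (\<lambda>x. measure_pmf.prob (q x) A)"
proof -
  have *: "measure_pmf.prob X A = pmf (map_pmf (\<lambda>x. x \<in> A) X) True" for X
    by (simp add: pmf_map vimage_def)
  show ?thesis unfolding * map_bind_pmf pmf_bind ..
qed

lemma card_bits: "card (bits n \<rho>) = 2 ^ nat \<lfloor>real n * \<rho>\<rfloor>"
  unfolding bits_def seqs_def using card_lists_length_eq[of "UNIV :: bool set"] by simp

lemma finite_bits [simp]: "finite (bits n \<rho>)"
  by (simp add: bits_def)

lemma bits_nonempty [simp]: "bits n \<rho> \<noteq> {}"
  using card_bits[of n \<rho>] by (metis card.empty power_not_zero zero_neq_numeral)

lemma prob_cipher_bind:
  fixes P :: "'x::finite pmf"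
  shows "measure_pmf.prob (bind_pmf (cipher_pmf n P r f) q) A =
    (\<Sum>xs\<in>seqs n. \<Sum>k\<in>bits n r. pmf (replicate_pmf n P) xs / card (bits n r) *
      measure_pmf.prob (bind_pmf (f xs k) (\<lambda>m. q (xs, k, m))) A)"
proof -
  have "measure_pmf.prob (bind_pmf (cipher_pmf n P r f) q) A =
    measure_pmf.expectation (replicate_pmf n P) (\<lambda>xs. measure_pmf.expectation (pmf_of_set (bits n r))
      (\<lambda>k. measure_pmf.prob (bind_pmf (f xs k) (\<lambda>m. q (xs, k, m))) A))"
    unfolding cipher_pmf_def by (simp add: bind_assoc_pmf bind_return_pmf prob_bind_pmf)
  also have "\<dots> = (\<Sum>xs\<in>seqs n. measure_pmf.expectation (pmf_of_set (bits n r))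
      (\<lambda>k. measure_pmf.prob (bind_pmf (f xs k) (\<lambda>m. q (xs, k, m))) A) * pmf (replicate_pmf n P) xs)"
    by (rule integral_measure_pmf_real) (auto simp: set_replicate_pmf)
  finally show ?thesis
    by (simp add: integral_pmf_of_set sum_divide_distrib sum_distrib_left sum_distrib_right mult.commute)
qed

lemma eavesdropper_prob_sum:
  fixes P :: "'x::finite pmf"
  shows "eavesdropper_prob n d_e P D_e r f g =
    (\<Sum>xs\<in>seqs n. \<Sum>k\<in>bits n r. pmf (replicate_pmf n P) xs / card (bits n r) *
      measure_pmf.prob (f xs k) {m. seq_dist n d_e xs (g m) \<le> D_e})"
proof -
  have "measure_pmf.prob (map_pmf (\<lambda>m. (xs, k, m)) (f xs k)) {(xs, k, m). seq_dist n d_e xs (g m) \<le> D_e}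
     = measure_pmf.prob (f xs k) {m. seq_dist n d_e xs (g m) \<le> D_e}" for xs k
    by (simp add: vimage_def)
  then show ?thesis
    unfolding eavesdropper_prob_def
    using prob_cipher_bind[of n P r f return_pmf] by (simp add: bind_return_pmf' map_pmf_def[symmetric])
qed

lemma excess_dist_prob_sum:
  fixes P :: "'x::finite pmf"
  shows "excess_dist_prob n d P D r f h =
    (\<Sum>xs\<in>seqs n. \<Sum>k\<in>bits n r. pmf (replicate_pmf n P) xs / card (bits n r) *
      measure_pmf.prob (bind_pmf (f xs k) (\<lambda>m. h m k)) {ys. seq_dist n d xs ys > D})"
proof -
  have "measure_pmf.prob (bind_pmf (f xs k) (\<lambda>m. bind_pmf (h m k) (\<lambda>ys. return_pmf (xs, ys)))) {(xs, ys). seq_dist n d xs ys > D}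
     = measure_pmf.prob (bind_pmf (f xs k) (\<lambda>m. h m k)) {ys. seq_dist n d xs ys > D}" for xs k
  proof -
    have "bind_pmf (f xs k) (\<lambda>m. bind_pmf (h m k) (\<lambda>ys. return_pmf (xs, ys))) = map_pmf (Pair xs) (bind_pmf (f xs k) (\<lambda>m. h m k))"
      by (simp add: map_bind_pmf map_pmf_def[symmetric])
    then show ?thesis by (simp add: vimage_def)
  qed
  then show ?thesis
    unfolding excess_dist_prob_def using prob_cipher_bind[of n P r f "\<lambda>(xs, k, m). bind_pmf (h m k) (\<lambda>ys. return_pmf (xs, ys))"]
    by simp
qed

lemma sum_by_type:
  fixes F :: "'x::finite list \<Rightarrow> real"
  assumes "n > 0"
  shows "(\<Sum>xs\<in>seqs n. F xs) = (\<Sum>Q | is_type n Q. \<Sum>xs\<in>tclass n Q. F xs)"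
proof -
  have "(\<Sum>xs\<in>seqs n. F xs) = (\<Sum>Q\<in>{Q. is_type n Q}. \<Sum>xs\<in>{xs \<in> seqs n. emp xs = Q}. F xs)"
    using card_types(1)[OF assms, where 'a = 'x] is_type_emp assms by (intro sum.group[symmetric]) auto
  then show ?thesis by (simp add: tclass_def)
qed

text \<open>Round robin by residues of an enumeration. It reserves messages for every source type,
  so that the decoder reads the type off the message and the codebooks of different types do not
  interfere.\<close>

lemma labelling_exists:
  assumes "finite M" "finite T" "T \<noteq> {}"
  obtains lab where "\<And>m. m \<in> M \<Longrightarrow> lab m \<in> T" "\<And>t. t \<in> T \<Longrightarrow> card M div card T \<le> card {m \<in> M. lab m = t}"
proof -
  let ?c = "card T"
  have c: "?c > 0" using assms by (simp add: card_gt_0_iff)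
  obtain e where e: "bij_betw e M {0..<card M}" using ex_bij_betw_finite_nat[OF assms(1)] by blast
  obtain e' where e': "bij_betw e' {0..<?c} T" using ex_bij_betw_nat_finite[OF assms(2)] by blast
  define lab where "lab m = e' (e m mod ?c)" for m
  show ?thesis
  proof (rule that)
    show "lab m \<in> T" for m using bij_betwE[OF e'] c by (auto simp: lab_def)
    fix t assume "t \<in> T"
    then have "t \<in> e' ` {0..<?c}" using e' by (simp add: bij_betw_def)
    then obtain j where j: "j < ?c" "e' j = t" by auto
    let ?h = "\<lambda>q. inv_into M e (q * ?c + j)"
    have range: "q * ?c + j < card M" if "q < card M div ?c" for q
    proof -
      have "(q + 1) * ?c \<le> card M div ?c * ?c" using that by (intro mult_le_mono1) simp
      also have "\<dots> \<le> card M" by simp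
      finally show ?thesis using j by simp
    qed
    have eh: "e (?h q) = q * ?c + j" "?h q \<in> M" if "q < card M div ?c" for q
      using range[OF that] e by (auto simp: bij_betw_def f_inv_into_f inv_into_into)
    have "inj_on ?h {..<card M div ?c}"
    proof (rule inj_onI)
      fix q q' assume "q \<in> {..<card M div ?c}" "q' \<in> {..<card M div ?c}" "?h q = ?h q'"
      then have "q * ?c + j = q' * ?c + j" using eh(1) by (metis lessThan_iff)
      then show "q = q'" using c by simp
    qed
    moreover have "?h ` {..<card M div ?c} \<subseteq> {m \<in> M. lab m = t}"
      using eh j by (auto simp: lab_def)
    ultimately have "card {..<card M div ?c} \<le> card {m \<in> M. lab m = t}"
      using assms by (intro card_inj_on_le[of ?h]) auto
    then show "card M div ?c \<le> card {m \<in> M. lab m = t}" by simp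
  qed
qed

lemma prob_tclass_weight:
  fixes P Q :: "'a::finite pmf"
  assumes "n > 0" "set_pmf P = UNIV" "x \<in> tclass n Q"
  shows "pmf (replicate_pmf n P) x * real (card (tclass n Q)) = measure_pmf.prob (replicate_pmf n P) (tclass n Q)"
  unfolding prob_tclass[OF assms(1,2)] prob_seq_type[OF assms] by simp

section \<open>Achievability at a fixed block length\<close>

text \<open>\<open>C\<close> collects the served types and \<open>Js\<close> their joint types.
  Letting the message reveal the type is harmless: the success probability is bounded type by type
  and for every g, as if the type were known.\<close>

lemma achievability_block:
  fixes P :: "'x::finite pmf" and d :: "'x \<Rightarrow> 'y::finite \<Rightarrow> real" and d_e :: "'x \<Rightarrow> 'v::finite \<Rightarrow> real"
    and D D_e R r \<alpha> :: real and C :: "'x pmf set" and Js :: "'x pmf \<Rightarrow> ('x \<times> 'y) pmf"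
  assumes n: "n > 0" and P: "set_pmf P = UNIV"
    and Js: "\<And>Q. Q \<in> C \<Longrightarrow> is_type n (Js Q)" "\<And>Q. Q \<in> C \<Longrightarrow> map_pmf fst (Js Q) = Q" "\<And>Q. Q \<in> C \<Longrightarrow> cost d (Js Q) \<le> D"
    and rate: "\<And>Q. Q \<in> C \<Longrightarrow>
      real (card (bits n R) div card {Q :: 'x pmf. is_type n Q}) *
        (real (card (tclass n (Js Q))) / (real (card (tclass n Q)) * real (card (tclass n (map_pmf snd (Js Q)))))) / 4
       \<ge> 1 + ln (real (card (tclass n Q)) * real (card (bits n r)))"
    and excess: "(\<Sum>Q | is_type n Q \<and> Q \<notin> C. measure_pmf.prob (replicate_pmf n P) (tclass n Q)) \<le> 2 powr (- (real n * \<alpha>))"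
  defines "a \<equiv> 1 + ln (real (card (bits n R)) * real CARD('v) ^ n)"
    and "\<beta> \<equiv> \<lambda>Q :: 'x pmf. pc n (CARD('x) * CARD('v) + (CARD('x) + CARD('v))) * 2 powr (- (real n * rate_dist d_e Q D_e))"
    and "\<gamma> \<equiv> \<lambda>J :: ('x \<times> 'y) pmf. pc n (CARD('x) * CARD('y) * CARD('v) + (CARD('x) * CARD('y) + CARD('y) * CARD('v))) * 2 powr (- (real n * cond_rate_dist d_e J D_e))"
  shows "\<exists>f \<in> reliable_encoders n d P D R r \<alpha>. \<forall>g \<in> bits n R \<rightarrow> seqs n.
    eavesdropper_prob n d_e P D_e r f g \<le>
      (\<Sum>Q | is_type n Q. measure_pmf.prob (replicate_pmf n P) (tclass n Q) *
        (if Q \<in> C then 4 * (2 * \<beta> Q + a * \<gamma> (Js Q) / real (card (bits n r))) else \<beta> Q))"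
proof -
  let ?TT = "{Q :: 'x pmf. is_type n Q}" and ?K = "bits n r"
  define w where "w = pmf (replicate_pmf n P)"
  have CT: "C \<subseteq> ?TT"
  proof
    fix Q assume "Q \<in> C"
    from is_type_map[OF Js(1)[OF this], of fst] Js(2)[OF this] show "Q \<in> ?TT" by simp
  qed
  have "emp (replicate n undefined) \<in> ?TT" using n by (simp add: is_type_emp)
  then have neT: "?TT \<noteq> {}" by blast
  obtain lab where lab: "\<And>m. m \<in> bits n R \<Longrightarrow> lab m \<in> ?TT"
    "\<And>t. t \<in> ?TT \<Longrightarrow> card (bits n R) div card ?TT \<le> card {m \<in> bits n R. lab m = t}"
    by (rule labelling_exists[OF finite_bits[of n R] card_types(1)[OF n] neT]) (assumption | rule that)+
  define M where "M Q = {m \<in> bits n R. lab m = Q}" for Q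
  have cK: "real (card ?K) > 0" by (simp add: card_gt_0_iff)
  then have K1: "real (card ?K) \<ge> 1" by (simp add: Suc_le_eq)
  \<comment> \<open>The conclusion of \<open>type_code\<close> packed into one predicate, so that
    codebooks for all served types can be chosen simultaneously.\<close>
  define good where "good Q cb \<longleftrightarrow>
    (\<forall>m\<in>M Q. \<forall>k\<in>?K. cb m k \<in> tclass n (map_pmf snd (Js Q))) \<and>
    (\<forall>x\<in>tclass n Q. \<forall>k\<in>?K. {m \<in> M Q. emp (zip x (cb m k)) = Js Q} \<noteq> {}) \<and>
    (\<forall>g. (\<forall>m\<in>M Q. length (g m) = n) \<longrightarrow>
      (\<Sum>x\<in>tclass n Q. \<Sum>k\<in>?K. measure_pmf.prob (pmf_of_set {m \<in> M Q. emp (zip x (cb m k)) = Js Q}) {m. seq_dist n d_e x (g m) \<le> D_e})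
      \<le> 4 * real (card (tclass n Q)) * (2 * \<beta> Q * real (card ?K) + a * \<gamma> (Js Q)))" for Q and cb :: "bool list \<Rightarrow> bool list \<Rightarrow> 'y list"
  have "\<exists>cb. good Q cb" if Q: "Q \<in> C" for Q
  proof -
    have QT: "is_type n Q" using CT Q by blast
    let ?p = "real (card (tclass n (Js Q))) / (real (card (tclass n Q)) * real (card (tclass n (map_pmf snd (Js Q)))))"
    have Mfin: "finite (M Q)" by (simp add: M_def)
    have cM: "real (card (bits n R) div card ?TT) \<le> real (card (M Q))" using lab(2)[of Q] QT by (simp add: M_def)
    have cMle: "card (M Q) \<le> card (bits n R)" unfolding M_def by (intro card_mono) auto
    \<comment> \<open>The logarithm is nonnegative, so the rate condition has a positive right-hand
      side and forces \<open>M Q\<close> to be nonempty.\<close>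
    have "0 \<le> ln (real (card (tclass n Q)) * real (card ?K))"
    proof -
      have "1 \<le> real (card (tclass n Q))" using is_type_tclass_pos[OF QT n] by simp
      then have "1 * 1 \<le> real (card (tclass n Q)) * real (card ?K)" using K1 by (intro mult_mono) auto
      then show ?thesis by simp
    qed
    moreover have rate': "real (card (M Q)) * ?p / 4 \<ge> 1 + ln (real (card (tclass n Q)) * real (card ?K))"
    proof -
      have "real (card (bits n R) div card ?TT) * ?p / 4 \<le> real (card (M Q)) * ?p / 4"
        using cM by (intro divide_right_mono mult_right_mono) auto
      with rate[OF Q] show ?thesis by linarith
    qed
    ultimately have "real (card (M Q)) * ?p / 4 > 0" by linarith
    then have Mne: "M Q \<noteq> {}" by auto
    have fst: "map_pmf fst (Js Q) = Q" by (rule Js(2)[OF Q])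
    have cM1: "real (card (M Q)) \<ge> 1" using Mne Mfin by (simp add: Suc_le_eq card_gt_0_iff)
    have \<gamma>pos: "\<gamma> J > 0" for J by (simp add: \<gamma>_def)
    \<comment> \<open>The logarithmic factor of \<open>type_code\<close> refers to the messages of
      one type; replacing them by all messages makes a common to all types.\<close>
    have "1 + ln (real (card (M Q)) * real CARD('v) ^ n) \<le> a"
      unfolding a_def using cM1 cMle by (simp add: mult_right_mono)
    then have a_le: "(1 + ln (real (card (M Q)) * real CARD('v) ^ n)) * \<gamma> (Js Q) \<le> a * \<gamma> (Js Q)"
      using \<gamma>pos[of "Js Q"] by (intro mult_right_mono) auto
    show ?thesis
    proof (rule type_code[OF n Js(1)[OF Q] Mfin Mne finite_bits[of n r] bits_nonempty[of n r], where c = d_e and D = D_e and \<beta> = "\<beta> Q" and \<gamma> = "\<gamma> (Js Q)", unfolded fst, OF rate'])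
      show "real (card {x \<in> tclass n Q. seq_dist n d_e x v \<le> D_e}) \<le> real (card (tclass n Q)) * \<beta> Q" if "length v = n" for v
        unfolding \<beta>_def by (rule ball_bound[OF n QT that])
      show "real (card {x \<in> jfib n (Js Q) y. seq_dist n d_e x v \<le> D_e}) \<le> real (card (jfib n (Js Q) y)) * \<gamma> (Js Q)"
        if "y \<in> tclass n (map_pmf snd (Js Q))" "length v = n" for y v
        unfolding \<gamma>_def by (rule cond_ball_bound[OF n Js(1)[OF Q] that])
      show "0 < \<gamma> (Js Q)" by (rule \<gamma>pos)
      fix cb :: "bool list \<Rightarrow> bool list \<Rightarrow> 'y list"
      assume 1: "\<And>m k. m \<in> M Q \<Longrightarrow> k \<in> ?K \<Longrightarrow> cb m k \<in> tclass n (map_pmf snd (Js Q))"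
        and 2: "\<And>x k. x \<in> tclass n Q \<Longrightarrow> k \<in> ?K \<Longrightarrow> {m \<in> M Q. emp (zip x (cb m k)) = Js Q} \<noteq> {}"
        and 3: "\<And>g :: bool list \<Rightarrow> 'v list. (\<And>m. m \<in> M Q \<Longrightarrow> length (g m) = n) \<Longrightarrow>
          (\<Sum>x\<in>tclass n Q. \<Sum>k\<in>?K. measure_pmf.prob (pmf_of_set {m \<in> M Q. emp (zip x (cb m k)) = Js Q}) {m. seq_dist n d_e x (g m) \<le> D_e})
          \<le> 4 * real (card (tclass n Q)) * (2 * \<beta> Q * real (card ?K) + (1 + ln (real (card (M Q)) * real CARD('v) ^ n)) * \<gamma> (Js Q))"
      have "4 * real (card (tclass n Q)) * (2 * \<beta> Q * real (card ?K) + (1 + ln (real (card (M Q)) * real CARD('v) ^ n)) * \<gamma> (Js Q))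
        \<le> 4 * real (card (tclass n Q)) * (2 * \<beta> Q * real (card ?K) + a * \<gamma> (Js Q))"
        using a_le by (intro mult_left_mono add_left_mono) auto
      then have "good Q cb" unfolding good_def using 1 2 3 by (blast intro: order.trans)
      then show ?thesis by blast
    qed
  qed
  then have "\<forall>Q\<in>C. \<exists>cb. good Q cb" by blast
  from bchoice[OF this] obtain cb where cb: "\<And>Q. Q \<in> C \<Longrightarrow> good Q (cb Q)" by blast
  define N where "N x k = {m \<in> M (emp x). emp (zip x (cb (emp x) m k)) = Js (emp x)}" for x k
  \<comment> \<open>For unserved types the encoder sends the constant \<open>m0\<close>, so the
    estimate is the fixed sequence \<open>g m0\<close>. \<open>y0\<close> supplies an output of the
    right length for messages with an unserved label.\<close>
  obtain m0 where m0: "m0 \<in> bits n R" using bits_nonempty by blast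
  define y0 :: "'y list" where "y0 = replicate n undefined"
  define f where "f x k = (if emp x \<in> C then pmf_of_set (N x k) else return_pmf m0)" for x k
  define h where "h m k = return_pmf (if lab m \<in> C then cb (lab m) m k else y0)" for m k
  have N: "finite (N x k)" "N x k \<subseteq> M (emp x)" for x k by (auto simp: N_def M_def)
  have Nne: "N x k \<noteq> {}" if "emp x \<in> C" "length x = n" "k \<in> ?K" for x k
  proof -
    have "x \<in> tclass n (emp x)" using that by (simp add: tclass_def)
    then show ?thesis using cb[OF that(1)] that unfolding good_def N_def by blast
  qed
  have setf: "set_pmf (f x k) = N x k" if "emp x \<in> C" "length x = n" "k \<in> ?K" for x k
    using N Nne[OF that] that by (simp add: f_def)
  have lencb: "length (cb (lab m) m k) = n" if "lab m \<in> C" "m \<in> bits n R" "k \<in> ?K" for m k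
  proof -
    have "m \<in> M (lab m)" using that by (simp add: M_def)
    then have "cb (lab m) m k \<in> tclass n (map_pmf snd (Js (lab m)))" using cb[OF that(1)] that unfolding good_def by blast
    then show ?thesis by (rule tclass_length)
  qed
  have fenc: "f \<in> encoders n R r"
    unfolding encoders_def
  proof (intro CollectI ballI)
    fix x :: "'x list" and k assume xk: "x \<in> seqs n" "k \<in> ?K"
    show "set_pmf (f x k) \<subseteq> bits n R"
    proof (cases "emp x \<in> C")
      case True
      then show ?thesis using setf[of x k] xk by (auto simp: N_def M_def)
    next
      case False
      then show ?thesis using m0 by (simp add: f_def)
    qed
  qed
  have hdec: "h \<in> decoders n R r"
    unfolding decoders_def using lencb by (auto simp: h_def y0_def)
  have zero: "measure_pmf.prob (bind_pmf (f x k) (\<lambda>m. h m k)) {ys. seq_dist n d x ys > D} = 0"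
    if x: "emp x \<in> C" "length x = n" "k \<in> ?K" for x k
  proof -
    have "seq_dist n d x ys \<le> D" if ys: "ys \<in> set_pmf (bind_pmf (f x k) (\<lambda>m. h m k))" for ys
    proof -
      obtain m where m: "m \<in> N x k" "ys \<in> set_pmf (h m k)" using ys setf[OF x] by auto
      have lm: "lab m = emp x" "m \<in> bits n R" using m by (auto simp: N_def M_def)
      then have y: "ys = cb (emp x) m k" using m x by (simp add: h_def)
      have "length ys = n" using lencb[of m k] lm x y by simp
      then have "seq_dist n d x ys = cost d (Js (emp x))"
        using m x n seq_dist_emp[of x n ys d] by (simp add: N_def y)
      then show ?thesis using Js(3)[OF x(1)] by simp
    qed
    then show ?thesis by (auto simp: measure_pmf.prob_eq_0 AE_measure_pmf_iff not_less)
  qed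
  have "excess_dist_prob n d P D r f h \<le> (\<Sum>x\<in>seqs n. if emp x \<in> C then 0 else w x)"
    unfolding excess_dist_prob_sum
  proof (rule sum_mono)
    fix x :: "'x list" assume x: "x \<in> seqs n"
    show "(\<Sum>k\<in>?K. pmf (replicate_pmf n P) x / card ?K * measure_pmf.prob (bind_pmf (f x k) (\<lambda>m. h m k)) {ys. seq_dist n d x ys > D})
      \<le> (if emp x \<in> C then 0 else w x)"
    proof (cases "emp x \<in> C")
      case True
      then show ?thesis using zero[of x] x by (simp add: sum_nonpos)
    next
      case False
      have "(\<Sum>k\<in>?K. pmf (replicate_pmf n P) x / card ?K * measure_pmf.prob (bind_pmf (f x k) (\<lambda>m. h m k)) {ys. seq_dist n d x ys > D})
        \<le> (\<Sum>k\<in>?K. pmf (replicate_pmf n P) x / card ?K * 1)"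
        by (intro sum_mono mult_left_mono) auto
      then show ?thesis using False by (simp add: w_def)
    qed
  qed
  also have "\<dots> = (\<Sum>Q\<in>?TT. \<Sum>x\<in>tclass n Q. if emp x \<in> C then 0 else w x)" by (rule sum_by_type[OF n])
  also have "\<dots> = (\<Sum>Q\<in>?TT. if Q \<in> C then 0 else measure_pmf.prob (replicate_pmf n P) (tclass n Q))"
  proof (intro sum.cong refl)
    fix Q
    have "(\<Sum>x\<in>tclass n Q. if emp x \<in> C then 0 else w x) = (\<Sum>x\<in>tclass n Q. if Q \<in> C then 0 else w x)"
      by (intro sum.cong) (auto simp: tclass_def)
    then show "(\<Sum>x\<in>tclass n Q. if emp x \<in> C then 0 else w x) = (if Q \<in> C then 0 else measure_pmf.prob (replicate_pmf n P) (tclass n Q))"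
      by (simp add: w_def measure_measure_pmf_finite)
  qed
  also have "\<dots> = (\<Sum>Q | is_type n Q \<and> Q \<notin> C. measure_pmf.prob (replicate_pmf n P) (tclass n Q))"
    using card_types(1)[OF n, where 'a = 'x] by (intro sum.mono_neutral_cong_right) auto
  finally have "excess_dist_prob n d P D r f h \<le> 2 powr (- (real n * \<alpha>))" using excess by linarith
  then have frel: "f \<in> reliable_encoders n d P D R r \<alpha>"
    unfolding reliable_encoders_def using fenc hdec by blast
  show ?thesis
  proof (intro bexI[OF _ frel] ballI)
    fix g :: "bool list \<Rightarrow> 'v list" assume g: "g \<in> bits n R \<rightarrow> seqs n"
    have "eavesdropper_prob n d_e P D_e r f g = (\<Sum>Q\<in>?TT. \<Sum>x\<in>tclass n Q. \<Sum>k\<in>?K. w x / card ?K * measure_pmf.prob (f x k) {m. seq_dist n d_e x (g m) \<le> D_e})"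
      unfolding eavesdropper_prob_sum w_def by (rule sum_by_type[OF n])
    also have "\<dots> \<le> (\<Sum>Q\<in>?TT. measure_pmf.prob (replicate_pmf n P) (tclass n Q) *
        (if Q \<in> C then 4 * (2 * \<beta> Q + a * \<gamma> (Js Q) / real (card ?K)) else \<beta> Q))"
    proof (rule sum_mono)
      fix Q :: "'x pmf" assume Q: "Q \<in> ?TT"
      let ?pr = "measure_pmf.prob (replicate_pmf n P) (tclass n Q)"
      let ?c = "real (card (tclass n Q))"
      have c: "?c > 0" using is_type_tclass_pos[of n Q] Q n by simp
      have wx: "w x = ?pr / ?c" if "x \<in> tclass n Q" for x
        unfolding prob_tclass_weight[OF n P that, symmetric] using that by (auto simp: w_def)
      have eq: "(\<Sum>x\<in>tclass n Q. \<Sum>k\<in>?K. w x / card ?K * measure_pmf.prob (f x k) {m. seq_dist n d_e x (g m) \<le> D_e})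
        = ?pr / (?c * card ?K) * (\<Sum>x\<in>tclass n Q. \<Sum>k\<in>?K. measure_pmf.prob (f x k) {m. seq_dist n d_e x (g m) \<le> D_e})"
        unfolding sum_distrib_left by (intro sum.cong refl) (simp add: wx)
      have "(\<Sum>x\<in>tclass n Q. \<Sum>k\<in>?K. measure_pmf.prob (f x k) {m. seq_dist n d_e x (g m) \<le> D_e})
        \<le> ?c * card ?K * (if Q \<in> C then 4 * (2 * \<beta> Q + a * \<gamma> (Js Q) / real (card ?K)) else \<beta> Q)"
      proof (cases "Q \<in> C")
        case True
        have "(\<Sum>x\<in>tclass n Q. \<Sum>k\<in>?K. measure_pmf.prob (f x k) {m. seq_dist n d_e x (g m) \<le> D_e})
          = (\<Sum>x\<in>tclass n Q. \<Sum>k\<in>?K. measure_pmf.prob (pmf_of_set {m \<in> M Q. emp (zip x (cb Q m k)) = Js Q}) {m. seq_dist n d_e x (g m) \<le> D_e})"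
          using True by (intro sum.cong refl) (auto simp: f_def N_def tclass_def)
        also have "\<dots> \<le> 4 * ?c * (2 * \<beta> Q * real (card ?K) + a * \<gamma> (Js Q))"
        proof -
          have "\<forall>m\<in>M Q. length (g m) = n" using g by (auto simp: M_def)
          then show ?thesis using cb[OF True] unfolding good_def by blast
        qed
        also have "\<dots> = ?c * card ?K * (4 * (2 * \<beta> Q + a * \<gamma> (Js Q) / real (card ?K)))"
          using cK by (simp add: field_simps)
        finally show ?thesis using True by simp
      next
        case False
        have "(\<Sum>x\<in>tclass n Q. \<Sum>k\<in>?K. measure_pmf.prob (f x k) {m. seq_dist n d_e x (g m) \<le> D_e})
          = (\<Sum>x\<in>tclass n Q. \<Sum>k\<in>?K. of_bool (seq_dist n d_e x (g m0) \<le> D_e))"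
          using False by (intro sum.cong refl) (auto simp: f_def tclass_def)
        also have "\<dots> = card ?K * real (card {x \<in> tclass n Q. seq_dist n d_e x (g m0) \<le> D_e})"
          by (simp add: sum_distrib_left[symmetric] Int_def)
        also have "\<dots> \<le> card ?K * (?c * \<beta> Q)"
          unfolding \<beta>_def using Q g m0 by (intro mult_left_mono ball_bound[OF n]) auto
        finally show ?thesis using False by (simp add: mult_ac)
      qed
      then have *: "?pr / (?c * card ?K) * (\<Sum>x\<in>tclass n Q. \<Sum>k\<in>?K. measure_pmf.prob (f x k) {m. seq_dist n d_e x (g m) \<le> D_e})
        \<le> ?pr / (?c * card ?K) * (?c * card ?K * (if Q \<in> C then 4 * (2 * \<beta> Q + a * \<gamma> (Js Q) / real (card ?K)) else \<beta> Q))"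
        by (intro mult_left_mono) auto
      then show "(\<Sum>x\<in>tclass n Q. \<Sum>k\<in>?K. w x / card ?K * measure_pmf.prob (f x k) {m. seq_dist n d_e x (g m) \<le> D_e})
        \<le> ?pr * (if Q \<in> C then 4 * (2 * \<beta> Q + a * \<gamma> (Js Q) / real (card ?K)) else \<beta> Q)"
      proof -
        have cancel: "u / (s * t) * (s * t * z) = u * z" if "s > 0" "t > 0" for u s t z :: real
          using that by simp
        show ?thesis using * unfolding eq cancel[OF c cK] .
      qed
    qed
    finally show "eavesdropper_prob n d_e P D_e r f g \<le> (\<Sum>Q\<in>?TT. measure_pmf.prob (replicate_pmf n P) (tclass n Q) *
        (if Q \<in> C then 4 * (2 * \<beta> Q + a * \<gamma> (Js Q) / real (card ?K)) else \<beta> Q))" .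
  qed
qed

section \<open>The converse at a fixed block length\<close>

lemma prob_pmf_sum:
  assumes "set_pmf p \<subseteq> S" "finite S"
  shows "measure_pmf.prob p A = (\<Sum>y\<in>S. pmf p y * of_bool (y \<in> A))"
proof -
  have "measure_pmf.prob p A = measure_pmf.expectation p (\<lambda>y. of_bool (y \<in> A))"
  proof -
    have "(\<lambda>y. of_bool (y \<in> A)) = (indicator A :: 'a \<Rightarrow> real)" by (auto simp: fun_eq_iff)
    then show ?thesis by simp
  qed
  also have "\<dots> = (\<Sum>y\<in>S. of_bool (y \<in> A) * pmf p y)"
    using assms by (intro integral_measure_pmf_real) auto
  finally show ?thesis by (simp add: mult.commute)
qed

lemma prob_bind_sum:
  assumes "set_pmf p \<subseteq> S" "finite S"
  shows "measure_pmf.prob (bind_pmf p q) A = (\<Sum>y\<in>S. pmf p y * measure_pmf.prob (q y) A)"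
  unfolding prob_bind_pmf using assms by (subst integral_measure_pmf_real[of S]) (auto simp: mult.commute)

lemma sum_pmf_support: "set_pmf p \<subseteq> S \<Longrightarrow> finite S \<Longrightarrow> (\<Sum>y\<in>S. pmf p y) = 1"
  by (rule sum_pmf_eq_1)

text \<open>Derandomisation: for each message some estimate is at least as good as the average under
  \<nu>. The attacks below may therefore be randomised although g is a function.\<close>

lemma eavesdropper_guess:
  fixes P :: "'x::finite pmf" and d_e :: "'x \<Rightarrow> 'v::finite \<Rightarrow> real" and \<nu> :: "bool list \<Rightarrow> 'v list pmf"
  assumes f: "f \<in> encoders n R r" and \<nu>: "\<And>m. set_pmf (\<nu> m) \<subseteq> seqs n"
  obtains g where "g \<in> bits n R \<rightarrow> seqs n"
    "eavesdropper_prob n d_e P D_e r f g \<ge>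
      (\<Sum>x\<in>seqs n. \<Sum>k\<in>bits n r. pmf (replicate_pmf n P) x / card (bits n r) *
        (\<Sum>m\<in>bits n R. pmf (f x k) m * measure_pmf.prob (\<nu> m) {v. seq_dist n d_e x v \<le> D_e}))"
proof -
  \<comment> \<open>The probability that the message is m and v is within distortion
    \<open>D_e\<close> of the source.\<close>
  define S where "S m v = (\<Sum>x\<in>seqs n. \<Sum>k\<in>bits n r. pmf (replicate_pmf n P) x / card (bits n r) *
    (pmf (f x k) m * of_bool (seq_dist n d_e x v \<le> D_e)))" for m and v :: "'v list"
  have setf: "set_pmf (f x k) \<subseteq> bits n R" if "x \<in> seqs n" "k \<in> bits n r" for x k
    using f that by (auto simp: encoders_def)
  have "\<exists>v\<in>seqs n. (\<Sum>v\<in>seqs n. pmf (\<nu> m) v * S m v) \<le> S m v" for m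
  proof (rule ccontr)
    assume "\<not> ?thesis"
    then have less: "S m v < (\<Sum>v\<in>seqs n. pmf (\<nu> m) v * S m v)" if "v \<in> seqs n" for v
      using that by (meson not_less)
    let ?t = "\<Sum>v\<in>seqs n. pmf (\<nu> m) v * S m v"
    obtain v0 where v0: "v0 \<in> set_pmf (\<nu> m)" using set_pmf_not_empty[of "\<nu> m"] by blast
    have "?t < (\<Sum>v\<in>seqs n. pmf (\<nu> m) v * ?t)"
    proof (rule sum_strict_mono_ex1)
      show "\<forall>v\<in>seqs n. pmf (\<nu> m) v * S m v \<le> pmf (\<nu> m) v * ?t"
        using less by (intro ballI mult_left_mono) (auto intro: less_imp_le)
      show "\<exists>v\<in>seqs n. pmf (\<nu> m) v * S m v < pmf (\<nu> m) v * ?t"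
      proof (rule bexI[of _ v0])
        show "v0 \<in> seqs n" using v0 \<nu> by blast
        then show "pmf (\<nu> m) v0 * S m v0 < pmf (\<nu> m) v0 * ?t"
          using less v0 by (intro mult_strict_left_mono) (auto simp: pmf_positive)
      qed
    qed simp
    also have "\<dots> = ?t" using sum_pmf_support[OF \<nu>[of m]] by (simp add: sum_distrib_right[symmetric])
    finally show False by simp
  qed
  then have "\<forall>m. \<exists>v. v \<in> seqs n \<and> (\<Sum>v\<in>seqs n. pmf (\<nu> m) v * S m v) \<le> S m v" by blast
  from choice[OF this] obtain g where g: "\<And>m. g m \<in> seqs n" "\<And>m. (\<Sum>v\<in>seqs n. pmf (\<nu> m) v * S m v) \<le> S m (g m)" by blast
  have swap: "(\<Sum>m\<in>bits n R. \<Sum>x\<in>seqs n. \<Sum>k\<in>bits n r. F m x k) = (\<Sum>x\<in>seqs n. \<Sum>k\<in>bits n r. \<Sum>m\<in>bits n R. F m x k)"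
    for F :: "bool list \<Rightarrow> 'x list \<Rightarrow> bool list \<Rightarrow> real"
    by (subst sum.swap, rule sum.cong[OF refl], rule sum.swap)
  have "(\<Sum>x\<in>seqs n. \<Sum>k\<in>bits n r. pmf (replicate_pmf n P) x / card (bits n r) *
        (\<Sum>m\<in>bits n R. pmf (f x k) m * measure_pmf.prob (\<nu> m) {v. seq_dist n d_e x v \<le> D_e}))
     = (\<Sum>x\<in>seqs n. \<Sum>k\<in>bits n r. \<Sum>m\<in>bits n R. \<Sum>v\<in>seqs n. pmf (\<nu> m) v * (pmf (replicate_pmf n P) x / card (bits n r) *
        (pmf (f x k) m * of_bool (seq_dist n d_e x v \<le> D_e))))"
    unfolding prob_pmf_sum[OF \<nu> finite_seqs] sum_distrib_left mem_Collect_eq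
    by (intro sum.cong refl) (simp only: mult_ac)
  also have "\<dots> = (\<Sum>m\<in>bits n R. \<Sum>x\<in>seqs n. \<Sum>k\<in>bits n r. \<Sum>v\<in>seqs n. pmf (\<nu> m) v * (pmf (replicate_pmf n P) x / card (bits n r) *
        (pmf (f x k) m * of_bool (seq_dist n d_e x v \<le> D_e))))" by (rule swap[symmetric])
  also have "\<dots> = (\<Sum>m\<in>bits n R. \<Sum>x\<in>seqs n. \<Sum>v\<in>seqs n. \<Sum>k\<in>bits n r. pmf (\<nu> m) v * (pmf (replicate_pmf n P) x / card (bits n r) *
        (pmf (f x k) m * of_bool (seq_dist n d_e x v \<le> D_e))))" by (intro sum.cong refl sum.swap)
  also have "\<dots> = (\<Sum>m\<in>bits n R. \<Sum>v\<in>seqs n. \<Sum>x\<in>seqs n. \<Sum>k\<in>bits n r. pmf (\<nu> m) v * (pmf (replicate_pmf n P) x / card (bits n r) *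
        (pmf (f x k) m * of_bool (seq_dist n d_e x v \<le> D_e))))" by (intro sum.cong refl sum.swap)
  also have "\<dots> = (\<Sum>m\<in>bits n R. \<Sum>v\<in>seqs n. pmf (\<nu> m) v * S m v)" by (simp add: S_def sum_distrib_left)
  also have "\<dots> \<le> (\<Sum>m\<in>bits n R. S m (g m))" by (intro sum_mono g)
  also have "\<dots> = (\<Sum>x\<in>seqs n. \<Sum>k\<in>bits n r. \<Sum>m\<in>bits n R. pmf (replicate_pmf n P) x / card (bits n r) *
    (pmf (f x k) m * of_bool (seq_dist n d_e x (g m) \<le> D_e)))" unfolding S_def by (rule swap)
  also have "\<dots> = eavesdropper_prob n d_e P D_e r f g"
    unfolding eavesdropper_prob_sum
    by (intro sum.cong refl) (simp only: prob_pmf_sum[OF setf finite_bits] sum_distrib_left mem_Collect_eq)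
  finally show ?thesis using g(1) by (intro that) auto
qed

text \<open>The guess knows y but not x, so it is drawn from the shell determined by the (y, v)
  marginal of L; it succeeds whenever it happens to complete (x, y) to L.\<close>

lemma guess_prob:
  fixes L :: "(('a::finite \<times> 'b::finite) \<times> 'c::finite) pmf"
  assumes n: "n > 0" and L: "is_type n L" and xy: "emp (zip x y) = map_pmf fst L" "length x = n" "length y = n"
    and c: "cost_v c L \<le> D"
  shows "jfib' n (yv_marg L) y \<noteq> {}"
    and "2 powr (- (real n * cond_mutual_info L)) \<le> pc n (CARD('a) * CARD('b) * CARD('c) + CARD('b)) *
      measure_pmf.prob (pmf_of_set (jfib' n (yv_marg L) y)) {v. seq_dist n c x v \<le> D}"
proof -
  let ?S = "jfib' n (yv_marg L) y" and ?V = "jfib' n L (zip x y)"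
  let ?pc = "pc n (CARD('a) * CARD('b) * CARD('c) + CARD('b))"
  have zt: "zip x y \<in> tclass n (map_pmf fst L)" using xy by (simp add: tclass_def)
  have sub: "?V \<subseteq> ?S \<inter> {v. seq_dist n c x v \<le> D}"
  proof
    fix v assume "v \<in> ?V"
    then have v: "length v = n" "emp (zip (zip x y) v) = L" by (auto simp: jfib'_def)
    have ne: "zip (zip x y) v \<noteq> []" using xy v n by (intro zip_ne[of _ n]) auto
    have "yv_marg L = emp (zip y v)"
      unfolding v(2)[symmetric] yv_marg_def map_emp[OF ne] using xy v by (simp add: map_yv_zip)
    have "cost_v c (emp (zip (zip x y) v)) = seq_dist n c x v"
      using xy(2,3) v(1) n ne by (simp add: expectation_emp seq_dist_def)
    then have "cost_v c L = seq_dist n c x v" unfolding v(2) .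
    with \<open>yv_marg L = emp (zip y v)\<close> show "v \<in> ?S \<inter> {v. seq_dist n c x v \<le> D}" using v c by (simp add: jfib'_def)
  qed
  have "card ?V * card (tclass n (map_pmf fst L)) = card (tclass n L)" by (rule card_jfib'[OF n zt])
  then have "card ?V > 0" using is_type_tclass_pos[OF L n] by (metis mult_0 neq0_conv)
  then have "?V \<noteq> {}" by auto
  then show ne: "?S \<noteq> {}" using sub by blast
  then have cS: "real (card ?S) > 0" by (simp add: card_gt_0_iff)
  have pr: "measure_pmf.prob (pmf_of_set ?S) {v. seq_dist n c x v \<le> D} = real (card (?S \<inter> {v. seq_dist n c x v \<le> D})) / real (card ?S)"
    using ne by (simp add: measure_pmf_of_set)
  have "real (card ?S) * 2 powr (- (real n * cond_mutual_info L)) \<le> real (card ?V) * ?pc"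
    by (rule guess_count[OF n L zt xy(2,3)])
  also have "\<dots> \<le> real (card (?S \<inter> {v. seq_dist n c x v \<le> D})) * ?pc"
    using card_mono[OF _ sub] by (intro mult_right_mono) auto
  finally show "2 powr (- (real n * cond_mutual_info L)) \<le> ?pc * measure_pmf.prob (pmf_of_set ?S) {v. seq_dist n c x v \<le> D}"
    unfolding pr using cS by (simp add: pos_le_divide_eq mult_ac)
qed

text \<open>Here the side information is a constant sequence, so the estimate ignores the message
  and the bound holds for every encoder.\<close>

lemma converse_blind:
  fixes P :: "'x::finite pmf" and d_e :: "'x \<Rightarrow> 'v::finite \<Rightarrow> real" and L :: "(('x \<times> unit) \<times> 'v) pmf"
  assumes n: "n > 0" and f: "f \<in> encoders n R r"
    and L: "is_type n L" "map_pmf fst L = unit_ext Q" "cost_v d_e L \<le> D_e"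
  obtains g where "g \<in> bits n R \<rightarrow> seqs n"
    "measure_pmf.prob (replicate_pmf n P) (tclass n Q) * 2 powr (- (real n * cond_mutual_info L)) \<le>
      pc n (CARD('x) * CARD('v) + 1) * eavesdropper_prob n d_e P D_e r f g"
proof -
  let ?y = "replicate n ()" and ?pc = "pc n (CARD('x) * CARD('v) + 1)"
  let ?\<sigma> = "2 powr (- (real n * cond_mutual_info L)) / ?pc"
  define \<nu> where "\<nu> = pmf_of_set (jfib' n (yv_marg L) ?y)"
  have ex: "emp (zip x ?y) = map_pmf fst L" if "x \<in> tclass n Q" for x
    using that n L by (simp add: tclass_def emp_unit_zip)
  have "is_type n (map_pmf fst (map_pmf fst L))" using L by (intro is_type_map)
  then have "is_type n Q" using L by simp
  then obtain x0 where x0: "x0 \<in> tclass n Q" using tclass_nonempty n by blast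
  have ne: "jfib' n (yv_marg L) ?y \<noteq> {}"
    using guess_prob(1)[OF n L(1) ex[OF x0] _ _ L(3)] x0 by (simp add: tclass_def)
  then have set\<nu>: "set_pmf \<nu> \<subseteq> seqs n" by (auto simp: \<nu>_def jfib'_def)
  have pr: "?\<sigma> \<le> measure_pmf.prob \<nu> {v. seq_dist n d_e x v \<le> D_e}" if x: "x \<in> tclass n Q" for x
    using guess_prob(2)[OF n L(1) ex[OF x] _ _ L(3)] tclass_length[OF x]
    by (simp add: pos_divide_le_eq mult.commute \<nu>_def)
  have cK: "real (card (bits n r)) > 0" by (simp add: card_gt_0_iff)
  obtain g where g: "g \<in> bits n R \<rightarrow> seqs n"
    "eavesdropper_prob n d_e P D_e r f g \<ge>
      (\<Sum>x\<in>seqs n. \<Sum>k\<in>bits n r. pmf (replicate_pmf n P) x / card (bits n r) *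
        (\<Sum>m\<in>bits n R. pmf (f x k) m * measure_pmf.prob \<nu> {v. seq_dist n d_e x v \<le> D_e}))"
    using eavesdropper_guess[OF f, of "\<lambda>_. \<nu>" P d_e D_e] set\<nu> by blast
  have "measure_pmf.prob (replicate_pmf n P) (tclass n Q) * ?\<sigma> = (\<Sum>x\<in>tclass n Q. pmf (replicate_pmf n P) x * ?\<sigma>)"
    by (simp only: measure_measure_pmf_finite[OF finite_tclass] sum_distrib_right)
  also have "\<dots> \<le> (\<Sum>x\<in>tclass n Q. pmf (replicate_pmf n P) x * measure_pmf.prob \<nu> {v. seq_dist n d_e x v \<le> D_e})"
    by (intro sum_mono mult_left_mono pr) auto
  also have "\<dots> \<le> (\<Sum>x\<in>seqs n. pmf (replicate_pmf n P) x * measure_pmf.prob \<nu> {v. seq_dist n d_e x v \<le> D_e})"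
    by (rule sum_mono2) (auto simp: tclass_def)
  also have "\<dots> = (\<Sum>x\<in>seqs n. \<Sum>k\<in>bits n r. pmf (replicate_pmf n P) x / card (bits n r) *
        (\<Sum>m\<in>bits n R. pmf (f x k) m * measure_pmf.prob \<nu> {v. seq_dist n d_e x v \<le> D_e}))"
  proof (rule sum.cong[OF refl])
    fix x :: "'x list" assume x: "x \<in> seqs n"
    have "(\<Sum>m\<in>bits n R. pmf (f x k) m * measure_pmf.prob \<nu> {v. seq_dist n d_e x v \<le> D_e}) = measure_pmf.prob \<nu> {v. seq_dist n d_e x v \<le> D_e}"
      if "k \<in> bits n r" for k
      using sum_pmf_support[of "f x k" "bits n R"] f x that by (simp add: sum_distrib_right[symmetric] encoders_def)
    then show "pmf (replicate_pmf n P) x * measure_pmf.prob \<nu> {v. seq_dist n d_e x v \<le> D_e} =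
      (\<Sum>k\<in>bits n r. pmf (replicate_pmf n P) x / card (bits n r) *
        (\<Sum>m\<in>bits n R. pmf (f x k) m * measure_pmf.prob \<nu> {v. seq_dist n d_e x v \<le> D_e}))"
      using cK by simp
  qed
  also have "\<dots> \<le> eavesdropper_prob n d_e P D_e r f g" by (rule g(2))
  finally have "measure_pmf.prob (replicate_pmf n P) (tclass n Q) * 2 powr (- (real n * cond_mutual_info L)) \<le>
      ?pc * eavesdropper_prob n d_e P D_e r f g" by (simp add: pos_divide_le_eq mult.commute)
  with g(1) show ?thesis by (rule that)
qed

text \<open>For a fixed key at most \<open>2\<^sup>n\<^sup>R\<close> reproductions are available, and each of them has a given joint type
  with only a fraction of about \<open>2 powr (- n * mutual_info J)\<close> of the sequences of the source type.
  Hence joint types of rate above \<open>R + \<epsilon>\<close> are negligible, and so are those violating the distortion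
  constraint; by pigeonhole one of the polynomially many others dominates.\<close>

lemma dominant_joint_type:
  fixes P :: "'x::finite pmf" and d :: "'x \<Rightarrow> 'y::finite \<Rightarrow> real"
  assumes n: "n > 0" and P: "set_pmf P = UNIV" and f: "f \<in> encoders n R r" and h: "h \<in> decoders n R r"
    and exc: "excess_dist_prob n d P D r f h \<le> 2 powr (- (real n * \<alpha>))"
    and Q: "is_type n Q" and big: "4 * 2 powr (- (real n * \<alpha>)) \<le> measure_pmf.prob (replicate_pmf n P) (tclass n Q)"
    and R: "R \<ge> 0" and eps: "4 * pc n (CARD('x) + CARD('y) + CARD('x) * CARD('y)) \<le> 2 powr (real n * \<epsilon>)"
  obtains J where "is_type n J" "map_pmf fst J = Q" "cost d J \<le> D" "mutual_info J \<le> R + \<epsilon>"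
    "measure_pmf.prob (replicate_pmf n P) (tclass n Q) \<le> 4 * pc n (CARD('x) * CARD('y)) *
      (\<Sum>x\<in>tclass n Q. \<Sum>k\<in>bits n r. pmf (replicate_pmf n P) x / card (bits n r) *
        (\<Sum>m\<in>bits n R. pmf (f x k) m * measure_pmf.prob (h m k) {y. emp (zip x y) = J}))"
proof (rule ccontr)
  assume contra: "\<not> thesis"
  note witness = that
  let ?K = "bits n r" and ?M = "bits n R"
  let ?pr = "measure_pmf.prob (replicate_pmf n P) (tclass n Q)"
  let ?N = "pc n (CARD('x) * CARD('y))"
  define w where "w = pmf (replicate_pmf n P)"
  define B where "B x k = bind_pmf (f x k) (\<lambda>m. h m k)" for x k
  \<comment> \<open>\<open>a J\<close> is the probability that the source has type Q and the
    legitimate reproduction has joint type J with it.\<close>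
  define a where "a J = (\<Sum>x\<in>tclass n Q. \<Sum>k\<in>?K. w x / card ?K *
        (\<Sum>m\<in>?M. pmf (f x k) m * measure_pmf.prob (h m k) {y. emp (zip x y) = J}))" for J
  have prpos: "?pr > 0" using big by (smt (verit) powr_gt_zero)
  have cK: "real (card ?K) > 0" by (simp add: card_gt_0_iff)
  have cQ: "real (card (tclass n Q)) > 0" using is_type_tclass_pos[OF Q n] by simp
  have setf: "set_pmf (f x k) \<subseteq> ?M" if "x \<in> seqs n" "k \<in> ?K" for x k
    using f that by (auto simp: encoders_def)
  have seth: "set_pmf (h m k) \<subseteq> seqs n" if "m \<in> ?M" "k \<in> ?K" for m k
    using h that by (auto simp: decoders_def)
  have setB: "set_pmf (B x k) \<subseteq> seqs n" if "x \<in> seqs n" "k \<in> ?K" for x k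
    unfolding B_def using setf[OF that] seth that by (simp add: UN_subset_iff) blast
  have wx: "w x = ?pr / real (card (tclass n Q))" if "x \<in> tclass n Q" for x
    unfolding prob_tclass_weight[OF n P that, symmetric] using that by (auto simp: w_def)
  have aB: "a J = (\<Sum>x\<in>tclass n Q. \<Sum>k\<in>?K. w x / card ?K * measure_pmf.prob (B x k) {y. emp (zip x y) = J})" for J
    unfolding a_def B_def
    by (intro sum.cong refl arg_cong2[where f = "(*)"] prob_bind_sum[symmetric] setf) (auto simp: tclass_def)
  define S where "S = {J :: ('x \<times> 'y) pmf. is_type n J \<and> map_pmf fst J = Q}"
  have finS: "finite S" unfolding S_def using card_types(1)[OF n, where 'a = "'x \<times> 'y"] by (rule rev_finite_subset) auto
  have "card S \<le> card {J :: ('x \<times> 'y) pmf. is_type n J}"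
    unfolding S_def by (rule card_mono[OF card_types(1)[OF n]]) auto
  then have cardS: "real (card S) \<le> ?N" using card_types_pc[OF n, where 'a = "'x \<times> 'y"] by simp
  have marg: "measure_pmf.prob (B x k) A = (\<Sum>J\<in>S. measure_pmf.prob (B x k) (A \<inter> {y. emp (zip x y) = J}))"
    if x: "x \<in> tclass n Q" and k: "k \<in> ?K" for x k A
  proof -
    have lx: "length x = n" using x by (rule tclass_length)
    have inS: "emp (zip x y) \<in> S" if "y \<in> seqs n" for y
      using that x n lx emp_zip_marg(1)[of x n y] is_type_emp[of "zip x y" n] by (auto simp: S_def tclass_def)
    have "(\<Sum>J\<in>S. measure_pmf.prob (B x k) (A \<inter> {y. emp (zip x y) = J}))
      = (\<Sum>J\<in>S. \<Sum>y\<in>seqs n. pmf (B x k) y * of_bool (y \<in> A \<and> emp (zip x y) = J))"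
      using setB[of x k] lx k by (intro sum.cong refl) (simp add: prob_pmf_sum[of _ "seqs n"])
    also have "\<dots> = (\<Sum>y\<in>seqs n. \<Sum>J\<in>S. pmf (B x k) y * of_bool (y \<in> A \<and> emp (zip x y) = J))" by (rule sum.swap)
    also have "\<dots> = (\<Sum>y\<in>seqs n. pmf (B x k) y * of_bool (y \<in> A))"
    proof (rule sum.cong[OF refl])
      fix y :: "'y list" assume "y \<in> seqs n"
      have "(\<Sum>J\<in>S. pmf (B x k) y * of_bool (y \<in> A \<and> emp (zip x y) = J)) =
        (\<Sum>J\<in>S. if J = emp (zip x y) then pmf (B x k) y * of_bool (y \<in> A) else 0)"
        by (intro sum.cong) auto
      then show "(\<Sum>J\<in>S. pmf (B x k) y * of_bool (y \<in> A \<and> emp (zip x y) = J)) = pmf (B x k) y * of_bool (y \<in> A)"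
        using inS[OF \<open>y \<in> seqs n\<close>] finS by (simp add: sum.delta)
    qed
    also have "\<dots> = measure_pmf.prob (B x k) A"
      using setB[of x k] lx k by (simp add: prob_pmf_sum[of _ "seqs n"])
    finally show ?thesis by simp
  qed
  \<comment> \<open>Were the claim false, an admissible J of rate at most R + \<epsilon> would have
    small mass by assumption; one of larger rate has small mass by counting.\<close>
  have small: "a J \<le> ?pr / (4 * ?N)" if J: "J \<in> S" "cost d J \<le> D" for J
  proof (cases "mutual_info J \<le> R + \<epsilon>")
    case True
    have "\<not> ?pr \<le> 4 * ?N * a J"
      using contra witness[of J] J True unfolding a_def w_def S_def by blast
    then show ?thesis by (simp add: pos_le_divide_eq mult_ac)
  next
    case False
    let ?X = "real (card (tclass n Q)) * (pc n (CARD('x) + CARD('y)) * 2 powr (- (real n * mutual_info J)))"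
    have JT: "is_type n J" "map_pmf fst J = Q" using J by (auto simp: S_def)
    have inner: "(\<Sum>x\<in>tclass n Q. measure_pmf.prob (h m k) {y. emp (zip x y) = J}) \<le> ?X" if mk: "m \<in> ?M" "k \<in> ?K" for m k
    proof -
      have "(\<Sum>x\<in>tclass n Q. measure_pmf.prob (h m k) {y. emp (zip x y) = J})
        = (\<Sum>x\<in>tclass n Q. \<Sum>y\<in>seqs n. pmf (h m k) y * of_bool (emp (zip x y) = J))"
        by (intro sum.cong refl) (simp add: prob_pmf_sum[OF seth[OF mk]])
      also have "\<dots> = (\<Sum>y\<in>seqs n. \<Sum>x\<in>tclass n Q. pmf (h m k) y * of_bool (emp (zip x y) = J))" by (rule sum.swap)
      also have "\<dots> \<le> (\<Sum>y\<in>seqs n. pmf (h m k) y * ?X)"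
      proof (rule sum_mono)
        fix y :: "'y list" assume y: "y \<in> seqs n"
        have "(\<Sum>x\<in>tclass n Q. of_bool (emp (zip x y) = J)) = real (card {x \<in> tclass n Q. emp (zip x y) = J})"
          by (simp add: Int_def)
        also have "\<dots> \<le> real (card (jfib n J y))"
          by (intro of_nat_mono card_mono) (auto simp: jfib_def tclass_def)
        also have "\<dots> \<le> ?X" using jfib_bound[OF n JT(1), of y] y JT by simp
        finally have "pmf (h m k) y * (\<Sum>x\<in>tclass n Q. of_bool (emp (zip x y) = J)) \<le> pmf (h m k) y * ?X"
          by (intro mult_left_mono) auto
        then show "(\<Sum>x\<in>tclass n Q. pmf (h m k) y * of_bool (emp (zip x y) = J)) \<le> pmf (h m k) y * ?X"
          by (simp only: sum_distrib_left)
      qed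
      also have "\<dots> = ?X" using sum_pmf_support[OF seth[OF mk]] by (simp add: sum_distrib_right[symmetric])
      finally show ?thesis .
    qed
    \<comment> \<open>Bounding the encoder by 1 removes its dependence on x: what remains is, for
      each key and message, one reproduction law, which can match J only on a small part of the
      class.\<close>
    have "a J \<le> (\<Sum>x\<in>tclass n Q. \<Sum>k\<in>?K. w x / card ?K * (\<Sum>m\<in>?M. 1 * measure_pmf.prob (h m k) {y. emp (zip x y) = J}))"
      unfolding a_def w_def by (intro sum_mono mult_left_mono mult_right_mono) (auto simp: pmf_le_1)
    also have "\<dots> = (\<Sum>x\<in>tclass n Q. \<Sum>k\<in>?K. \<Sum>m\<in>?M. ?pr / (real (card (tclass n Q)) * card ?K) * measure_pmf.prob (h m k) {y. emp (zip x y) = J})"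
      by (intro sum.cong refl) (simp add: wx sum_distrib_left)
    also have "\<dots> = (\<Sum>k\<in>?K. \<Sum>x\<in>tclass n Q. \<Sum>m\<in>?M. ?pr / (real (card (tclass n Q)) * card ?K) * measure_pmf.prob (h m k) {y. emp (zip x y) = J})"
      by (rule sum.swap)
    also have "\<dots> = (\<Sum>k\<in>?K. \<Sum>m\<in>?M. \<Sum>x\<in>tclass n Q. ?pr / (real (card (tclass n Q)) * card ?K) * measure_pmf.prob (h m k) {y. emp (zip x y) = J})"
      by (intro sum.cong refl sum.swap)
    also have "\<dots> = ?pr / (real (card (tclass n Q)) * card ?K) * (\<Sum>k\<in>?K. \<Sum>m\<in>?M. \<Sum>x\<in>tclass n Q. measure_pmf.prob (h m k) {y. emp (zip x y) = J})"
      by (simp only: sum_distrib_left)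
    also have "\<dots> \<le> ?pr / (real (card (tclass n Q)) * card ?K) * (\<Sum>k\<in>?K. \<Sum>m\<in>?M. ?X)"
      by (intro mult_left_mono sum_mono inner) auto
    also have "\<dots> = ?pr * (real (card ?M) * pc n (CARD('x) + CARD('y)) * 2 powr (- (real n * mutual_info J)))"
      using cQ cK by simp
    also have "\<dots> \<le> ?pr * (1 / (4 * ?N))"
    proof (rule mult_left_mono)
      have "real (card ?M) \<le> 2 powr (real n * R)"
        unfolding card_bits using R by (simp add: powr_realpow[symmetric])
      then have "real (card ?M) * pc n (CARD('x) + CARD('y)) * 2 powr (- (real n * mutual_info J))
        \<le> 2 powr (real n * R) * pc n (CARD('x) + CARD('y)) * 2 powr (- (real n * (R + \<epsilon>)))"
        using False by (intro mult_mono) (auto intro!: mult_left_mono)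
      also have "\<dots> = pc n (CARD('x) + CARD('y)) * 2 powr (- (real n * \<epsilon>))"
        by (simp add: powr_add[symmetric] algebra_simps)
      also have "\<dots> \<le> 1 / (4 * ?N)"
        using eps by (simp add: pc_mult[symmetric] powr_minus field_simps)
      finally show "real (card ?M) * pc n (CARD('x) + CARD('y)) * 2 powr (- (real n * mutual_info J)) \<le> 1 / (4 * ?N)" .
    qed simp
    finally show ?thesis by simp
  qed
  \<comment> \<open>The joint types share the whole mass of the class. The admissible ones would
    carry at most a quarter, and the violating ones carry at most the excess probability, which is
    another quarter.\<close>
  have "(\<Sum>J\<in>S. a J) = ?pr"
  proof -
    have "(\<Sum>J\<in>S. a J) = (\<Sum>x\<in>tclass n Q. \<Sum>k\<in>?K. \<Sum>J\<in>S. w x / card ?K * measure_pmf.prob (B x k) {y. emp (zip x y) = J})"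
      unfolding aB by (subst sum.swap, rule sum.cong[OF refl], rule sum.swap)
    also have "\<dots> = (\<Sum>x\<in>tclass n Q. \<Sum>k\<in>?K. w x / card ?K)"
    proof (intro sum.cong refl)
      fix x k assume "x \<in> tclass n Q" "k \<in> ?K"
      from marg[OF this, of UNIV] have "(\<Sum>J\<in>S. measure_pmf.prob (B x k) {y. emp (zip x y) = J}) = 1" by simp
      then show "(\<Sum>J\<in>S. w x / card ?K * measure_pmf.prob (B x k) {y. emp (zip x y) = J}) = w x / card ?K"
        by (simp only: sum_distrib_left[symmetric] mult_1_right)
    qed
    also have "\<dots> = (\<Sum>x\<in>tclass n Q. w x)" using cK by simp
    finally show ?thesis by (simp add: w_def measure_measure_pmf_finite)
  qed
  moreover have "(\<Sum>J\<in>S. a J) = (\<Sum>J\<in>{J \<in> S. cost d J \<le> D}. a J) + (\<Sum>J\<in>{J \<in> S. cost d J > D}. a J)"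
  proof -
    have "S = {J \<in> S. cost d J \<le> D} \<union> {J \<in> S. cost d J > D}" by auto
    then have "sum a S = sum a ({J \<in> S. cost d J \<le> D} \<union> {J \<in> S. cost d J > D})" by (rule arg_cong)
    also have "\<dots> = sum a {J \<in> S. cost d J \<le> D} + sum a {J \<in> S. cost d J > D}"
      using finS by (intro sum.union_disjoint) auto
    finally show ?thesis .
  qed
  moreover have "(\<Sum>J\<in>{J \<in> S. cost d J \<le> D}. a J) \<le> ?pr / 4"
  proof -
    have "(\<Sum>J\<in>{J \<in> S. cost d J \<le> D}. a J) \<le> (\<Sum>J\<in>{J \<in> S. cost d J \<le> D}. ?pr / (4 * ?N))"
      using small by (intro sum_mono) auto
    also have "\<dots> = real (card {J \<in> S. cost d J \<le> D}) * (?pr / (4 * ?N))" by simp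
    also have "\<dots> \<le> ?N * (?pr / (4 * ?N))"
    proof (rule mult_right_mono)
      have "card {J \<in> S. cost d J \<le> D} \<le> card S" using finS by (intro card_mono) auto
      then show "real (card {J \<in> S. cost d J \<le> D}) \<le> ?N" using cardS by linarith
    qed simp
    also have "\<dots> = ?pr / 4" by (simp add: less_imp_neq[OF pc_pos, symmetric])
    finally show ?thesis .
  qed
  moreover have "(\<Sum>J\<in>{J \<in> S. cost d J > D}. a J) \<le> ?pr / 4"
  proof -
    let ?Bad = "{J \<in> S. cost d J > D}"
    have "(\<Sum>J\<in>?Bad. a J) = (\<Sum>x\<in>tclass n Q. \<Sum>k\<in>?K. \<Sum>J\<in>?Bad. w x / card ?K * measure_pmf.prob (B x k) {y. emp (zip x y) = J})"
      unfolding aB by (subst sum.swap, rule sum.cong[OF refl], rule sum.swap)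
    also have "\<dots> \<le> (\<Sum>x\<in>tclass n Q. \<Sum>k\<in>?K. w x / card ?K * measure_pmf.prob (B x k) {y. seq_dist n d x y > D})"
    proof (intro sum_mono)
      fix x k assume x: "x \<in> tclass n Q" and k: "k \<in> ?K"
      have lx: "length x = n" using x by (rule tclass_length)
      have "(\<Sum>J\<in>?Bad. measure_pmf.prob (B x k) {y. emp (zip x y) = J})
        \<le> (\<Sum>J\<in>?Bad. measure_pmf.prob (B x k) ({y. seq_dist n d x y > D} \<inter> {y. emp (zip x y) = J}))"
      proof (rule sum_mono)
        fix J assume J: "J \<in> ?Bad"
        have "\<And>y. y \<in> set_pmf (B x k) \<Longrightarrow> emp (zip x y) = J \<Longrightarrow> seq_dist n d x y > D"
        proof -
          fix y assume "y \<in> set_pmf (B x k)" "emp (zip x y) = J"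
          moreover from this have "length y = n" using setB[of x k] lx k by auto
          ultimately show "seq_dist n d x y > D" using seq_dist_emp[OF lx _ n, of y d] J by simp
        qed
        then have "measure_pmf.prob (B x k) {y. emp (zip x y) = J} = measure_pmf.prob (B x k) ({y. seq_dist n d x y > D} \<inter> {y. emp (zip x y) = J})"
          by (intro measure_eq_AE) (auto simp: AE_measure_pmf_iff)
        then show "measure_pmf.prob (B x k) {y. emp (zip x y) = J} \<le> measure_pmf.prob (B x k) ({y. seq_dist n d x y > D} \<inter> {y. emp (zip x y) = J})"
          by simp
      qed
      also have "\<dots> \<le> (\<Sum>J\<in>S. measure_pmf.prob (B x k) ({y. seq_dist n d x y > D} \<inter> {y. emp (zip x y) = J}))"
        using finS by (intro sum_mono2) auto
      also have "\<dots> = measure_pmf.prob (B x k) {y. seq_dist n d x y > D}" by (rule marg[OF x k, symmetric])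
      finally have "w x / card ?K * (\<Sum>J\<in>?Bad. measure_pmf.prob (B x k) {y. emp (zip x y) = J}) \<le> w x / card ?K * measure_pmf.prob (B x k) {y. seq_dist n d x y > D}"
        by (intro mult_left_mono) (auto simp: w_def)
      then show "(\<Sum>J\<in>?Bad. w x / card ?K * measure_pmf.prob (B x k) {y. emp (zip x y) = J}) \<le> w x / card ?K * measure_pmf.prob (B x k) {y. seq_dist n d x y > D}"
        by (simp only: sum_distrib_left)
    qed
    also have "\<dots> \<le> (\<Sum>x\<in>seqs n. \<Sum>k\<in>?K. w x / card ?K * measure_pmf.prob (B x k) {y. seq_dist n d x y > D})"
      by (rule sum_mono2) (auto simp: tclass_def w_def intro!: sum_nonneg)
    also have "\<dots> = excess_dist_prob n d P D r f h" unfolding excess_dist_prob_sum w_def B_def ..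
    also have "\<dots> \<le> ?pr / 4" using exc big by simp
    finally show ?thesis .
  qed
  ultimately show False using prpos by linarith
qed

text \<open>Success is counted only if the guessed key is the true one and the reproduction drawn
  with it has joint type J with the source; \<open>A\<close> is the probability of the latter event
  under the true key.\<close>

lemma converse_key_guess:
  fixes P :: "'x::finite pmf" and d_e :: "'x \<Rightarrow> 'v::finite \<Rightarrow> real" and L :: "(('x \<times> 'y::finite) \<times> 'v) pmf"
  assumes n: "n > 0" and f: "f \<in> encoders n R r" and h: "h \<in> decoders n R r"
    and L: "is_type n L" "map_pmf fst L = J" "cost_v d_e L \<le> D_e" and J: "map_pmf fst J = Q"
  defines "A \<equiv> (\<Sum>x\<in>tclass n Q. \<Sum>k\<in>bits n r. pmf (replicate_pmf n P) x / card (bits n r) *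
        (\<Sum>m\<in>bits n R. pmf (f x k) m * measure_pmf.prob (h m k) {y. emp (zip x y) = J}))"
  obtains g where "g \<in> bits n R \<rightarrow> seqs n"
    "A * 2 powr (- (real n * cond_mutual_info L)) \<le>
      pc n (CARD('x) * CARD('y) * CARD('v) + CARD('y)) * real (card (bits n r)) * eavesdropper_prob n d_e P D_e r f g"
proof -
  let ?K = "bits n r" and ?M = "bits n R" and ?pc = "pc n (CARD('x) * CARD('y) * CARD('v) + CARD('y))"
  define \<sigma> where "\<sigma> = 2 powr (- (real n * cond_mutual_info L)) / ?pc"
  \<comment> \<open>\<open>pmf_of_set\<close> needs a nonempty set, hence the fallback to all
    sequences; it never applies to a y that has joint type J with a source sequence.\<close>
  define S where "S y = (if jfib' n (yv_marg L) y = {} then seqs n else jfib' n (yv_marg L) y)" for y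
  have "replicate n undefined \<in> (seqs n :: 'v list set)" by simp
  then have seqs_ne: "(seqs n :: 'v list set) \<noteq> {}" by blast
  have S: "finite (S y)" "S y \<noteq> {}" "S y \<subseteq> seqs n" for y
    using seqs_ne by (auto simp: S_def jfib'_def)
  \<comment> \<open>A stochastic decoder is simulated with fresh randomness; only its law given
    message and key enters \<open>A\<close>.\<close>
  define \<nu> where "\<nu> m = bind_pmf (pmf_of_set ?K) (\<lambda>k. bind_pmf (h m k) (\<lambda>y. pmf_of_set (S y)))" for m
  have set\<nu>: "set_pmf (\<nu> m) \<subseteq> seqs n" for m using S by (auto simp: \<nu>_def)
  have seth: "set_pmf (h m k) \<subseteq> seqs n" if "m \<in> ?M" "k \<in> ?K" for m k
    using h that by (auto simp: decoders_def)
  have cK: "real (card ?K) > 0" by (simp add: card_gt_0_iff)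
  have pr: "measure_pmf.prob (h m k) {y. emp (zip x y) = J} * (\<sigma> / card ?K) \<le> measure_pmf.prob (\<nu> m) {v. seq_dist n d_e x v \<le> D_e}"
    if x: "length x = n" and m: "m \<in> ?M" and k: "k \<in> ?K" for x m k
  proof -
    let ?V = "{v. seq_dist n d_e x v \<le> D_e}"
    have "measure_pmf.prob (h m k) {y. emp (zip x y) = J} * \<sigma> = (\<Sum>y\<in>seqs n. pmf (h m k) y * (of_bool (emp (zip x y) = J) * \<sigma>))"
      unfolding prob_pmf_sum[OF seth[OF m k] finite_seqs] sum_distrib_right mem_Collect_eq mult.assoc ..
    also have "\<dots> \<le> (\<Sum>y\<in>seqs n. pmf (h m k) y * measure_pmf.prob (pmf_of_set (S y)) ?V)"
    proof (intro sum_mono mult_left_mono)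
      fix y :: "'y list" assume y: "y \<in> seqs n"
      show "of_bool (emp (zip x y) = J) * \<sigma> \<le> measure_pmf.prob (pmf_of_set (S y)) ?V"
      proof (cases "emp (zip x y) = J")
        case True
        then have e: "emp (zip x y) = map_pmf fst L" using L by simp
        have "\<sigma> \<le> measure_pmf.prob (pmf_of_set (jfib' n (yv_marg L) y)) ?V"
          using guess_prob(2)[OF n L(1) e x _ L(3)] y by (simp add: \<sigma>_def pos_divide_le_eq mult.commute)
        then show ?thesis using guess_prob(1)[OF n L(1) e x _ L(3)] y True by (simp add: S_def)
      qed simp
    qed simp
    also have "\<dots> = measure_pmf.prob (bind_pmf (h m k) (\<lambda>y. pmf_of_set (S y))) ?V"
      by (rule prob_bind_sum[OF seth[OF m k], symmetric]) simp
    \<comment> \<open>The true key is among the guessed ones; this is where the factor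
      \<open>card (bits n r)\<close> is lost.\<close>
    also have "\<dots> \<le> (\<Sum>k\<in>?K. measure_pmf.prob (bind_pmf (h m k) (\<lambda>y. pmf_of_set (S y))) ?V)"
      using k by (intro member_le_sum) auto
    also have "\<dots> = card ?K * measure_pmf.prob (\<nu> m) ?V"
      unfolding \<nu>_def using cK by (simp add: prob_bind_pmf[of "pmf_of_set ?K"] integral_pmf_of_set)
    finally show ?thesis unfolding times_divide_eq_right pos_divide_le_eq[OF cK] by (simp only: mult.commute)
  qed
  obtain g where g: "g \<in> ?M \<rightarrow> seqs n"
    "eavesdropper_prob n d_e P D_e r f g \<ge>
      (\<Sum>x\<in>seqs n. \<Sum>k\<in>?K. pmf (replicate_pmf n P) x / card ?K *
        (\<Sum>m\<in>?M. pmf (f x k) m * measure_pmf.prob (\<nu> m) {v. seq_dist n d_e x v \<le> D_e}))"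
    using eavesdropper_guess[OF f, of \<nu> P d_e D_e] set\<nu> by blast
  have "A * (\<sigma> / card ?K) = (\<Sum>x\<in>tclass n Q. \<Sum>k\<in>?K. pmf (replicate_pmf n P) x / card ?K *
        (\<Sum>m\<in>?M. pmf (f x k) m * (measure_pmf.prob (h m k) {y. emp (zip x y) = J} * (\<sigma> / card ?K))))"
    unfolding A_def sum_distrib_right sum_distrib_left by (intro sum.cong refl) (simp only: mult_ac)
  also have "\<dots> \<le> (\<Sum>x\<in>tclass n Q. \<Sum>k\<in>?K. pmf (replicate_pmf n P) x / card ?K *
        (\<Sum>m\<in>?M. pmf (f x k) m * measure_pmf.prob (\<nu> m) {v. seq_dist n d_e x v \<le> D_e}))"
    by (intro sum_mono mult_left_mono pr) (auto simp: tclass_def)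
  also have "\<dots> \<le> (\<Sum>x\<in>seqs n. \<Sum>k\<in>?K. pmf (replicate_pmf n P) x / card ?K *
        (\<Sum>m\<in>?M. pmf (f x k) m * measure_pmf.prob (\<nu> m) {v. seq_dist n d_e x v \<le> D_e}))"
    by (rule sum_mono2) (auto simp: tclass_def intro!: sum_nonneg mult_nonneg_nonneg divide_nonneg_nonneg)
  also have "\<dots> \<le> eavesdropper_prob n d_e P D_e r f g" by (rule g(2))
  finally have "A * (\<sigma> / card ?K) * (?pc * card ?K) \<le> eavesdropper_prob n d_e P D_e r f g * (?pc * card ?K)"
    using cK by (intro mult_right_mono) auto
  then have "A * 2 powr (- (real n * cond_mutual_info L)) \<le> ?pc * real (card ?K) * eavesdropper_prob n d_e P D_e r f g"
    using cK by (simp add: \<sigma>_def mult_ac less_imp_neq[OF pc_pos, symmetric])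
  with g(1) show ?thesis by (rule that)
qed

section \<open>Single-letter selection by compactness\<close>

lemma seq_at_top_subseq:
  assumes "\<And>k. N k \<ge> Suc k" "strict_mono s"
  shows "filterlim (N \<circ> s) at_top sequentially"
proof (rule filterlim_at_top_mono[OF filterlim_subseq[OF assms(2)]])
  show "\<forall>\<^sub>F k in sequentially. s k \<le> (N \<circ> s) k"
    using assms(1) by (intro always_eventually allI) (metis Suc_leD comp_apply)
qed

text \<open>An instance of \<open>feasible_types_approx\<close> with a one-letter source and zero
  cost: Q is then the conditional law to be rounded.\<close>

lemma types_dense:
  fixes Q :: "'a::finite pmf"
  obtains X where "\<And>k. is_type (Suc k) (X k)" "pmf_tendsto X Q"
proof -
  let ?J = "map_pmf (Pair ()) Q"
  have cst: "cost (\<lambda>_ _. 0) ?J \<le> (0 :: real)" by (simp add: case_prod_beta')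
  have feas: "\<exists>b :: 'a. (0 :: real) \<le> 0" for a :: unit by simp
  have m1: "map_pmf fst ?J = return_pmf ()" by (simp add: map_pmf_comp)
  have ty: "is_type (Suc k) (return_pmf ())" for k by (simp add: is_type_def)
  have lim: "pmf_tendsto (\<lambda>k. return_pmf ()) (return_pmf ())" by (simp add: pmf_tendsto_def)
  obtain Jk where Jk: "\<And>k. is_type (Suc k) (Jk k)" "\<And>k. map_pmf fst (Jk k) = return_pmf ()"
    "\<And>k. cost (\<lambda>_ _. 0) (Jk k) \<le> (0 :: real)" "pmf_tendsto Jk ?J"
    by (rule feasible_types_approx[where N = Suc and Qk = "\<lambda>_. return_pmf ()" and Q = "return_pmf ()" and J = ?J and c = "\<lambda>_ _. 0" and D = 0,
        OF zero_less_Suc filterlim_Suc ty lim feas m1 cst]) (assumption | rule that)+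
  have "pmf_tendsto (\<lambda>k. map_pmf snd (Jk k)) (map_pmf snd ?J)" by (rule pmf_tendsto_map[OF Jk(4)])
  then have "pmf_tendsto (\<lambda>k. map_pmf snd (Jk k)) Q" by (simp add: map_pmf_comp)
  with Jk(1) show ?thesis by (intro that[of "\<lambda>k. map_pmf snd (Jk k)"] is_type_map)
qed

text \<open>The bound must be uniform over all large n and all types near the divergence ball.
  Counterexamples with margins tending to zero would accumulate at some Q with divergence at most
  \<alpha>; a good joint distribution at Q is carried back to types over the sequence, a
  contradiction.\<close>

lemma achievability_selection:
  fixes P :: "'x::finite pmf" and d :: "'x \<Rightarrow> 'y::finite \<Rightarrow> real" and d_e :: "'x \<Rightarrow> 'v::finite \<Rightarrow> real"
  assumes P: "set_pmf P = UNIV" and d: "\<And>x. \<exists>y. d x y \<le> D" and de: "\<And>x. \<exists>v. d_e x v \<le> D_e"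
    and R: "\<And>Q. KL Q P \<le> \<alpha> \<Longrightarrow> rate_dist d Q D < R"
    and E: "\<And>Q. KL Q P \<le> \<alpha> \<Longrightarrow> E \<le> KL Q P + max_cond_rate_dist d d_e Q R D D_e"
    and eps: "\<epsilon> > 0"
  obtains m :: nat where "m > 0"
    "\<And>n Q. n \<ge> m \<Longrightarrow> is_type n Q \<Longrightarrow> KL Q P \<le> \<alpha> + 1 / real m \<Longrightarrow>
       \<exists>J. is_type n J \<and> map_pmf fst J = Q \<and> cost d J \<le> D \<and> mutual_info J \<le> R - 1 / real m \<and>
         E - \<epsilon> \<le> KL Q P + cond_rate_dist d_e J D_e"
proof (rule ccontr)
  assume contra: "\<not> thesis"
  define bad where "bad k p \<longleftrightarrow> fst p \<ge> Suc k \<and> is_type (fst p) (snd p) \<and> KL (snd p) P \<le> \<alpha> + 1 / real (Suc k) \<and>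
    \<not> (\<exists>J. is_type (fst p) J \<and> map_pmf fst J = snd p \<and> cost d J \<le> D \<and> mutual_info J \<le> R - 1 / real (Suc k) \<and>
         E - \<epsilon> \<le> KL (snd p) P + cond_rate_dist d_e J D_e)" for k and p :: "nat \<times> 'x pmf"
  note witness = that
  have "\<exists>p. bad k p" for k
  proof (rule ccontr)
    assume nb: "\<not> (\<exists>p. bad k p)"
    have thesis
    proof (rule witness[of "Suc k"])
      fix n :: nat and Q :: "'x pmf"
      assume "n \<ge> Suc k" "is_type n Q" "KL Q P \<le> \<alpha> + 1 / real (Suc k)"
      moreover have "\<not> bad k (n, Q)" using nb by blast
      ultimately show "\<exists>J. is_type n J \<and> map_pmf fst J = Q \<and> cost d J \<le> D \<and> mutual_info J \<le> R - 1 / real (Suc k) \<and>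
         E - \<epsilon> \<le> KL Q P + cond_rate_dist d_e J D_e"
        unfolding bad_def fst_conv snd_conv by blast
    qed simp
    with contra show False ..
  qed
  then have "\<forall>k. \<exists>p. bad k p" by blast
  from choice[OF this] obtain p where p: "\<And>k. bad k (p k)" by blast
  define N X where "N = (\<lambda>k. fst (p k))" and "X = (\<lambda>k. snd (p k))"
  have NX: "N k \<ge> Suc k" "is_type (N k) (X k)" "KL (X k) P \<le> \<alpha> + 1 / real (Suc k)" for k
    using p[of k] by (simp_all add: bad_def N_def X_def)
  have no: "\<not> (\<exists>J. is_type (N k) J \<and> map_pmf fst J = X k \<and> cost d J \<le> D \<and> mutual_info J \<le> R - 1 / real (Suc k) \<and>
         E - \<epsilon> \<le> KL (X k) P + cond_rate_dist d_e J D_e)" for k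
    using p[of k] by (simp add: bad_def N_def X_def)
  obtain s Q where s: "strict_mono s" "pmf_tendsto (X \<circ> s) Q" using pmf_compact by blast
  have KLlim: "(\<lambda>k. KL (X (s k)) P) \<longlonglongrightarrow> KL Q P" using KL_tendsto[OF P s(2)] by (simp add: comp_def)
  have inv_lim: "(\<lambda>k. 1 / real (Suc (s k))) \<longlonglongrightarrow> 0"
    using LIMSEQ_subseq_LIMSEQ[OF LIMSEQ_Suc[OF lim_1_over_n] s(1)] by (simp add: comp_def)
  have "(\<lambda>k. \<alpha> + 1 / real (Suc (s k))) \<longlonglongrightarrow> \<alpha> + 0" by (intro tendsto_intros inv_lim)
  from LIMSEQ_le[OF KLlim this] NX(3) have KLQ: "KL Q P \<le> \<alpha>" by auto
  let ?G = "max_cond_rate_dist d d_e Q R D D_e"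
  obtain J0 :: "('x \<times> 'y) pmf" where J0: "map_pmf fst J0 = Q" "cost d J0 \<le> D" "mutual_info J0 < R"
    using rate_dist_less[OF R[OF KLQ] d] by blast
  have "?G - \<epsilon> / 4 < ?G" using eps by simp
  \<comment> \<open>\<open>J1\<close> nearly attains the supremum but may use the full rate R,
    whereas \<open>J0\<close> has strictly smaller rate.\<close>
  then obtain J1 :: "('x \<times> 'y) pmf" where J1: "map_pmf fst J1 = Q" "cost d J1 \<le> D" "mutual_info J1 \<le> R" "?G - \<epsilon> / 4 < cond_rate_dist d_e J1 D_e"
    using max_cond_rate_dist_less[OF _ J0(1,2) less_imp_le[OF J0(3)]] by blast
  define t where "t k = 1 / real (Suc k)" for k
  have t: "t \<longlonglongrightarrow> 0" "\<And>k. 0 \<le> t k" "\<And>k. t k \<le> 1" "\<And>k. 0 < t k"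
    unfolding t_def using LIMSEQ_Suc[OF lim_1_over_n] by auto
  have "eventually (\<lambda>k. ?G - \<epsilon> / 4 < cond_rate_dist d_e (mix_pmf (t k) J1 J0) D_e) sequentially"
    by (rule cond_rate_dist_lsc[OF mix_tendsto[OF t(1-3)] de J1(4)])
  then obtain k0 where k0: "?G - \<epsilon> / 4 < cond_rate_dist d_e (mix_pmf (t k0) J1 J0) D_e"
    by (auto simp: eventually_sequentially)
  \<comment> \<open>A small share of \<open>J0\<close> pushes the rate below R by convexity, while
    lower semicontinuity keeps the loss in the conditional rate-distortion function within
    \<epsilon>/4.\<close>
  define J' where "J' = mix_pmf (t k0) J1 J0"
  have J'1: "map_pmf fst J' = Q" by (simp add: J'_def map_mix J0 J1)
  have "(1 - t k0) * cost d J1 + t k0 * cost d J0 \<le> (1 - t k0) * D + t k0 * D"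
    using t J0 J1 by (intro add_mono mult_left_mono) auto
  then have J'2: "cost d J' \<le> D" unfolding J'_def expectation_mix[OF t(2,3)] by (simp add: algebra_simps)
  have "mutual_info J' \<le> (1 - t k0) * mutual_info J1 + t k0 * mutual_info J0"
    unfolding J'_def using t J0 J1 by (intro mutual_info_convex) auto
  also have "\<dots> \<le> (1 - t k0) * R + t k0 * mutual_info J0"
    using t J1 by (intro add_mono mult_left_mono) auto
  also have "\<dots> < (1 - t k0) * R + t k0 * R"
    using t(4) J0(3) by simp
  finally have J'3: "mutual_info J' < R" by (simp add: algebra_simps)
  have Npos: "(N \<circ> s) k > 0" for k using NX(1)[of "s k"] by simp
  have ty: "is_type ((N \<circ> s) k) ((X \<circ> s) k)" for k using NX(2)[of "s k"] by simp
  obtain Jk where Jk: "\<And>k. is_type ((N \<circ> s) k) (Jk k)" "\<And>k. map_pmf fst (Jk k) = (X \<circ> s) k"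
    "\<And>k. cost d (Jk k) \<le> D" "pmf_tendsto Jk J'"
    by (rule feasible_types_approx[where c = d, OF Npos seq_at_top_subseq[OF NX(1) s(1)] ty s(2) d J'1 J'2]) (assumption | rule that)+
  have e1: "eventually (\<lambda>k. ?G - \<epsilon> / 4 < cond_rate_dist d_e (Jk k) D_e) sequentially"
    by (rule cond_rate_dist_lsc[OF Jk(4) de]) (use k0 in \<open>simp add: J'_def\<close>)
  have "(\<lambda>k. mutual_info (Jk k) + 1 / real (Suc (s k))) \<longlonglongrightarrow> mutual_info J' + 0"
    by (intro tendsto_intros mutual_info_tendsto Jk inv_lim)
  then have e2: "eventually (\<lambda>k. mutual_info (Jk k) + 1 / real (Suc (s k)) < R) sequentially"
    using J'3 by (intro order_tendstoD(2)) auto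
  have e3: "eventually (\<lambda>k. KL Q P - \<epsilon> / 4 < KL (X (s k)) P) sequentially"
    using KLlim eps by (intro order_tendstoD(1)) auto
  obtain k where k: "?G - \<epsilon> / 4 < cond_rate_dist d_e (Jk k) D_e" "mutual_info (Jk k) + 1 / real (Suc (s k)) < R"
    "KL Q P - \<epsilon> / 4 < KL (X (s k)) P"
    using eventually_happens[OF eventually_conj[OF e1 eventually_conj[OF e2 e3]]] by auto
  have "E - \<epsilon> \<le> KL (X (s k)) P + cond_rate_dist d_e (Jk k) D_e"
    using E[OF KLQ] k(1,3) eps by linarith
  moreover have "mutual_info (Jk k) \<le> R - 1 / real (Suc (s k))" using k(2) by linarith
  ultimately show False using no[of "s k"] Jk(1-3)[of k] by auto
qed

text \<open>The companion argument for the eavesdropper, uniform in J because the code dictates J. A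
  limit of counterexamples obeys the constraints exactly, so it has a channel below the maximum plus
  \<epsilon>, and \<open>feasible_types_approx\<close> carries that channel back.\<close>

lemma converse_selection:
  fixes Q0 :: "'x::finite pmf" and d :: "'x \<Rightarrow> 'y::finite \<Rightarrow> real" and d_e :: "'x \<Rightarrow> 'v::finite \<Rightarrow> real"
  assumes de: "\<And>x. \<exists>v. d_e x v \<le> D_e" and eps: "\<epsilon> > 0"
  obtains m :: nat where "m > 0"
    "\<And>n J. n \<ge> m \<Longrightarrow> is_type n J \<Longrightarrow> (\<And>x. \<bar>pmf (map_pmf fst J) x - pmf Q0 x\<bar> \<le> 1 / real m) \<Longrightarrow>
      cost d J \<le> D \<Longrightarrow> mutual_info J \<le> R + 1 / real m \<Longrightarrow>
      \<exists>L. is_type n L \<and> map_pmf fst L = J \<and> cost_v d_e L \<le> D_e \<and> cond_mutual_info L \<le> max_cond_rate_dist d d_e Q0 R D D_e + \<epsilon>"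
proof (rule ccontr)
  let ?G = "max_cond_rate_dist d d_e Q0 R D D_e"
  assume contra: "\<not> thesis"
  define bad where "bad k p \<longleftrightarrow> fst p \<ge> Suc k \<and> is_type (fst p) (snd p) \<and>
    (\<forall>x. \<bar>pmf (map_pmf fst (snd p)) x - pmf Q0 x\<bar> \<le> 1 / real (Suc k)) \<and> cost d (snd p) \<le> D \<and> mutual_info (snd p) \<le> R + 1 / real (Suc k) \<and>
    \<not> (\<exists>L. is_type (fst p) L \<and> map_pmf fst L = snd p \<and> cost_v d_e L \<le> D_e \<and> cond_mutual_info L \<le> ?G + \<epsilon>)"
    for k and p :: "nat \<times> ('x \<times> 'y) pmf"
  note witness = that
  have "\<exists>p. bad k p" for k
  proof (rule ccontr)
    assume nb: "\<not> (\<exists>p. bad k p)"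
    have thesis
    proof (rule witness[of "Suc k"])
      fix n :: nat and J :: "('x \<times> 'y) pmf"
      assume "n \<ge> Suc k" "is_type n J" "\<And>x. \<bar>pmf (map_pmf fst J) x - pmf Q0 x\<bar> \<le> 1 / real (Suc k)"
        "cost d J \<le> D" "mutual_info J \<le> R + 1 / real (Suc k)"
      moreover have "\<not> bad k (n, J)" using nb by blast
      ultimately show "\<exists>L. is_type n L \<and> map_pmf fst L = J \<and> cost_v d_e L \<le> D_e \<and> cond_mutual_info L \<le> ?G + \<epsilon>"
        unfolding bad_def fst_conv snd_conv by blast
    qed simp
    with contra show False ..
  qed
  then have "\<forall>k. \<exists>p. bad k p" by blast
  from choice[OF this] obtain p where p: "\<And>k. bad k (p k)" by blast
  define N X where "N = (\<lambda>k. fst (p k))" and "X = (\<lambda>k. snd (p k))"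
  have NX: "N k \<ge> Suc k" "is_type (N k) (X k)" "\<bar>pmf (map_pmf fst (X k)) x - pmf Q0 x\<bar> \<le> 1 / real (Suc k)"
    "cost d (X k) \<le> D" "mutual_info (X k) \<le> R + 1 / real (Suc k)" for k x
    using p[of k] by (simp_all add: bad_def N_def X_def)
  have no: "\<not> (\<exists>L. is_type (N k) L \<and> map_pmf fst L = X k \<and> cost_v d_e L \<le> D_e \<and> cond_mutual_info L \<le> ?G + \<epsilon>)" for k
    using p[of k] by (simp add: bad_def N_def X_def)
  obtain s J where s: "strict_mono s" "pmf_tendsto (X \<circ> s) J" using pmf_compact by blast
  have inv_lim: "(\<lambda>k. 1 / real (Suc (s k))) \<longlonglongrightarrow> 0"
    using LIMSEQ_subseq_LIMSEQ[OF LIMSEQ_Suc[OF lim_1_over_n] s(1)] by (simp add: comp_def)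
  have "pmf_tendsto (\<lambda>k. map_pmf fst ((X \<circ> s) k)) Q0"
    unfolding pmf_tendsto_def
  proof
    fix x
    have "(\<lambda>k. pmf (map_pmf fst ((X \<circ> s) k)) x - pmf Q0 x) \<longlonglongrightarrow> 0"
      by (rule Lim_null_comparison[OF _ inv_lim]) (unfold comp_def real_norm_def, intro always_eventually allI NX(3))
    then show "(\<lambda>k. pmf (map_pmf fst ((X \<circ> s) k)) x) \<longlonglongrightarrow> pmf Q0 x" by (simp add: LIM_zero_iff)
  qed
  then have J1: "map_pmf fst J = Q0" using pmf_tendsto_map[OF s(2), of fst] pmf_tendsto_unique by blast
  have J2: "cost d J \<le> D"
    by (rule LIMSEQ_le_const2[OF pmf_tendsto_expectation[OF s(2)]]) (auto simp: NX(4))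
  have "(\<lambda>k. R + 1 / real (Suc (s k))) \<longlonglongrightarrow> R + 0" by (intro tendsto_intros inv_lim)
  then have J3: "mutual_info J \<le> R"
    using LIMSEQ_le[OF mutual_info_tendsto[OF s(2)], of "\<lambda>k. R + 1 / real (Suc (s k))" "R + 0"] NX(5) by auto
  have "cond_rate_dist d_e J D_e < ?G + \<epsilon>"
    using max_cond_rate_dist_ge[where c = d_e, OF J1 J2 J3 de] eps by linarith
  then obtain L where L: "map_pmf fst L = J" "cost_v d_e L \<le> D_e" "cond_mutual_info L < ?G + \<epsilon>"
    using de by (rule cond_rate_dist_less)
  have Npos: "(N \<circ> s) k > 0" for k using NX(1)[of "s k"] by simp
  have ty: "is_type ((N \<circ> s) k) ((X \<circ> s) k)" for k using NX(2)[of "s k"] by simp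
  have de': "\<exists>v. d_e (fst z) v \<le> D_e" for z :: "'x \<times> 'y" using de by blast
  obtain Lk where Lk: "\<And>k. is_type ((N \<circ> s) k) (Lk k)" "\<And>k. map_pmf fst (Lk k) = (X \<circ> s) k"
    "\<And>k. cost (\<lambda>z. d_e (fst z)) (Lk k) \<le> D_e" "pmf_tendsto Lk L"
    by (rule feasible_types_approx[where c = "\<lambda>z. d_e (fst z)", OF Npos seq_at_top_subseq[OF NX(1) s(1)] ty s(2) de' L(1) L(2)[unfolded cost_v_alt]]) (assumption | rule that)+
  have "eventually (\<lambda>k. cond_mutual_info (Lk k) < ?G + \<epsilon>) sequentially"
    by (rule order_tendstoD(2)[OF cond_mutual_info_tendsto[OF Lk(4)] L(3)])
  then obtain k where "cond_mutual_info (Lk k) < ?G + \<epsilon>" by (auto simp: eventually_sequentially)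
  then show False using no[of "s k"] Lk(1-3)[of k] unfolding cost_v_alt by auto
qed

text \<open>Q is approximated by types, and a near-optimal L over \<open>unit_ext Q\<close> by types
  over these; the strict inequality absorbs both errors.\<close>

lemma blind_selection:
  fixes P :: "'x::finite pmf" and d_e :: "'x \<Rightarrow> 'v::finite \<Rightarrow> real"
  assumes P: "set_pmf P = UNIV" and de: "\<And>x. \<exists>v. d_e x v \<le> D_e" and e: "KL Q P + rate_dist d_e Q D_e < e"
  shows "eventually (\<lambda>n. \<exists>Q' L. is_type n Q' \<and> is_type n L \<and> map_pmf fst L = unit_ext Q' \<and> cost_v d_e L \<le> D_e \<and>
    KL Q' P + cond_mutual_info L < e) sequentially"
proof -
  obtain X where X: "\<And>k. is_type (Suc k) (X k)" "pmf_tendsto X Q" using types_dense by blast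
  have "cond_rate_dist d_e (unit_ext Q) D_e < e - KL Q P" using e by (simp add: rate_dist_unit)
  then obtain L where L: "map_pmf fst L = unit_ext Q" "cost_v d_e L \<le> D_e" "cond_mutual_info L < e - KL Q P"
    using de by (rule cond_rate_dist_less)
  have de': "\<exists>v. d_e (fst z) v \<le> D_e" for z :: "'x \<times> unit" using de by blast
  have ul: "pmf_tendsto (\<lambda>k. unit_ext (X k)) (unit_ext Q)" unfolding unit_ext_def by (rule pmf_tendsto_map[OF X(2)])
  obtain Lk where Lk: "\<And>k. is_type (Suc k) (Lk k)" "\<And>k. map_pmf fst (Lk k) = unit_ext (X k)"
    "\<And>k. cost (\<lambda>z. d_e (fst z)) (Lk k) \<le> D_e" "pmf_tendsto Lk L"
    by (rule feasible_types_approx[where c = "\<lambda>z. d_e (fst z)" and N = Suc, OF zero_less_Suc filterlim_Suc is_type_unit_ext[OF X(1)] ul de' L(1) L(2)[unfolded cost_v_alt]]) (assumption | rule that)+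
  have "(\<lambda>k. KL (X k) P + cond_mutual_info (Lk k)) \<longlonglongrightarrow> KL Q P + cond_mutual_info L"
    by (intro tendsto_intros KL_tendsto[OF P X(2)] cond_mutual_info_tendsto Lk)
  then have "eventually (\<lambda>k. KL (X k) P + cond_mutual_info (Lk k) < e) sequentially"
    using L(3) by (intro order_tendstoD(2)) auto
  then have "eventually (\<lambda>k. \<exists>Q' L. is_type (Suc k) Q' \<and> is_type (Suc k) L \<and> map_pmf fst L = unit_ext Q' \<and> cost_v d_e L \<le> D_e \<and>
    KL Q' P + cond_mutual_info L < e) sequentially"
  proof eventually_elim
    case (elim k)
    then show ?case using X(1)[of k] Lk(1-3)[of k] unfolding cost_v_alt by blast
  qed
  then show ?thesis by (subst (asm) eventually_sequentially_Suc)
qed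

section \<open>From subexponential factors to exponents\<close>

lemma pc_eventually:
  assumes "\<epsilon> > 0"
  shows "eventually (\<lambda>n. c * pc n A \<le> 2 powr (real n * \<epsilon>)) sequentially"
proof -
  \<comment> \<open>Half of \<epsilon> is left for the constant c, and A + 1 keeps the divisor
    positive for A = 0.\<close>
  define \<delta> where "\<delta> = \<epsilon> / (2 * (real A + 1))"
  have \<delta>: "\<delta> > 0" using assms by (simp add: \<delta>_def)
  have 1: "eventually (\<lambda>n. 3 * (real n + 1) \<le> 2 powr (\<delta> * real n)) sequentially"
    using \<delta> by real_asymp
  have "eventually (\<lambda>n. max c 1 \<le> 2 powr ((\<epsilon> / 2) * real n)) sequentially"
    using assms by real_asymp
  with 1 show ?thesis
  proof eventually_elim
    case (elim n)
    have "pc n A \<le> (2 powr (\<delta> * real n)) ^ A" unfolding pc_def using elim(1) by (intro power_mono) auto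
    also have "\<dots> = 2 powr (\<delta> * real n * real A)" by (simp add: powr_realpow[symmetric] powr_powr)
    also have "\<dots> \<le> 2 powr ((\<epsilon> / 2) * real n)"
    proof -
      have "\<delta> * real A \<le> \<delta> * (real A + 1)" using \<delta> by (intro mult_left_mono) auto
      also have "\<dots> = \<epsilon> / 2"
      proof -
        have "\<epsilon> / (2 * B) * B = \<epsilon> / 2" if "B > 0" for B using that by simp
        from this[of "real A + 1"] show ?thesis by (simp only: \<delta>_def)
      qed
      finally have "\<delta> * real A * real n \<le> \<epsilon> / 2 * real n" by (intro mult_right_mono) auto
      then show ?thesis by (simp add: mult_ac)
    qed
    finally have A: "pc n A \<le> 2 powr ((\<epsilon> / 2) * real n)" .
    have "c * pc n A \<le> max c 1 * pc n A" by (intro mult_right_mono) auto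
    also have "\<dots> \<le> 2 powr ((\<epsilon> / 2) * real n) * 2 powr ((\<epsilon> / 2) * real n)"
      using elim(2) A by (intro mult_mono) auto
    also have "\<dots> = 2 powr (real n * \<epsilon>)" by (simp add: powr_add[symmetric] algebra_simps)
    finally show ?case .
  qed
qed

lemma prob_exponent_ge:
  assumes "n > 0" "0 \<le> p" "p \<le> 2 powr (- (real n * e))"
  shows "ereal e \<le> prob_exponent n p"
proof (cases "p = 0")
  case False
  then have "log 2 p \<le> - (real n * e)" using assms by (subst log_le_iff) auto
  then have "e \<le> (- log 2 p) / real n" using assms by (subst pos_le_divide_eq) (simp_all add: mult.commute)
  then show ?thesis using False by (simp add: prob_exponent_def)
qed (simp add: prob_exponent_def)

lemma prob_exponent_le:
  assumes "n > 0" "2 powr (- (real n * e)) \<le> p"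
  shows "prob_exponent n p \<le> ereal e"
proof -
  have p: "p > 0" using assms by (smt (verit) powr_gt_zero)
  then have "- (real n * e) \<le> log 2 p" using assms by (subst le_log_iff) auto
  then have "(- log 2 p) / real n \<le> e" using assms by (subst pos_divide_le_eq) (simp_all add: mult.commute)
  then show ?thesis using p by (simp add: prob_exponent_def)
qed

lemma ereal_tendsto_realI:
  fixes s :: "nat \<Rightarrow> ereal"
  assumes "\<And>\<epsilon>. \<epsilon> > 0 \<Longrightarrow> eventually (\<lambda>n. ereal (T - \<epsilon>) \<le> s n) sequentially"
    and "\<And>\<epsilon>. \<epsilon> > 0 \<Longrightarrow> eventually (\<lambda>n. s n \<le> ereal (T + \<epsilon>)) sequentially"
  shows "s \<longlonglongrightarrow> ereal T"
proof (rule order_tendstoI)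
  fix a assume "a < ereal T"
  then obtain b where b: "a < ereal b" "ereal b < ereal T" using ereal_dense2 by blast
  then show "eventually (\<lambda>n. a < s n) sequentially"
    using assms(1)[of "T - b"] by (auto elim!: eventually_mono intro: less_le_trans)
next
  fix a assume "ereal T < a"
  then obtain b where b: "ereal T < ereal b" "ereal b < a" using ereal_dense2 by blast
  then show "eventually (\<lambda>n. s n < a) sequentially"
    using assms(2)[of "b - T"] by (auto elim!: eventually_mono intro: le_less_trans)
qed

text \<open>Rounding the number of bits down costs at most a factor 2.\<close>

lemma card_bits_bounds:
  assumes "\<rho> \<ge> 0"
  shows "real (card (bits n \<rho>)) \<le> 2 powr (real n * \<rho>)" "2 powr (real n * \<rho>) \<le> 2 * real (card (bits n \<rho>))"
proof -
  have c: "real (card (bits n \<rho>)) = 2 powr of_int \<lfloor>real n * \<rho>\<rfloor>"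
    unfolding card_bits using assms by (simp add: powr_realpow[symmetric])
  show "real (card (bits n \<rho>)) \<le> 2 powr (real n * \<rho>)" unfolding c by simp
  have "2 powr (real n * \<rho>) \<le> 2 powr (of_int \<lfloor>real n * \<rho>\<rfloor> + 1)" by (simp add: less_imp_le)
  then show "2 powr (real n * \<rho>) \<le> 2 * real (card (bits n \<rho>))" unfolding c by (simp add: powr_add)
qed

section \<open>The exponent\<close>

lemma exists_le_of_Max_Min:
  fixes d :: "'x::finite \<Rightarrow> 'y::finite \<Rightarrow> real"
  assumes "D \<ge> (MAX x. MIN y. d x y)"
  shows "\<exists>y. d x y \<le> D"
proof -
  have "(MIN y. d x y) \<in> range (d x)" by (rule Min_in) auto
  then obtain y where "d x y = (MIN y. d x y)" by force
  also have "\<dots> \<le> (MAX x. MIN y. d x y)" by (rule Max_ge) auto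
  finally show ?thesis using assms by (intro exI[of _ y]) linarith
qed

lemma bdd_below_secrecy:
  fixes P :: "'x::finite pmf" and d_e :: "'x \<Rightarrow> 'v::finite \<Rightarrow> real"
  assumes "set_pmf P = UNIV" "\<And>x. \<exists>v. d_e x v \<le> D_e"
  shows "bdd_below (range (\<lambda>Q. KL Q P + rate_dist d_e Q D_e))"
  by (rule bdd_belowI2[of _ 0]) (use KL_nonneg[OF assms(1)] rate_dist_nonneg[where d = d_e, OF assms(2)] in \<open>auto intro: add_nonneg_nonneg\<close>)

lemma max_cond_rate_dist_lower:
  fixes d :: "'x::finite \<Rightarrow> 'y::finite \<Rightarrow> real" and d_e :: "'x \<Rightarrow> 'v::finite \<Rightarrow> real"
  assumes "rate_dist d Q D < R" "\<And>x. \<exists>y. d x y \<le> D" "\<And>x. \<exists>v. d_e x v \<le> D_e"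
  shows "max_cond_rate_dist d d_e Q R D D_e \<ge> - 2 * real (CARD('x) * CARD('y) * CARD('v)) - 2 * real CARD('y)"
proof -
  obtain J where J: "map_pmf fst J = Q" "cost d J \<le> D" "mutual_info J < R" using rate_dist_less assms(1,2) by blast
  show ?thesis
    using max_cond_rate_dist_ge[where c = d_e, OF J(1,2) less_imp_le[OF J(3)] assms(3)]
      cond_rate_dist_lower[where c = d_e and J = J, OF assms(3)] by linarith
qed

text \<open>Taking E below both competing terms avoids reasoning about their minimum: every type
  contributes at most \<open>2 powr (- (real n * E))\<close> up to subexponential factors, whichever
  term governs it.\<close>

lemma achievability_eventually:
  fixes P :: "'x::finite pmf" and d :: "'x \<Rightarrow> 'y::finite \<Rightarrow> real" and d_e :: "'x \<Rightarrow> 'v::finite \<Rightarrow> real"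
  assumes P: "set_pmf P = UNIV" and d: "\<And>x. \<exists>y. d x y \<le> D" and de: "\<And>x. \<exists>v. d_e x v \<le> D_e"
    and R: "\<And>Q. KL Q P \<le> \<alpha> \<Longrightarrow> rate_dist d Q D < R" and R0: "R > 0" and r: "r > 0"
    and E0: "\<And>Q. E \<le> KL Q P + rate_dist d_e Q D_e"
    and E1: "\<And>Q. KL Q P \<le> \<alpha> \<Longrightarrow> E - r \<le> KL Q P + max_cond_rate_dist d d_e Q R D D_e"
    and eps: "\<epsilon> > 0"
  shows "eventually (\<lambda>n. ereal (E - \<epsilon>) \<le> secrecy_exponent d d_e P D D_e R r \<alpha> n) sequentially"
proof -
  obtain m :: nat where m: "m > 0"
    "\<And>n Q. n \<ge> m \<Longrightarrow> is_type n Q \<Longrightarrow> KL Q P \<le> \<alpha> + 1 / real m \<Longrightarrow>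
       \<exists>J. is_type n J \<and> map_pmf fst J = Q \<and> cost d J \<le> D \<and> mutual_info J \<le> R - 1 / real m \<and>
         (E - r) - \<epsilon> / 2 \<le> KL Q P + cond_rate_dist d_e J D_e"
    using achievability_selection[where \<epsilon> = "\<epsilon> / 2" and E = "E - r", OF P d de R E1] eps by auto
  \<comment> \<open>Degrees of the polynomial losses: \<open>A0\<close> and \<open>A1\<close> from
    the blind and the conditional ball bound, \<open>A2\<close> from the rate condition (message
    splitting, Stirling, a logarithm), \<open>A3\<close> from the final sum over types.\<close>
  define A0 where "A0 = CARD('x) * CARD('v) + (CARD('x) + CARD('v))"
  define A1 where "A1 = CARD('x) * CARD('y) * CARD('v) + (CARD('x) * CARD('y) + CARD('y) * CARD('v))"
  define A2 where "A2 = CARD('x) + CARD('x) * CARD('y) + 1"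
  define A3 where "A3 = CARD('x) + (A0 + A1 + 1)"
  \<comment> \<open>Per-letter bounds for the two logarithms that occur, from ln k \<le> k for
    alphabet sizes and ln 2 < 1 for bit strings.\<close>
  define c1 where "c1 = real CARD('x) + r"
  define c2 where "c2 = R + real CARD('v)"
  have c1: "c1 \<ge> 0" and c2: "c2 \<ge> 0" using r R0 by (auto simp: c1_def c2_def)
  have m0: "1 / real m > 0" using m(1) by simp
  have lin: "1 + real n * c \<le> (1 + c) * pc n 1" if "c \<ge> 0" for n c
  proof -
    have "1 + real n * c \<le> (1 + c) * (real n + 1)" using that by (simp add: algebra_simps)
    also have "\<dots> \<le> (1 + c) * pc n 1" using that unfolding pc_def by (intro mult_left_mono) auto
    finally show ?thesis .
  qed
  have ev1: "eventually (\<lambda>n. 2 * pc n CARD('x) \<le> 2 powr (real n * R)) sequentially"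
    by (rule pc_eventually[OF R0])
  have ev2: "eventually (\<lambda>n. (16 * (1 + c1)) * pc n A2 \<le> 2 powr (real n * (1 / real m))) sequentially"
    by (rule pc_eventually[OF m0])
  have ev3: "eventually (\<lambda>n. 1 * pc n CARD('x) \<le> 2 powr (real n * (1 / real m))) sequentially"
    by (rule pc_eventually[OF m0])
  have "\<epsilon> / 2 > 0" using eps by simp
  have ev4: "eventually (\<lambda>n. (8 + 8 * (1 + c2)) * pc n A3 \<le> 2 powr (real n * (\<epsilon> / 2))) sequentially"
    by (rule pc_eventually[OF \<open>\<epsilon> / 2 > 0\<close>])
  have ev5: "eventually (\<lambda>n. n \<ge> m) sequentially" by (rule eventually_ge_at_top)
  show ?thesis
    using ev1 ev2 ev3 ev4 ev5
  proof eventually_elim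
    case (elim n)
    have n: "n > 0" using elim(5) m(1) by simp
    define C where "C = {Q. is_type n Q \<and> KL Q P \<le> \<alpha> + 1 / real m}"
    have "\<forall>Q\<in>C. \<exists>J. is_type n J \<and> map_pmf fst J = Q \<and> cost d J \<le> D \<and> mutual_info J \<le> R - 1 / real m \<and>
         (E - r) - \<epsilon> / 2 \<le> KL Q P + cond_rate_dist d_e J D_e"
      using m(2)[OF elim(5)] by (auto simp: C_def)
    from bchoice[OF this] obtain Js where Js0: "\<forall>Q\<in>C. is_type n (Js Q) \<and> map_pmf fst (Js Q) = Q \<and> cost d (Js Q) \<le> D \<and>
         mutual_info (Js Q) \<le> R - 1 / real m \<and> (E - r) - \<epsilon> / 2 \<le> KL Q P + cond_rate_dist d_e (Js Q) D_e" ..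
    then have Js: "is_type n (Js Q)" "map_pmf fst (Js Q) = Q" "cost d (Js Q) \<le> D"
      "mutual_info (Js Q) \<le> R - 1 / real m" "(E - r) - \<epsilon> / 2 \<le> KL Q P + cond_rate_dist d_e (Js Q) D_e" if "Q \<in> C" for Q
      using that by blast+
    let ?TT = "{Q :: 'x pmf. is_type n Q}"
    have cT: "real (card ?TT) \<le> pc n CARD('x)" by (rule card_types_pc[OF n])
    have bR: "real (card (bits n R)) \<le> 2 powr (real n * R)" "2 powr (real n * R) \<le> 2 * real (card (bits n R))"
      using card_bits_bounds[of R n] R0 by auto
    have br: "real (card (bits n r)) \<le> 2 powr (real n * r)" "2 powr (real n * r) \<le> 2 * real (card (bits n r))"
      using card_bits_bounds[of r n] r by auto
    have cK: "real (card (bits n r)) > 0" by (simp add: card_gt_0_iff)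
    have posT: "card ?TT > 0"
    proof -
      have "emp (replicate n undefined) \<in> ?TT" using n by (simp add: is_type_emp)
      then show ?thesis using card_types(1)[OF n] by (auto simp: card_gt_0_iff)
    qed
    \<comment> \<open>Integer division loses at most a factor 2 once the quotient is at least 1,
      which holds because messages eventually outnumber types.\<close>
    have half: "real (card (bits n R)) / (2 * pc n CARD('x)) \<le> real (card (bits n R) div card ?TT)"
    proof -
      have "card ?TT \<le> card (bits n R)" using cT elim(1) bR(2) by linarith
      then have "card (bits n R) \<le> 2 * (card (bits n R) div card ?TT * card ?TT)"
      proof -
        assume le: "card ?TT \<le> card (bits n R)"
        have "card (bits n R) mod card ?TT < card ?TT" using posT by simp
        moreover have "card (bits n R) div card ?TT \<ge> 1" using le posT by (simp add: div_greater_zero_iff Suc_le_eq)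
        then have "card ?TT \<le> card (bits n R) div card ?TT * card ?TT" by simp
        ultimately show ?thesis using div_mult_mod_eq[of "card (bits n R)" "card ?TT"] by linarith
      qed
      then have "real (card (bits n R)) \<le> 2 * (real (card (bits n R) div card ?TT) * real (card ?TT))"
      proof -
        assume "card (bits n R) \<le> 2 * (card (bits n R) div card ?TT * card ?TT)"
        then have "real (card (bits n R)) \<le> real (2 * (card (bits n R) div card ?TT * card ?TT))" by (rule of_nat_mono)
        also have "\<dots> = 2 * (real (card (bits n R) div card ?TT) * real (card ?TT))"
          by (simp only: of_nat_mult of_nat_numeral)
        finally show ?thesis .
      qed
      also have "\<dots> \<le> 2 * (real (card (bits n R) div card ?TT) * pc n CARD('x))"
        using cT by (intro mult_left_mono) auto
      finally show ?thesis by (simp add: pos_divide_le_eq mult_ac)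
    qed
    define a where "a = 1 + ln (real (card (bits n R)) * real CARD('v) ^ n)"
    have a_le: "a \<le> (1 + c2) * pc n 1"
    proof -
      have cR: "real (card (bits n R)) > 0" by (simp add: card_gt_0_iff)
      have "ln (real (card (bits n R))) \<le> ln (2 powr (real n * R))" using bR(1) cR by (subst ln_le_cancel_iff) auto
      also have "\<dots> = real n * R * ln 2" by (simp add: ln_powr)
      also have "\<dots> \<le> real n * R * 1" using R0 ln_2_less_1 by (intro mult_left_mono) auto
      finally have 1: "ln (real (card (bits n R))) \<le> real n * R" by simp
      have "ln (real CARD('v)) \<le> real CARD('v)" using ln_le_minus_one[of "real CARD('v)"] by simp
      then have "real n * ln (real CARD('v)) \<le> real n * real CARD('v)" by (intro mult_left_mono) auto
      then have 2: "ln (real CARD('v) ^ n) \<le> real n * real CARD('v)" by (simp add: ln_realpow)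
      have "a \<le> 1 + real n * c2" unfolding a_def c2_def using 1 2 cR by (simp add: ln_mult algebra_simps)
      also have "\<dots> \<le> (1 + c2) * pc n 1" by (rule lin[OF c2])
      finally show ?thesis .
    qed
    have a_nn: "a \<ge> 0"
    proof -
      have "card (bits n R) > 0" "CARD('v) ^ n > 0" by (simp_all add: card_gt_0_iff)
      then have "1 \<le> card (bits n R) * CARD('v) ^ n" by (simp add: Suc_le_eq)
      then have "real 1 \<le> real (card (bits n R) * CARD('v) ^ n)" by (rule of_nat_mono)
      then have "1 \<le> real (card (bits n R)) * real CARD('v) ^ n" by simp
      then show ?thesis unfolding a_def by (simp add: add_nonneg_nonneg)
    qed
    have "\<exists>f \<in> reliable_encoders n d P D R r \<alpha>. \<forall>g \<in> bits n R \<rightarrow> seqs n.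
      eavesdropper_prob n d_e P D_e r f g \<le>
        (\<Sum>Q | is_type n Q. measure_pmf.prob (replicate_pmf n P) (tclass n Q) *
          (if Q \<in> C then 4 * (2 * (pc n A0 * 2 powr (- (real n * rate_dist d_e Q D_e))) +
             a * (pc n A1 * 2 powr (- (real n * cond_rate_dist d_e (Js Q) D_e))) / real (card (bits n r)))
           else pc n A0 * 2 powr (- (real n * rate_dist d_e Q D_e))))"
      unfolding a_def A0_def A1_def
    proof (rule achievability_block[where C = C and Js = Js, OF n P Js(1-3)])
      fix Q assume Q: "Q \<in> C"
      have QT: "is_type n Q" using Q by (simp add: C_def)
      let ?X = "real (card (tclass n Q))" and ?Y = "real (card (tclass n (map_pmf snd (Js Q))))"
      let ?p = "real (card (tclass n (Js Q))) / (?X * ?Y)"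
      have X: "?X > 0" using is_type_tclass_pos[OF QT n] by simp
      have Y: "?Y > 0" using is_type_tclass_pos[OF is_type_map[OF Js(1)[OF Q]] n] by simp
      have "?X * ?Y * 2 powr (- (real n * mutual_info (Js Q))) \<le> real (card (tclass n (Js Q))) * pc n (CARD('x) * CARD('y))"
        using mutual_info_count(2)[OF n Js(1)[OF Q]] by (simp only: Js(2)[OF Q])
      then have "2 powr (- (real n * mutual_info (Js Q))) \<le> ?p * pc n (CARD('x) * CARD('y))"
        using mult_pos_pos[OF X Y] by (simp add: pos_le_divide_eq mult_ac)
      moreover have "2 powr (- (real n * (R - 1 / real m))) \<le> 2 powr (- (real n * mutual_info (Js Q)))"
        using Js(4)[OF Q] by (simp add: mult_left_mono)
      ultimately have p: "2 powr (- (real n * (R - 1 / real m))) \<le> ?p * pc n (CARD('x) * CARD('y))" by linarith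
      have ln: "1 + ln (?X * real (card (bits n r))) \<le> (1 + c1) * pc n 1"
      proof -
        have "tclass n Q \<subseteq> {xs. set xs \<subseteq> UNIV \<and> length xs = n}" by (auto simp: tclass_def)
        from card_mono[OF finite_lists_length_eq[OF finite] this]
        have "card (tclass n Q) \<le> CARD('x) ^ n" using card_lists_length_eq[of "UNIV :: 'x set" n] by simp
        then have "?X \<le> real (CARD('x) ^ n)" by (rule of_nat_mono)
        then have "?X \<le> real CARD('x) ^ n" by simp
        then have "ln ?X \<le> ln (real CARD('x) ^ n)" using X by simp
        also have "\<dots> = real n * ln (real CARD('x))" by (simp add: ln_realpow)
        also have "\<dots> \<le> real n * real CARD('x)"
          using ln_le_minus_one[of "real CARD('x)"] by (intro mult_left_mono) auto
        finally have 1: "ln ?X \<le> real n * real CARD('x)" .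
        have "ln (real (card (bits n r))) \<le> ln (2 powr (real n * r))" using br(1) cK by (subst ln_le_cancel_iff) auto
        also have "\<dots> = real n * r * ln 2" by (simp add: ln_powr)
        also have "\<dots> \<le> real n * r * 1" using r ln_2_less_1 by (intro mult_left_mono) auto
        finally have 2: "ln (real (card (bits n r))) \<le> real n * r" by simp
        have "1 + ln (?X * real (card (bits n r))) \<le> 1 + real n * c1"
          unfolding ln_mult_pos[OF X cK] c1_def using 1 2 by (simp add: distrib_left)
        also have "\<dots> \<le> (1 + c1) * pc n 1" by (rule lin[OF c1])
        finally show ?thesis .
      qed
      \<comment> \<open>16 = 4 * 2 * 2: the quarter in the rate condition, the integer division, and
        the rounding of n R.\<close>
      have "(1 + c1) * pc n 1 * (16 * (pc n CARD('x) * pc n (CARD('x) * CARD('y)))) = (16 * (1 + c1)) * pc n A2"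
        unfolding A2_def pc_mult[symmetric] by (simp only: mult_ac)
      also have "\<dots> \<le> 2 powr (real n * (1 / real m))" by (rule elim(2))
      also have "\<dots> = 2 powr (real n * R) * 2 powr (- (real n * (R - 1 / real m)))"
        by (simp add: powr_add[symmetric] algebra_simps)
      also have "\<dots> \<le> (2 * real (card (bits n R))) * (?p * pc n (CARD('x) * CARD('y)))"
        using bR(2) p by (intro mult_mono) auto
      finally have "(1 + c1) * pc n 1 * (8 * pc n CARD('x)) * (2 * pc n (CARD('x) * CARD('y))) \<le> real (card (bits n R)) * ?p * (2 * pc n (CARD('x) * CARD('y)))"
        by (simp only: mult_ac)
      then have "(1 + c1) * pc n 1 * (8 * pc n CARD('x)) \<le> real (card (bits n R)) * ?p"
        by (rule mult_right_le_imp_le) simp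
      then have "(1 + c1) * pc n 1 \<le> real (card (bits n R)) * ?p / (8 * pc n CARD('x))"
        by (subst pos_le_divide_eq) auto
      also have "\<dots> = real (card (bits n R)) / (2 * pc n CARD('x)) * ?p / 4" by simp
      also have "\<dots> \<le> real (card (bits n R) div card ?TT) * ?p / 4"
        using half by (intro divide_right_mono mult_right_mono) auto
      finally show "1 + ln (?X * real (card (bits n r))) \<le> real (card (bits n R) div card ?TT) * ?p / 4"
        using ln by linarith
    next
      \<comment> \<open>The number of types is at most
        \<open>2 powr (real n * (1 / real m))\<close>, which cancels the surplus 1/m in divergence
        and leaves exactly the permitted error.\<close>
      have "(\<Sum>Q | is_type n Q \<and> Q \<notin> C. measure_pmf.prob (replicate_pmf n P) (tclass n Q))
        \<le> (\<Sum>Q | is_type n Q \<and> Q \<notin> C. 2 powr (- (real n * (\<alpha> + 1 / real m))))"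
      proof (rule sum_mono)
        fix Q assume "Q \<in> {Q. is_type n Q \<and> Q \<notin> C}"
        then have "\<alpha> + 1 / real m \<le> KL Q P" by (auto simp: C_def)
        then have "real n * (\<alpha> + 1 / real m) \<le> real n * KL Q P" by (intro mult_left_mono) auto
        then have "2 powr (- (real n * KL Q P)) \<le> 2 powr (- (real n * (\<alpha> + 1 / real m)))" by simp
        then show "measure_pmf.prob (replicate_pmf n P) (tclass n Q) \<le> 2 powr (- (real n * (\<alpha> + 1 / real m)))"
          using prob_tclass_bounds(1)[OF n P, of Q] by linarith
      qed
      also have "\<dots> = real (card {Q. is_type n Q \<and> Q \<notin> C}) * 2 powr (- (real n * (\<alpha> + 1 / real m)))" by simp
      also have "\<dots> \<le> 2 powr (real n * (1 / real m)) * 2 powr (- (real n * (\<alpha> + 1 / real m)))"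
      proof (rule mult_right_mono)
        have "card {Q. is_type n Q \<and> Q \<notin> C} \<le> card ?TT" by (rule card_mono[OF card_types(1)[OF n]]) auto
        then show "real (card {Q. is_type n Q \<and> Q \<notin> C}) \<le> 2 powr (real n * (1 / real m))" using cT elim(3) by linarith
      qed simp
      also have "\<dots> = 2 powr (- (real n * \<alpha>))" by (simp add: powr_add[symmetric] algebra_simps)
      finally show "(\<Sum>Q | is_type n Q \<and> Q \<notin> C. measure_pmf.prob (replicate_pmf n P) (tclass n Q)) \<le> 2 powr (- (real n * \<alpha>))" .
    qed
    then obtain f where f: "f \<in> reliable_encoders n d P D R r \<alpha>"
      and fg: "\<And>g. g \<in> bits n R \<rightarrow> seqs n \<Longrightarrow> eavesdropper_prob n d_e P D_e r f g \<le>
        (\<Sum>Q | is_type n Q. measure_pmf.prob (replicate_pmf n P) (tclass n Q) *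
          (if Q \<in> C then 4 * (2 * (pc n A0 * 2 powr (- (real n * rate_dist d_e Q D_e))) +
             a * (pc n A1 * 2 powr (- (real n * cond_rate_dist d_e (Js Q) D_e))) / real (card (bits n r)))
           else pc n A0 * 2 powr (- (real n * rate_dist d_e Q D_e))))" by blast
    let ?z = "2 powr (- (real n * (E - \<epsilon> / 2)))"
    \<comment> \<open>In 8 + 8 (1 + c2) both terms carry the 4 of
      \<open>achievability_block\<close>; the blind term adds the Chernoff factor 2, the other one
      the factor 1 + c2 from a and 2 from rounding n r.\<close>
    have each: "measure_pmf.prob (replicate_pmf n P) (tclass n Q) *
          (if Q \<in> C then 4 * (2 * (pc n A0 * 2 powr (- (real n * rate_dist d_e Q D_e))) +
             a * (pc n A1 * 2 powr (- (real n * cond_rate_dist d_e (Js Q) D_e))) / real (card (bits n r)))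
           else pc n A0 * 2 powr (- (real n * rate_dist d_e Q D_e))) \<le> (8 + 8 * (1 + c2)) * pc n (A0 + A1 + 1) * ?z"
      (is "?pr * ?s \<le> ?rhs") if "is_type n Q" for Q
    proof -
      let ?u = "2 powr (- (real n * KL Q P))"
      have pr: "?pr \<le> ?u" by (rule prob_tclass_bounds(1)[OF n P])
      have b1: "?u * 2 powr (- (real n * rate_dist d_e Q D_e)) \<le> ?z"
      proof -
        have "real n * (E - \<epsilon> / 2) \<le> real n * (KL Q P + rate_dist d_e Q D_e)"
          using E0[of Q] eps by (intro mult_left_mono) auto
        then show ?thesis by (simp add: powr_add[symmetric] distrib_left)
      qed
      have pA: "pc n A0 \<le> pc n (A0 + A1 + 1)" "pc n 1 * pc n A1 \<le> pc n (A0 + A1 + 1)"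
        unfolding pc_mult by (auto intro!: pc_mono)
      have t1: "?u * (pc n A0 * 2 powr (- (real n * rate_dist d_e Q D_e))) \<le> pc n (A0 + A1 + 1) * ?z"
      proof -
        have "?u * (pc n A0 * 2 powr (- (real n * rate_dist d_e Q D_e))) = pc n A0 * (?u * 2 powr (- (real n * rate_dist d_e Q D_e)))" by simp
        also have "\<dots> \<le> pc n (A0 + A1 + 1) * ?z" using pA b1 by (intro mult_mono) auto
        finally show ?thesis .
      qed
      show ?thesis
      proof (cases "Q \<in> C")
        case True
        let ?g = "2 powr (- (real n * cond_rate_dist d_e (Js Q) D_e))"
        have "1 / real (card (bits n r)) \<le> 2 * 2 powr (- (real n * r))"
          using br(2) cK by (simp add: powr_minus field_simps)
        then have "?u * ?g * (1 / real (card (bits n r))) \<le> ?u * ?g * (2 * 2 powr (- (real n * r)))"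
          by (intro mult_left_mono) auto
        also have "\<dots> = 2 * 2 powr (- (real n * (KL Q P + cond_rate_dist d_e (Js Q) D_e + r)))"
          by (simp add: powr_add[symmetric] algebra_simps)
        also have "\<dots> \<le> 2 * ?z"
        proof -
          have "real n * (E - \<epsilon> / 2) \<le> real n * (KL Q P + cond_rate_dist d_e (Js Q) D_e + r)"
            using Js(5)[OF True] by (intro mult_left_mono) auto
          then show ?thesis by simp
        qed
        finally have b2: "?u * ?g * (1 / real (card (bits n r))) \<le> 2 * ?z" .
        have "?u * (a * (pc n A1 * ?g) / real (card (bits n r))) = a * pc n A1 * (?u * ?g * (1 / real (card (bits n r))))" by simp
        also have "\<dots> \<le> ((1 + c2) * pc n 1) * pc n A1 * (2 * ?z)"
          by (rule mult_mono[OF mult_right_mono[OF a_le] b2]) (use c2 in \<open>auto intro!: mult_nonneg_nonneg\<close>)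
        also have "\<dots> = (1 + c2) * 2 * ?z * (pc n 1 * pc n A1)" by (simp only: mult_ac)
        also have "\<dots> \<le> (1 + c2) * 2 * ?z * pc n (A0 + A1 + 1)" using pA c2 by (intro mult_left_mono) auto
        finally have t2: "?u * (a * (pc n A1 * ?g) / real (card (bits n r))) \<le> (1 + c2) * 2 * ?z * pc n (A0 + A1 + 1)" .
        have s_nn: "?s \<ge> 0" using a_nn True by (auto intro!: add_nonneg_nonneg mult_nonneg_nonneg divide_nonneg_nonneg)
        have "?pr * ?s \<le> ?u * ?s" using pr s_nn by (intro mult_right_mono)
        also have "\<dots> = 8 * (?u * (pc n A0 * 2 powr (- (real n * rate_dist d_e Q D_e)))) + 4 * (?u * (a * (pc n A1 * ?g) / real (card (bits n r))))"
          using True by (simp add: distrib_left)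
        also have "\<dots> \<le> 8 * (pc n (A0 + A1 + 1) * ?z) + 4 * ((1 + c2) * 2 * ?z * pc n (A0 + A1 + 1))"
          using t1 t2 by (intro add_mono mult_left_mono) auto
        also have "\<dots> = ?rhs" by (simp add: algebra_simps)
        finally show ?thesis .
      next
        case False
        have "?pr * ?s \<le> ?u * (pc n A0 * 2 powr (- (real n * rate_dist d_e Q D_e)))"
          using pr False by (simp add: mult_right_mono)
        also have "\<dots> \<le> 1 * (pc n (A0 + A1 + 1) * ?z)" using t1 by simp
        also have "\<dots> \<le> (8 + 8 * (1 + c2)) * (pc n (A0 + A1 + 1) * ?z)" using c2 by (intro mult_right_mono) auto
        finally show ?thesis by (simp only: mult.assoc)
      qed
    qed
    have "ereal (E - \<epsilon>) \<le> prob_exponent n (eavesdropper_prob n d_e P D_e r f g)" if g: "g \<in> bits n R \<rightarrow> seqs n" for g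
    proof (rule prob_exponent_ge[OF n])
      show "0 \<le> eavesdropper_prob n d_e P D_e r f g" by (simp add: eavesdropper_prob_def)
      have "eavesdropper_prob n d_e P D_e r f g \<le> (\<Sum>Q\<in>?TT. (8 + 8 * (1 + c2)) * pc n (A0 + A1 + 1) * ?z)"
        by (rule order.trans[OF fg[OF g]], rule sum_mono, rule each) simp
      also have "\<dots> = real (card ?TT) * ((8 + 8 * (1 + c2)) * pc n (A0 + A1 + 1) * ?z)" by simp
      also have "\<dots> \<le> pc n CARD('x) * ((8 + 8 * (1 + c2)) * pc n (A0 + A1 + 1) * ?z)"
        using cT c2 by (intro mult_right_mono) auto
      also have "\<dots> = (8 + 8 * (1 + c2)) * pc n A3 * ?z"
        unfolding A3_def pc_mult[symmetric] by (simp only: mult_ac)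
      also have "\<dots> \<le> 2 powr (real n * (\<epsilon> / 2)) * ?z" using elim(4) by (intro mult_right_mono) auto
      also have "\<dots> = 2 powr (- (real n * (E - \<epsilon>)))" by (simp add: powr_add[symmetric] algebra_simps)
      finally show "eavesdropper_prob n d_e P D_e r f g \<le> 2 powr (- (real n * (E - \<epsilon>)))" .
    qed
    then show ?case unfolding secrecy_exponent_def by (intro SUP_upper2[OF f] INF_greatest)
  qed
qed


lemma converse_blind_eventually:
  fixes P :: "'x::finite pmf" and d :: "'x \<Rightarrow> 'y::finite \<Rightarrow> real" and d_e :: "'x \<Rightarrow> 'v::finite \<Rightarrow> real"
  assumes P: "set_pmf P = UNIV" and de: "\<And>x. \<exists>v. d_e x v \<le> D_e"
    and e: "KL Q P + rate_dist d_e Q D_e < E"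
  shows "eventually (\<lambda>n. secrecy_exponent d d_e P D D_e R r \<alpha> n \<le> ereal E) sequentially"
proof -
  \<comment> \<open>The gap between e' and E absorbs the polynomial factors.\<close>
  obtain e' where e': "KL Q P + rate_dist d_e Q D_e < e'" "e' < E" using e dense by blast
  define B where "B = CARD('x) * CARD('v) + 1"
  have ev1: "eventually (\<lambda>n. \<exists>Q' L. is_type n Q' \<and> is_type n L \<and> map_pmf fst L = unit_ext Q' \<and> cost_v d_e L \<le> D_e \<and>
    KL Q' P + cond_mutual_info L < e') sequentially"
    by (rule blind_selection[OF P de e'(1)])
  have ev2: "eventually (\<lambda>n. 1 * pc n (CARD('x) + B) \<le> 2 powr (real n * (E - e'))) sequentially"
    using e'(2) by (intro pc_eventually) simp
  have ev3: "eventually (\<lambda>n. n > 0) sequentially" by (rule eventually_gt_at_top)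
  show ?thesis
    using ev1 ev2 ev3
  proof eventually_elim
    case (elim n)
    then obtain Q' and L :: "(('x \<times> unit) \<times> 'v) pmf" where QL: "is_type n Q'" "is_type n L" "map_pmf fst L = unit_ext Q'" "cost_v d_e L \<le> D_e"
      "KL Q' P + cond_mutual_info L < e'" by blast
    have n: "n > 0" by (rule elim)
    show ?case
      unfolding secrecy_exponent_def
    proof (rule SUP_least)
      fix f assume "f \<in> reliable_encoders n d P D R r \<alpha>"
      then have f: "f \<in> encoders n R r" by (simp add: reliable_encoders_def)
      obtain g where g: "g \<in> bits n R \<rightarrow> seqs n"
        "measure_pmf.prob (replicate_pmf n P) (tclass n Q') * 2 powr (- (real n * cond_mutual_info L)) \<le> pc n B * eavesdropper_prob n d_e P D_e r f g"
        using converse_blind[where P = P, OF n f QL(2-4)] unfolding B_def by blast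
      let ?pr = "measure_pmf.prob (replicate_pmf n P) (tclass n Q')" and ?ev = "eavesdropper_prob n d_e P D_e r f g"
      have ev0: "?ev \<ge> 0" by (simp add: eavesdropper_prob_def)
      have "real n * (KL Q' P + cond_mutual_info L) \<le> real n * e'" using QL(5) by (intro mult_left_mono) auto
      then have "2 powr (- (real n * e')) \<le> 2 powr (- (real n * KL Q' P)) * 2 powr (- (real n * cond_mutual_info L))"
        by (simp add: powr_add[symmetric] distrib_left)
      also have "\<dots> \<le> (?pr * pc n CARD('x)) * 2 powr (- (real n * cond_mutual_info L))"
        using prob_tclass_bounds(2)[OF n P QL(1)] by (intro mult_right_mono) auto
      also have "\<dots> = pc n CARD('x) * (?pr * 2 powr (- (real n * cond_mutual_info L)))" by (simp only: mult_ac)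
      also have "\<dots> \<le> pc n CARD('x) * (pc n B * ?ev)" using g(2) by (intro mult_left_mono) auto
      also have "\<dots> = (1 * pc n (CARD('x) + B)) * ?ev" by (simp add: pc_mult[symmetric])
      also have "\<dots> \<le> 2 powr (real n * (E - e')) * ?ev" using elim(2) ev0 by (intro mult_right_mono) auto
      finally have "2 powr (- (real n * (E - e'))) * 2 powr (- (real n * e')) \<le> 2 powr (- (real n * (E - e'))) * (2 powr (real n * (E - e')) * ?ev)"
        by (intro mult_left_mono) auto
      moreover have "2 powr (- (real n * (E - e'))) * (2 powr (real n * (E - e')) * ?ev) = ?ev"
        by (simp only: mult.assoc[symmetric] powr_add[symmetric]) simp
      moreover have "2 powr (- (real n * (E - e'))) * 2 powr (- (real n * e')) = 2 powr (- (real n * E))"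
        by (simp add: powr_add[symmetric] algebra_simps)
      ultimately have "2 powr (- (real n * E)) \<le> ?ev" by simp
      then have "prob_exponent n ?ev \<le> ereal E" by (rule prob_exponent_le[OF n])
      then show "(INF g\<in>bits n R \<rightarrow> seqs n. prob_exponent n (eavesdropper_prob n d_e P D_e r f g)) \<le> ereal E"
        by (rule INF_lower2[OF g(1)])
    qed
  qed
qed

lemma converse_key_guess_eventually:
  fixes P :: "'x::finite pmf" and d :: "'x \<Rightarrow> 'y::finite \<Rightarrow> real" and d_e :: "'x \<Rightarrow> 'v::finite \<Rightarrow> real"
  assumes P: "set_pmf P = UNIV" and de: "\<And>x. \<exists>v. d_e x v \<le> D_e" and \<alpha>: "\<alpha> > 0" and r: "r > 0" and R0: "R \<ge> 0"
    and Q0: "KL Q0 P \<le> \<alpha>" and e: "r + (KL Q0 P + max_cond_rate_dist d d_e Q0 R D D_e) < E"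
  shows "eventually (\<lambda>n. secrecy_exponent d d_e P D D_e R r \<alpha> n \<le> ereal E) sequentially"
proof -
  let ?G = "max_cond_rate_dist d d_e Q0 R D D_e"
  \<comment> \<open>One third of the gap each for the choice of L, for the divergence of the
    attacked type, and for the polynomial factors.\<close>
  define \<epsilon> where "\<epsilon> = (E - (r + (KL Q0 P + ?G))) / 3"
  have eps: "\<epsilon> > 0" using e by (simp add: \<epsilon>_def)
  obtain m :: nat where m: "m > 0"
    "\<And>n J. n \<ge> m \<Longrightarrow> is_type n J \<Longrightarrow> (\<And>x. \<bar>pmf (map_pmf fst J) x - pmf Q0 x\<bar> \<le> 1 / real m) \<Longrightarrow>
      cost d J \<le> D \<Longrightarrow> mutual_info J \<le> R + 1 / real m \<Longrightarrow>
      \<exists>L. is_type n L \<and> map_pmf fst L = J \<and> cost_v d_e L \<le> D_e \<and> cond_mutual_info L \<le> ?G + \<epsilon>"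
  proof (rule converse_selection[where ?Q0.0 = Q0 and d = d and D = D and R = R and d_e = d_e, OF de eps])
    fix m :: nat
    assume 1: "m > 0" and 2: "\<And>n J. n \<ge> m \<Longrightarrow> is_type n J \<Longrightarrow> (\<And>x. \<bar>pmf (map_pmf fst J) x - pmf Q0 x\<bar> \<le> 1 / real m) \<Longrightarrow>
      cost d J \<le> D \<Longrightarrow> mutual_info J \<le> R + 1 / real m \<Longrightarrow>
      \<exists>L. is_type n L \<and> map_pmf fst L = J \<and> cost_v d_e L \<le> D_e \<and> cond_mutual_info L \<le> ?G + \<epsilon>"
    show thesis by (rule that[OF 1 2])
  qed
  have m0: "1 / real m > 0" using m(1) by simp
  \<comment> \<open>Half of the tolerance 1/m goes into mixing with P, half into approximating the
    mixture by a type.\<close>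
  define t where "t = 1 / (2 * real m)"
  have t: "0 < t" "t \<le> 1" using m(1) by (auto simp: t_def divide_le_eq_1)
  \<comment> \<open>\<open>Q0\<close> may lie on the boundary of the divergence ball, where its
    class need not be more probable than the permitted error.\<close>
  define Qt where "Qt = mix_pmf t Q0 P"
  have Qt_close: "\<bar>pmf Qt x - pmf Q0 x\<bar> \<le> t" for x
  proof -
    have "pmf Qt x - pmf Q0 x = t * (pmf P x - pmf Q0 x)"
      using t by (simp add: Qt_def pmf_mix algebra_simps)
    moreover have "\<bar>pmf P x - pmf Q0 x\<bar> \<le> 1"
      using pmf_nonneg[of P x] pmf_nonneg[of Q0 x] pmf_le_1[of P x] pmf_le_1[of Q0 x] by linarith
    ultimately show ?thesis using t by (simp add: abs_mult mult_left_le)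
  qed
  have KLt: "KL Qt P \<le> (1 - t) * KL Q0 P" unfolding Qt_def using t by (intro KL_mix[OF P]) auto
  also have "\<dots> \<le> 1 * KL Q0 P" using t KL_nonneg[OF P, of Q0] by (intro mult_right_mono) auto
  finally have KLt1: "KL Qt P \<le> KL Q0 P" by simp
  have "(1 - t) * KL Q0 P \<le> (1 - t) * \<alpha>" using Q0 t by (intro mult_left_mono) auto
  also have "\<dots> < 1 * \<alpha>" using t \<alpha> by (intro mult_strict_right_mono) auto
  finally have KLt2: "KL Qt P < \<alpha>" using KLt by simp
  obtain X where X: "\<And>k. is_type (Suc k) (X k)" "pmf_tendsto X Qt" using types_dense by blast
  \<comment> \<open>The attacked type must stay strictly inside the ball, so that a polynomial
    factor fits between its probability and the permitted error.\<close>
  define \<delta> where "\<delta> = min \<epsilon> ((\<alpha> - KL Qt P) / 2)"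
  have \<delta>: "\<delta> > 0" "\<delta> \<le> \<epsilon>" "KL Qt P + \<delta> < \<alpha>" 
  proof -
    have half: "\<delta> \<le> (\<alpha> - KL Qt P) / 2" unfolding \<delta>_def by (rule min.cobounded2)
    show "\<delta> > 0" unfolding \<delta>_def using eps KLt2 by simp
    show "\<delta> \<le> \<epsilon>" unfolding \<delta>_def by (rule min.cobounded1)
    have "(\<alpha> - KL Qt P) / 2 < \<alpha> - KL Qt P" using KLt2 by simp
    with half have "\<delta> < \<alpha> - KL Qt P" by (rule le_less_trans)
    then show "KL Qt P + \<delta> < \<alpha>" by simp
  qed
  have "eventually (\<lambda>k. KL (X k) P < KL Qt P + \<delta>) sequentially"
    by (rule order_tendstoD(2)[OF KL_tendsto[OF P X(2)]]) (use \<delta> in simp)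
  moreover have "eventually (\<lambda>k. \<forall>x. \<bar>pmf (X k) x - pmf Qt x\<bar> < t) sequentially"
  proof (rule eventually_all_finite)
    fix x
    have "(\<lambda>k. pmf (X k) x) \<longlonglongrightarrow> pmf Qt x" using X(2) by (simp add: pmf_tendsto_def)
    from tendstoD[OF this t(1)] show "eventually (\<lambda>k. \<bar>pmf (X k) x - pmf Qt x\<bar> < t) sequentially" by (simp add: dist_real_def)
  qed
  ultimately have "eventually (\<lambda>k. \<exists>Q. is_type (Suc k) Q \<and> KL Q P < KL Qt P + \<delta> \<and> (\<forall>x. \<bar>pmf Q x - pmf Qt x\<bar> < t)) sequentially"
  proof eventually_elim
    case (elim k)
    then show ?case by (intro exI[of _ "X k"] conjI X(1)) auto
  qed
  then have ev1: "eventually (\<lambda>n. \<exists>Q. is_type n Q \<and> KL Q P < KL Qt P + \<delta> \<and> (\<forall>x. \<bar>pmf Q x - pmf Qt x\<bar> < t)) sequentially"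
    by (subst (asm) eventually_sequentially_Suc)
  define B where "B = CARD('x) * CARD('y) * CARD('v) + CARD('y)"
  define B' where "B' = CARD('x) + (CARD('x) * CARD('y) + B)"
  have ev2: "eventually (\<lambda>n. 4 * pc n (CARD('x) + CARD('y) + CARD('x) * CARD('y)) \<le> 2 powr (real n * (1 / real m))) sequentially"
    by (rule pc_eventually[OF m0])
  have ev3: "eventually (\<lambda>n. 4 * pc n B' \<le> 2 powr (real n * \<epsilon>)) sequentially"
    by (rule pc_eventually[OF eps])
  have ev4: "eventually (\<lambda>n. 4 * pc n CARD('x) \<le> 2 powr (real n * (\<alpha> - (KL Qt P + \<delta>)))) sequentially"
    by (rule pc_eventually) (use \<delta> in simp)
  have ev5: "eventually (\<lambda>n. n \<ge> m) sequentially" by (rule eventually_ge_at_top)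
  show ?thesis
    using ev1 ev2 ev3 ev4 ev5
  proof eventually_elim
    case (elim n)
    then obtain Q where Q: "is_type n Q" "KL Q P < KL Qt P + \<delta>" "\<And>x. \<bar>pmf Q x - pmf Qt x\<bar> < t" by blast
    have n: "n > 0" using elim(5) m(1) by simp
    have close: "\<bar>pmf Q x - pmf Q0 x\<bar> \<le> 1 / real m" for x
    proof -
      have "2 * t = 1 / real m" by (simp add: t_def)
      then show ?thesis using Q(3)[of x] Qt_close[of x] by linarith
    qed
    let ?pr = "measure_pmf.prob (replicate_pmf n P) (tclass n Q)"
    have lower: "2 powr (- (real n * KL Q P)) \<le> ?pr * pc n CARD('x)" by (rule prob_tclass_bounds(2)[OF n P Q(1)])
    have big: "4 * 2 powr (- (real n * \<alpha>)) \<le> ?pr"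
    proof -
      have "real n * KL Q P \<le> real n * (KL Qt P + \<delta>)" using Q(2) by (intro mult_left_mono) auto
      then have "2 powr (- (real n * (KL Qt P + \<delta>))) \<le> 2 powr (- (real n * KL Q P))" by simp
      with lower have l: "2 powr (- (real n * (KL Qt P + \<delta>))) \<le> ?pr * pc n CARD('x)" by linarith
      have "(4 * 2 powr (- (real n * \<alpha>))) * pc n CARD('x) = 2 powr (- (real n * \<alpha>)) * (4 * pc n CARD('x))" by simp
      also have "\<dots> \<le> 2 powr (- (real n * \<alpha>)) * 2 powr (real n * (\<alpha> - (KL Qt P + \<delta>)))"
        using elim(4) by (intro mult_left_mono) auto
      also have "\<dots> = 2 powr (- (real n * (KL Qt P + \<delta>)))" by (simp add: powr_add[symmetric] algebra_simps)
      also have "\<dots> \<le> ?pr * pc n CARD('x)" by (rule l)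
      finally show ?thesis by (rule mult_right_le_imp_le) simp
    qed
    show ?case
      unfolding secrecy_exponent_def
    proof (rule SUP_least)
      fix f assume "f \<in> reliable_encoders n d P D R r \<alpha>"
      then obtain h where f: "f \<in> encoders n R r" and h: "h \<in> decoders n R r"
        and exc: "excess_dist_prob n d P D r f h \<le> 2 powr (- (real n * \<alpha>))" by (auto simp: reliable_encoders_def)
      obtain J where J: "is_type n J" "map_pmf fst J = Q" "cost d J \<le> D" "mutual_info J \<le> R + 1 / real m"
        "?pr \<le> 4 * pc n (CARD('x) * CARD('y)) *
          (\<Sum>x\<in>tclass n Q. \<Sum>k\<in>bits n r. pmf (replicate_pmf n P) x / card (bits n r) *
            (\<Sum>m\<in>bits n R. pmf (f x k) m * measure_pmf.prob (h m k) {y. emp (zip x y) = J}))" (is "_ \<le> _ * ?A")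
        by (rule dominant_joint_type[OF n P f h exc Q(1) big R0 elim(2)])
      obtain L where L: "is_type n L" "map_pmf fst L = J" "cost_v d_e L \<le> D_e" "cond_mutual_info L \<le> ?G + \<epsilon>"
      proof -
        have "\<bar>pmf (map_pmf fst J) x - pmf Q0 x\<bar> \<le> 1 / real m" for x unfolding J(2) by (rule close)
        from m(2)[OF elim(5) J(1) this J(3,4)] show thesis using that by blast
      qed
      obtain g where g: "g \<in> bits n R \<rightarrow> seqs n"
        "?A * 2 powr (- (real n * cond_mutual_info L)) \<le> pc n B * real (card (bits n r)) * eavesdropper_prob n d_e P D_e r f g"
        unfolding B_def by (rule converse_key_guess[where P = P, OF n f h L(1-3) J(2)])
      let ?ev = "eavesdropper_prob n d_e P D_e r f g" and ?c = "2 powr (- (real n * cond_mutual_info L))"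
      have ev0: "?ev \<ge> 0" by (simp add: eavesdropper_prob_def)
      have "real n * (KL Q P + cond_mutual_info L) \<le> real n * (KL Q0 P + ?G + 2 * \<epsilon>)"
        using L(4) Q(2) KLt1 \<delta>(2) by (intro mult_left_mono) auto
      then have "2 powr (- (real n * (KL Q0 P + ?G + 2 * \<epsilon>))) \<le> 2 powr (- (real n * KL Q P)) * ?c"
        by (simp add: powr_add[symmetric] distrib_left)
      also have "\<dots> \<le> (?pr * pc n CARD('x)) * ?c" using lower by (intro mult_right_mono) auto
      also have "\<dots> \<le> ((4 * pc n (CARD('x) * CARD('y)) * ?A) * pc n CARD('x)) * ?c"
        using J(5) by (intro mult_right_mono) auto
      also have "\<dots> = (4 * pc n (CARD('x) * CARD('y)) * pc n CARD('x)) * (?A * ?c)" by (simp only: mult_ac)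
      also have "\<dots> \<le> (4 * pc n (CARD('x) * CARD('y)) * pc n CARD('x)) * (pc n B * real (card (bits n r)) * ?ev)"
        using g(2) by (intro mult_left_mono) auto
      also have "\<dots> = (4 * pc n B') * (real (card (bits n r)) * ?ev)" by (simp add: B'_def pc_mult[symmetric] mult_ac)
      also have "\<dots> \<le> 2 powr (real n * \<epsilon>) * (2 powr (real n * r) * ?ev)"
        by (rule mult_mono[OF elim(3) mult_right_mono[OF card_bits_bounds(1)[OF less_imp_le[OF r]] ev0]]) (use ev0 in auto)
      finally have "2 powr (- (real n * (\<epsilon> + r))) * 2 powr (- (real n * (KL Q0 P + ?G + 2 * \<epsilon>))) \<le>
        2 powr (- (real n * (\<epsilon> + r))) * (2 powr (real n * \<epsilon>) * (2 powr (real n * r) * ?ev))"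
        by (intro mult_left_mono) auto
      moreover have "2 powr (- (real n * (\<epsilon> + r))) * (2 powr (real n * \<epsilon>) * (2 powr (real n * r) * ?ev)) = ?ev"
        by (simp only: mult.assoc[symmetric] powr_add[symmetric]) (simp add: algebra_simps)
      moreover have "2 powr (- (real n * (\<epsilon> + r))) * 2 powr (- (real n * (KL Q0 P + ?G + 2 * \<epsilon>))) = 2 powr (- (real n * E))"
      proof -
        have "3 * \<epsilon> = E - (r + (KL Q0 P + ?G))" by (simp add: \<epsilon>_def)
        then have E: "E = \<epsilon> + r + (KL Q0 P + ?G + 2 * \<epsilon>)" by linarith
        show ?thesis unfolding powr_add[symmetric] by (subst E) (simp add: algebra_simps)
      qed
      ultimately have "2 powr (- (real n * E)) \<le> ?ev" by simp
      then have "prob_exponent n ?ev \<le> ereal E" by (rule prob_exponent_le[OF n])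
      then show "(INF g\<in>bits n R \<rightarrow> seqs n. prob_exponent n (eavesdropper_prob n d_e P D_e r f g)) \<le> ereal E"
        by (rule INF_lower2[OF g(1)])
    qed
  qed
qed

theorem theorem2:
  fixes P :: "'x::finite pmf"
    and d :: "'x \<Rightarrow> 'y::finite \<Rightarrow> real"
    and d_e :: "'x \<Rightarrow> 'v::finite \<Rightarrow> real"
    and D D_e \<alpha> r R :: real
  assumes "set_pmf P = UNIV"
    and "\<And>x y. d x y \<ge> 0"
    and "\<And>x v. d_e x v \<ge> 0"
    and "D \<ge> (MAX x. MIN y. d x y)"
    and "D_e \<ge> (MAX x. MIN v. d_e x v)"
    and "\<alpha> > 0"
    and "r > 0"
    and "R > (SUP Q \<in> {Q. KL Q P \<le> \<alpha>}. rate_dist d Q D)"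
  shows "(\<lambda>n. secrecy_exponent d d_e P D D_e R r \<alpha> n) \<longlonglongrightarrow>
           ereal (min (perfect_secrecy_exponent d_e P D_e)
                      (r + (INF Q \<in> {Q. KL Q P \<le> \<alpha>}.
                              KL Q P + max_cond_rate_dist d d_e Q R D D_e)))"
proof -
  note P = assms(1)
  have d: "\<exists>y. d x y \<le> D" for x by (rule exists_le_of_Max_Min[OF assms(4)])
  have de: "\<exists>v. d_e x v \<le> D_e" for x by (rule exists_le_of_Max_Min[OF assms(5)])
  have bddR: "bdd_above ((\<lambda>Q. rate_dist d Q D) ` {Q. KL Q P \<le> \<alpha>})"
    by (rule bdd_aboveI2[OF rate_dist_upper[OF d]])
  have R: "rate_dist d Q D < R" if "KL Q P \<le> \<alpha>" for Q
    using cSUP_upper[OF _ bddR, of Q] that assms(8) by simp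
  have PKL: "KL P P \<le> \<alpha>" using KL_self[OF P] assms(6) by simp
  \<comment> \<open>P itself lies in the divergence ball and has a nonnegative rate.\<close>
  have R0: "R > 0" using R[OF PKL] rate_dist_nonneg[where d = d and Q = P, OF d] by linarith
  let ?F = "\<lambda>Q. KL Q P + max_cond_rate_dist d d_e Q R D D_e"
  define E0 where "E0 = perfect_secrecy_exponent d_e P D_e"
  define I1 where "I1 = (INF Q \<in> {Q. KL Q P \<le> \<alpha>}. ?F Q)"
  \<comment> \<open>An infimum of reals is a lower bound only of a set bounded below; the crude
    entropy bounds supply this.\<close>
  have bdd1: "bdd_below (?F ` {Q. KL Q P \<le> \<alpha>})"
  proof (rule bdd_belowI2)
    fix Q assume "Q \<in> {Q. KL Q P \<le> \<alpha>}"
    then show "- 2 * real (CARD('x) * CARD('y) * CARD('v)) - 2 * real CARD('y) \<le> ?F Q"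
      using max_cond_rate_dist_lower[where d_e = d_e, OF R[of Q] d de] KL_nonneg[OF P, of Q] by auto
  qed
  have E0_le: "E0 \<le> KL Q P + rate_dist d_e Q D_e" for Q
    unfolding E0_def perfect_secrecy_exponent_def by (rule cINF_lower[OF bdd_below_secrecy[OF P de]]) simp
  have I1_le: "I1 \<le> ?F Q" if "KL Q P \<le> \<alpha>" for Q
    unfolding I1_def by (rule cINF_lower[OF bdd1]) (use that in simp)
  have ne: "{Q. KL Q P \<le> \<alpha>} \<noteq> {}" using PKL by blast
  have "(\<lambda>n. secrecy_exponent d d_e P D D_e R r \<alpha> n) \<longlonglongrightarrow> ereal (min E0 (r + I1))"
  proof (rule ereal_tendsto_realI)
    fix \<epsilon> :: real assume eps: "\<epsilon> > 0"
    show "eventually (\<lambda>n. ereal (min E0 (r + I1) - \<epsilon>) \<le> secrecy_exponent d d_e P D D_e R r \<alpha> n) sequentially"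
    proof (rule achievability_eventually[where d = d and d_e = d_e, OF P d de R R0 assms(7) _ _ eps])
      show "min E0 (r + I1) \<le> KL Q P + rate_dist d_e Q D_e" for Q using E0_le[of Q] by simp
      show "min E0 (r + I1) - r \<le> ?F Q" if "KL Q P \<le> \<alpha>" for Q using I1_le[OF that] by simp
    qed
    show "eventually (\<lambda>n. secrecy_exponent d d_e P D D_e R r \<alpha> n \<le> ereal (min E0 (r + I1) + \<epsilon>)) sequentially"
    \<comment> \<open>The attack belonging to the smaller term is used, and a point within
      \<epsilon> of the infimum replaces a minimiser.\<close>
    proof (cases "E0 \<le> r + I1")
      case True
      have "(INF Q. KL Q P + rate_dist d_e Q D_e) < E0 + \<epsilon>"
        using eps by (simp add: E0_def perfect_secrecy_exponent_def)
      from cInf_lessD[OF _ this] obtain Q where "KL Q P + rate_dist d_e Q D_e < E0 + \<epsilon>" by auto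
      from converse_blind_eventually[where d_e = d_e, OF P de this] show ?thesis using True by (simp add: min_def)
    next
      case False
      have "(INF Q \<in> {Q. KL Q P \<le> \<alpha>}. ?F Q) < I1 + \<epsilon>" using eps by (simp add: I1_def)
      from cInf_lessD[OF _ this] ne obtain Q where Q: "KL Q P \<le> \<alpha>" "?F Q < I1 + \<epsilon>" by auto
      then have "r + ?F Q < min E0 (r + I1) + \<epsilon>" using False by (simp add: min_def)
      then show ?thesis
        by (rule converse_key_guess_eventually[where d_e = d_e, OF P de assms(6,7) less_imp_le[OF R0] Q(1)])
    qed
  qed
  then show ?thesis by (simp only: E0_def I1_def)
qed

end
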